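(* Let $k$ be a finite field and $A$ a finitary $k$-algebra. The following conditions are equivalent: (i) $D(A)$ is an ideal of $\mathcal{H}(A)$; (ii) $A$ is serial, i.e. each indecomposable $A$-module is uniserial; (iii) $D_{r}(A)$ is an ideal of $\mathcal{H}(A)$ for all integers $r\geq 1$; (iv) $D_{r}(A)$ is an ideal of $\mathcal{H}(A)$ for some integer $r\geq 2$.
   Context: $k$ is a finite field with $q$ elements and $v=q^{1/2}$. For a $k$-algebra $A$, "$A$-module" means finite dimensional (over $k$) left $A$-module, and $A$-mod is the category of these. $A$ is finitary if $\mathrm{Ext}^1(S_1,S_2)$ is a finite group for any two (not necessarily different) simple objects $S_1,S_2$ of $A$-mod. The Hall algebra $\mathcal{H}(A)$ is the $\mathbb{Z}[v,v^{-1}]$-algebra with basis the set of isomorphism classes $[X]$ of $A$-modules and multiplication $[M]\diamond[N]=\sum_{[X]}F^X_{M,N}[X]$, where $F^X_{M,N}$ is the number of submodules $U$ of $X$ with $U\cong N$ and $X/U\cong M$. For an $A$-module $M$, $s(M)$ is the number of indecomposable direct summands in a decomposition of $M$ into indecomposables (with $s(0)=0$). For an integer $r\geq 1$, $D_r(A)$ is the $\mathbb{Z}[v,v^{-1}]$-span in $\mathcal{H}(A)$ of the $[M]$ with $s(M)\geq r+1$, and $D(A)=D_1(A)$. "Ideal" means two-sided ideal. *)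

theory Defs
  imports Complex_Main "HOL-Algebra.Ideal" "HOL-Algebra.Module"
begin

section \<open>Algebras and finite-dimensional left modules\<close>

text \<open>The locales \<^locale>\<open>algebra\<close> and \<^locale>\<open>module\<close> of HOL-Algebra only cover
  commutative algebras and modules over commutative rings, so the noncommutative versions are
  introduced here. Algebras are associative and unital (possibly zero, possibly of infinite
  dimension); modules are unital.\<close>

locale assoc_algebra = module K A + ring A
  for K :: "('k, 'm) ring_scheme" (structure) and A :: "('k, 'a, 'n) module_scheme" (structure) +
  assumes smult_mult_left: "\<lbrakk>c \<in> carrier K; a \<in> carrier A; b \<in> carrier A\<rbrakk>
      \<Longrightarrow> (c \<odot>\<^bsub>A\<^esub> a) \<otimes>\<^bsub>A\<^esub> b = c \<odot>\<^bsub>A\<^esub> (a \<otimes>\<^bsub>A\<^esub> b)"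
    and smult_mult_right: "\<lbrakk>c \<in> carrier K; a \<in> carrier A; b \<in> carrier A\<rbrakk>
      \<Longrightarrow> a \<otimes>\<^bsub>A\<^esub> (c \<odot>\<^bsub>A\<^esub> b) = c \<odot>\<^bsub>A\<^esub> (a \<otimes>\<^bsub>A\<^esub> b)"

locale left_module = A?: ring A + M?: abelian_group M
  for A :: "('a, 'm) ring_scheme" (structure) and M :: "('a, 'b, 'n) module_scheme" (structure) +
  assumes smult_closed: "\<lbrakk>a \<in> carrier A; x \<in> carrier M\<rbrakk> \<Longrightarrow> a \<odot>\<^bsub>M\<^esub> x \<in> carrier M"
    and smult_l_distr: "\<lbrakk>a \<in> carrier A; b \<in> carrier A; x \<in> carrier M\<rbrakk>
      \<Longrightarrow> (a \<oplus>\<^bsub>A\<^esub> b) \<odot>\<^bsub>M\<^esub> x = (a \<odot>\<^bsub>M\<^esub> x) \<oplus>\<^bsub>M\<^esub> (b \<odot>\<^bsub>M\<^esub> x)"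
    and smult_r_distr: "\<lbrakk>a \<in> carrier A; x \<in> carrier M; y \<in> carrier M\<rbrakk>
      \<Longrightarrow> a \<odot>\<^bsub>M\<^esub> (x \<oplus>\<^bsub>M\<^esub> y) = (a \<odot>\<^bsub>M\<^esub> x) \<oplus>\<^bsub>M\<^esub> (a \<odot>\<^bsub>M\<^esub> y)"
    and smult_assoc: "\<lbrakk>a \<in> carrier A; b \<in> carrier A; x \<in> carrier M\<rbrakk>
      \<Longrightarrow> (a \<otimes>\<^bsub>A\<^esub> b) \<odot>\<^bsub>M\<^esub> x = a \<odot>\<^bsub>M\<^esub> (b \<odot>\<^bsub>M\<^esub> x)"
    and smult_one: "x \<in> carrier M \<Longrightarrow> \<one>\<^bsub>A\<^esub> \<odot>\<^bsub>M\<^esub> x = x"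

text \<open>A scalar \<open>c\<close> of the ground field acts on an \<open>A\<close>-module as \<open>c \<odot> \<one>\<^bsub>A\<^esub>\<close>.\<close>

definition fin_dim ::
  "('k, 'm) ring_scheme \<Rightarrow> ('k, 'a) module \<Rightarrow> ('a, 'b) module \<Rightarrow> bool" where
  "fin_dim K A M \<longleftrightarrow>
     (\<exists>B. finite B \<and> B \<subseteq> carrier M \<and>
       (\<forall>x\<in>carrier M. \<exists>c\<in>B \<rightarrow> carrier K.
          x = (\<Oplus>\<^bsub>M\<^esub>b\<in>B. (c b \<odot>\<^bsub>A\<^esub> \<one>\<^bsub>A\<^esub>) \<odot>\<^bsub>M\<^esub> b)))"

definition fd_module ::
  "('k, 'm) ring_scheme \<Rightarrow> ('k, 'a) module \<Rightarrow> ('a, 'b) module \<Rightarrow> bool" where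
  "fd_module K A M \<longleftrightarrow> left_module A M \<and> fin_dim K A M"

definition mod_hom ::
  "('k, 'a) module \<Rightarrow> ('a, 'b) module \<Rightarrow> ('a, 'c) module \<Rightarrow> ('b \<Rightarrow> 'c) set" where
  "mod_hom A M N = {h. h \<in> carrier M \<rightarrow> carrier N \<and>
     (\<forall>x\<in>carrier M. \<forall>y\<in>carrier M. h (x \<oplus>\<^bsub>M\<^esub> y) = h x \<oplus>\<^bsub>N\<^esub> h y) \<and>
     (\<forall>a\<in>carrier A. \<forall>x\<in>carrier M. h (a \<odot>\<^bsub>M\<^esub> x) = a \<odot>\<^bsub>N\<^esub> h x)}"

definition mod_iso ::
  "('k, 'a) module \<Rightarrow> ('a, 'b) module \<Rightarrow> ('a, 'c) module \<Rightarrow> ('b \<Rightarrow> 'c) set" where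
  "mod_iso A M N = {h \<in> mod_hom A M N. bij_betw h (carrier M) (carrier N)}"

definition mod_isomorphic ::
  "('k, 'a) module \<Rightarrow> ('a, 'b) module \<Rightarrow> ('a, 'c) module \<Rightarrow> bool" where
  "mod_isomorphic A M N \<longleftrightarrow> mod_iso A M N \<noteq> {}"

abbreviation sub_mod :: "('a, 'b) module \<Rightarrow> 'b set \<Rightarrow> ('a, 'b) module" where
  "sub_mod M U \<equiv> M\<lparr>carrier := U\<rparr>"

text \<open>The fields \<open>mult\<close> and \<open>one\<close>, which the record \<open>module\<close> inherits from rings, play no
  role for modules. For a coset \<open>C = x + U\<close>, the set \<open>U + a C\<close> is the coset \<open>a x + U\<close>.\<close>

definition quot_mod :: "('a, 'b) module \<Rightarrow> 'b set \<Rightarrow> ('a, 'b set) module" where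
  "quot_mod M U =
     \<lparr>carrier = a_rcosets\<^bsub>M\<^esub> U, mult = undefined, one = undefined,
      zero = U, add = set_add M,
      smult = (\<lambda>a C. U <+>\<^bsub>M\<^esub> ((\<lambda>x. a \<odot>\<^bsub>M\<^esub> x) ` C))\<rparr>"

definition simple_mod :: "('k, 'a) module \<Rightarrow> ('a, 'b) module \<Rightarrow> bool" where
  "simple_mod A M \<longleftrightarrow> carrier M \<noteq> {\<zero>\<^bsub>M\<^esub>} \<and>
     (\<forall>U. submodule U A M \<longrightarrow> U = {\<zero>\<^bsub>M\<^esub>} \<or> U = carrier M)"

definition uniserial_mod :: "('k, 'a) module \<Rightarrow> ('a, 'b) module \<Rightarrow> bool" where
  "uniserial_mod A M \<longleftrightarrow>
     (\<forall>U V. submodule U A M \<longrightarrow> submodule V A M \<longrightarrow> U \<subseteq> V \<or> V \<subseteq> U)"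

definition indecomposable_mod :: "('k, 'a) module \<Rightarrow> ('a, 'b) module \<Rightarrow> bool" where
  "indecomposable_mod A M \<longleftrightarrow> carrier M \<noteq> {\<zero>\<^bsub>M\<^esub>} \<and>
     (\<forall>U V. submodule U A M \<longrightarrow> submodule V A M \<longrightarrow>
        U \<inter> V = {\<zero>\<^bsub>M\<^esub>} \<longrightarrow> U <+>\<^bsub>M\<^esub> V = carrier M \<longrightarrow>
        U = {\<zero>\<^bsub>M\<^esub>} \<or> V = {\<zero>\<^bsub>M\<^esub>})"

text \<open>Internal direct sum decompositions. Distinct summands are distinct sets, being nonzero and
  independent, so that a set of submodules (rather than a family) suffices; the empty set
  decomposes the zero module.\<close>

definition indec_decomposition ::
  "('k, 'a) module \<Rightarrow> ('a, 'b) module \<Rightarrow> 'b set set \<Rightarrow> bool" where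
  "indec_decomposition A M \<U> \<longleftrightarrow> finite \<U> \<and>
     (\<forall>U\<in>\<U>. submodule U A M \<and> indecomposable_mod A (sub_mod M U)) \<and>
     (\<forall>x\<in>carrier M. \<exists>!u. u \<in> (\<Pi>\<^sub>E U\<in>\<U>. U) \<and> x = (\<Oplus>\<^bsub>M\<^esub>U\<in>\<U>. u U))"

text \<open>Well-defined on finite-dimensional modules by the Krull-Schmidt theorem.\<close>

definition num_summands :: "('k, 'a) module \<Rightarrow> ('a, 'b) module \<Rightarrow> nat" where
  "num_summands A M = (THE n. \<exists>\<U>. indec_decomposition A M \<U> \<and> card \<U> = n)"


section \<open>Finitary and serial algebras\<close>

text \<open>Over a finite field every finite-dimensional module is a finite set and hence isomorphic to
  a module whose elements are natural numbers (see \<open>fd_module_on_nat\<close> below). So the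
  modules with carrier in \<^typ>\<open>nat\<close> represent all finite-dimensional modules, and
  serve as the objects of the category \<open>A\<close>-mod.\<close>

type_synonym 'a nmod = "('a, nat) module"

text \<open>Yoneda description of \<open>Ext\<^sup>1(M,N)\<close>: short exact sequences
  \<open>0 \<rightarrow> N \<rightarrow> E \<rightarrow> M \<rightarrow> 0\<close> modulo isomorphisms that are the identity on \<open>N\<close> and \<open>M\<close>.
  The Baer sum is not needed, as only the cardinality of the group matters.\<close>

type_synonym 'a extension = "'a nmod \<times> (nat \<Rightarrow> nat) \<times> (nat \<Rightarrow> nat)"

definition extensions ::
  "('k, 'm) ring_scheme \<Rightarrow> ('k, 'a) module \<Rightarrow> 'a nmod \<Rightarrow> 'a nmod \<Rightarrow> 'a extension set" where
  "extensions K A M N = {(E, f, g). fd_module K A E \<and> f \<in> mod_hom A N E \<and> g \<in> mod_hom A E M \<and>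
     inj_on f (carrier N) \<and> g ` carrier E = carrier M \<and>
     f ` carrier N = {x \<in> carrier E. g x = \<zero>\<^bsub>M\<^esub>}}"

definition ext_equiv ::
  "('k, 'm) ring_scheme \<Rightarrow> ('k, 'a) module \<Rightarrow> 'a nmod \<Rightarrow> 'a nmod \<Rightarrow> 'a extension rel" where
  "ext_equiv K A M N = {((E, f, g), (E', f', g')).
     (E, f, g) \<in> extensions K A M N \<and> (E', f', g') \<in> extensions K A M N \<and>
     (\<exists>h\<in>mod_iso A E E'. (\<forall>x\<in>carrier N. h (f x) = f' x) \<and> (\<forall>x\<in>carrier E. g' (h x) = g x))}"

definition Ext1 ::
  "('k, 'm) ring_scheme \<Rightarrow> ('k, 'a) module \<Rightarrow> 'a nmod \<Rightarrow> 'a nmod \<Rightarrow> 'a extension set set" where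
  "Ext1 K A M N = extensions K A M N // ext_equiv K A M N"

definition finitary :: "('k, 'm) ring_scheme \<Rightarrow> ('k, 'a) module \<Rightarrow> bool" where
  "finitary K A \<longleftrightarrow> (\<forall>(S1 :: 'a nmod) (S2 :: 'a nmod).
     fd_module K A S1 \<longrightarrow> simple_mod A S1 \<longrightarrow> fd_module K A S2 \<longrightarrow> simple_mod A S2 \<longrightarrow>
     finite (Ext1 K A S1 S2))"

definition serial_algebra :: "('k, 'm) ring_scheme \<Rightarrow> ('k, 'a) module \<Rightarrow> bool" where
  "serial_algebra K A \<longleftrightarrow> (\<forall>M :: 'a nmod.
     fd_module K A M \<longrightarrow> indecomposable_mod A M \<longrightarrow> uniserial_mod A M)"


section \<open>The Hall algebra\<close>

definition iso_class ::
  "('k, 'm) ring_scheme \<Rightarrow> ('k, 'a) module \<Rightarrow> 'a nmod \<Rightarrow> 'a nmod set" where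
  "iso_class K A M = {N. fd_module K A N \<and> mod_isomorphic A M N}"

definition iso_classes ::
  "('k, 'm) ring_scheme \<Rightarrow> ('k, 'a) module \<Rightarrow> 'a nmod set set" where
  "iso_classes K A = {iso_class K A M | M. fd_module K A M}"

definition class_rep :: "'a nmod set \<Rightarrow> 'a nmod" where
  "class_rep X = (SOME M. M \<in> X)"

definition zero_mod :: "'a nmod" where
  "zero_mod = \<lparr>carrier = {0}, mult = undefined, one = undefined, zero = 0,
     add = (\<lambda>_ _. 0), smult = (\<lambda>_ _. 0)\<rparr>"

definition hall_number :: "('k, 'a) module \<Rightarrow> 'a nmod \<Rightarrow> 'a nmod \<Rightarrow> 'a nmod \<Rightarrow> nat" where
  "hall_number A X M N = card {U. submodule U A X \<and>
     mod_isomorphic A (sub_mod X U) N \<and> mod_isomorphic A (quot_mod X U) M}"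

definition v_elem :: "('k, 'm) ring_scheme \<Rightarrow> real" where
  "v_elem K = sqrt (real (card (carrier K)))"

text \<open>\<open>\<int>[v, v\<^sup>-\<^sup>1]\<close> as a subring of the real numbers; \<open>v\<close> is a number, not an indeterminate.\<close>

definition Z_v :: "('k, 'm) ring_scheme \<Rightarrow> real set" where
  "Z_v K = {\<Sum>i\<in>I. of_int (a i) * v_elem K powi i | (a :: int \<Rightarrow> int) I. finite I}"

definition hall_basis ::
  "('k, 'm) ring_scheme \<Rightarrow> ('k, 'a) module \<Rightarrow> 'a nmod \<Rightarrow> ('a nmod set \<Rightarrow> real)" where
  "hall_basis K A M = (\<lambda>X. if X = iso_class K A M then 1 else 0)"

text \<open>An element of the free \<open>\<int>[v, v\<^sup>-\<^sup>1]\<close>-module on the isomorphism classes is its finitely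
  supported coefficient function; the product is the bilinear extension of
  \<open>[M] \<diamondop> [N] = (\<Sum>[X]. F\<^bsup>X\<^esup>\<^bsub>M,N\<^esub> [X])\<close>. (For finitary \<open>A\<close> the product has finite support.)
  The identity element is the class of the zero module.\<close>

definition hall_algebra ::
  "('k, 'm) ring_scheme \<Rightarrow> ('k, 'a) module \<Rightarrow> (real, 'a nmod set \<Rightarrow> real) module" where
  "hall_algebra K A =
     \<lparr>carrier = {f. finite {X. f X \<noteq> 0} \<and> {X. f X \<noteq> 0} \<subseteq> iso_classes K A \<and> range f \<subseteq> Z_v K},
      mult = (\<lambda>f g X. if X \<in> iso_classes K A
        then \<Sum>M | f M \<noteq> 0. \<Sum>N | g N \<noteq> 0.
          f M * g N * real (hall_number A (class_rep X) (class_rep M) (class_rep N))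
        else 0),
      one = hall_basis K A zero_mod,
      zero = (\<lambda>X. 0),
      add = (\<lambda>f g X. f X + g X),
      smult = (\<lambda>c f X. c * f X)\<rparr>"

definition hall_D ::
  "nat \<Rightarrow> ('k, 'm) ring_scheme \<Rightarrow> ('k, 'a) module \<Rightarrow> ('a nmod set \<Rightarrow> real) set" where
  "hall_D r K A = {(\<lambda>X. \<Sum>M\<in>S. c M * hall_basis K A M X) | c S.
     finite S \<and> (\<forall>M\<in>S. fd_module K A M \<and> num_summands A M \<ge> r + 1 \<and> c M \<in> Z_v K)}"


section \<open>Adequacy of modules on natural numbers\<close>

lemma scalar_closed:
  assumes "assoc_algebra K A" "c \<in> carrier K"
  shows "c \<odot>\<^bsub>A\<^esub> \<one>\<^bsub>A\<^esub> \<in> carrier A"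
proof -
  interpret assoc_algebra K A by fact
  show ?thesis using assms(2) by simp
qed

lemma fd_module_iff_finite:
  assumes "finite (carrier K)" "assoc_algebra K A"
  shows "fd_module K A M \<longleftrightarrow> left_module A M \<and> finite (carrier M)"
proof (cases "left_module A M")
  case True
  then interpret left_module A M .
  interpret K: assoc_algebra K A by fact
  have "finite (carrier M)" if fd: "fin_dim K A M"
  proof -
    obtain B where B: "finite B" "B \<subseteq> carrier M"
      and sp: "\<forall>x\<in>carrier M. \<exists>c\<in>B \<rightarrow> carrier K.
          x = (\<Oplus>\<^bsub>M\<^esub>b\<in>B. (c b \<odot>\<^bsub>A\<^esub> \<one>\<^bsub>A\<^esub>) \<odot>\<^bsub>M\<^esub> b)"
      using fd unfolding fin_dim_def by blast
    define F where "F c = (\<Oplus>\<^bsub>M\<^esub>b\<in>B. (c b \<odot>\<^bsub>A\<^esub> \<one>\<^bsub>A\<^esub>) \<odot>\<^bsub>M\<^esub> b)" for c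
    have "carrier M \<subseteq> F ` (B \<rightarrow>\<^sub>E carrier K)"
    proof
      fix x assume "x \<in> carrier M"
      then obtain c where c: "c \<in> B \<rightarrow> carrier K" "x = F c"
        using sp unfolding F_def by blast
      have "F c = F (restrict c B)"
        unfolding F_def using c(1) B scalar_closed[OF assms(2)]
        by (intro M.finsum_cong') (auto intro!: smult_closed simp: Pi_iff)
      moreover have "restrict c B \<in> B \<rightarrow>\<^sub>E carrier K" using c(1) by simp
      ultimately show "x \<in> F ` (B \<rightarrow>\<^sub>E carrier K)" using c(2) by blast
    qed
    moreover have "finite (B \<rightarrow>\<^sub>E carrier K)"
      using B(1) assms(1) by (intro finite_PiE) auto
    ultimately show ?thesis using finite_subset by blast
  qed
  moreover have "fin_dim K A M" if fin: "finite (carrier M)"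
    unfolding fin_dim_def
  proof (intro exI[of _ "carrier M"] conjI ballI)
    fix x assume x: "x \<in> carrier M"
    let ?c = "\<lambda>b. if b = x then \<one>\<^bsub>K\<^esub> else \<zero>\<^bsub>K\<^esub>"
    have z: "\<zero>\<^bsub>A\<^esub> \<odot>\<^bsub>M\<^esub> b = \<zero>\<^bsub>M\<^esub>" if "b \<in> carrier M" for b
    proof -
      have "\<zero>\<^bsub>A\<^esub> \<odot>\<^bsub>M\<^esub> b = \<zero>\<^bsub>A\<^esub> \<odot>\<^bsub>M\<^esub> b \<oplus>\<^bsub>M\<^esub> \<zero>\<^bsub>A\<^esub> \<odot>\<^bsub>M\<^esub> b"
        using smult_l_distr[of "\<zero>\<^bsub>A\<^esub>" "\<zero>\<^bsub>A\<^esub>" b] that by simp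
      then show ?thesis
        using smult_closed[of "\<zero>\<^bsub>A\<^esub>" b] that by (metis M.add.r_cancel_one' A.zero_closed)
    qed
    have "(\<Oplus>\<^bsub>M\<^esub>b\<in>carrier M. (?c b \<odot>\<^bsub>A\<^esub> \<one>\<^bsub>A\<^esub>) \<odot>\<^bsub>M\<^esub> b)
        = (\<Oplus>\<^bsub>M\<^esub>b\<in>carrier M. if x = b then b else \<zero>\<^bsub>M\<^esub>)"
      by (rule M.finsum_cong') (use x z in \<open>auto simp: smult_one\<close>)
    also have "\<dots> = x"
      using M.finsum_singleton[OF x fin, of "\<lambda>b. b"] by simp
    finally show "\<exists>c\<in>carrier M \<rightarrow> carrier K.
        x = (\<Oplus>\<^bsub>M\<^esub>b\<in>carrier M. (c b \<odot>\<^bsub>A\<^esub> \<one>\<^bsub>A\<^esub>) \<odot>\<^bsub>M\<^esub> b)"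
      by (intro bexI[of _ ?c]) auto
  qed (use fin in auto)
  ultimately show ?thesis using True unfolding fd_module_def by blast
qed (simp add: fd_module_def)

lemma fd_module_on_nat:
  fixes M :: "('a, 'b) module"
  assumes "finite (carrier K)" "assoc_algebra K A" "fd_module K A M"
  shows "\<exists>N :: 'a nmod. fd_module K A N \<and> mod_isomorphic A M N"
proof -
  have M: "left_module A M" "finite (carrier M)"
    using assms fd_module_iff_finite by blast+
  interpret left_module A M by (rule M)
  obtain f :: "'b \<Rightarrow> nat" where f: "inj_on f (carrier M)"
    using finite_imp_inj_to_nat_seg[OF M(2)] by blast
  define g where "g = the_inv_into (carrier M) f"
  have g [simp]: "g (f x) = x" if "x \<in> carrier M" for x
    using f that by (simp add: g_def the_inv_into_f_f)
  define N :: "'a nmod" where "N = \<lparr>carrier = f ` carrier M, mult = undefined, one = undefined,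
    zero = f \<zero>\<^bsub>M\<^esub>, add = (\<lambda>x y. f (g x \<oplus>\<^bsub>M\<^esub> g y)), smult = (\<lambda>a x. f (a \<odot>\<^bsub>M\<^esub> g x))\<rparr>"
  have ab: "abelian_group N"
  proof (rule abelian_groupI)
    fix x assume "x \<in> carrier N"
    then obtain y where y: "y \<in> carrier M" "x = f y" by (auto simp: N_def)
    have "f (\<ominus>\<^bsub>M\<^esub> y) \<in> carrier N" "f (\<ominus>\<^bsub>M\<^esub> y) \<oplus>\<^bsub>N\<^esub> x = \<zero>\<^bsub>N\<^esub>"
      using y by (auto simp: N_def M.l_neg)
    then show "\<exists>y\<in>carrier N. y \<oplus>\<^bsub>N\<^esub> x = \<zero>\<^bsub>N\<^esub>" by blast
  qed (auto simp: N_def M.a_ac)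
  have "left_module A N"
    by (intro left_module.intro left_module_axioms.intro ab)
      (auto simp: N_def smult_closed smult_l_distr smult_r_distr smult_assoc smult_one
        intro: A.ring_axioms)
  moreover have "finite (carrier N)" using M(2) by (simp add: N_def)
  ultimately have "fd_module K A N" using assms fd_module_iff_finite by blast
  moreover have "f \<in> mod_iso A M N"
    using f by (auto simp: mod_iso_def mod_hom_def N_def bij_betw_def)
  ultimately show ?thesis unfolding mod_isomorphic_def by blast
qed

end

theory Submission
  imports Defs "HOL-Library.Nat_Bijection"
begin

text \<open>For a serial algebra each \<open>D\<^sub>r\<close> is an ideal for the following reason. The
  coefficient of \<open>[X]\<close> in \<open>[M] \<diamondop> [N]\<close> is nonzero only if \<open>N\<close> is isomorphic to a submodule of \<open>X\<close> with quotient isomorphic to \<open>M\<close>. So it has to be seen that, for a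
  serial algebra, no submodule and no quotient of \<open>X\<close> has more indecomposable summands than \<open>X\<close>. This
  is a dimension argument: if \<open>X\<close> is a direct sum of \<open>n\<close> uniserial modules, then the socle and the
  top of \<open>X\<close> have length \<open>n\<close>, and the socle of a submodule and the top of a quotient cannot be
  longer. Here the argument is carried out without socles, by splitting off one uniserial summand at
  a time (\<open>serial_submodule_summands\<close>, \<open>serial_quotient_summands\<close>).

  Conversely, let \<open>M\<close> be indecomposable with incomparable submodules \<open>V\<close> and \<open>V'\<close>, and
  let \<open>Q = M / (V \<inter> V')\<close>. If \<open>Q\<close> is decomposable, then \<open>M\<close> has one summand and its quotient \<open>Q\<close> at
  least two; otherwise \<open>Q\<close> has one summand, and its submodule generated by the images of \<open>V\<close> and
  \<open>V'\<close> is their direct sum, and has at least two. Either way there is an extension whose middle term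
  has fewer summands than one of its ends, so \<open>D\<^sub>1\<close> is not an ideal; adding \<open>r - 1\<close> copies of \<open>M\<close> to the
  middle term and to that end gives the same for \<open>D\<^sub>r\<close> (\<open>summand_gap_of_not_uniserial\<close>,
  \<open>summand_gap_add\<close>).

  Two facts lie behind these statements. The number of summands is well defined: this is the
  Krull-Schmidt theorem, proved by the exchange property of indecomposable modules (\<open>exchange\<close>,
  \<open>indec_sum_unique\<close>). And \<open>\<H>(A)\<close> is a ring (\<open>hall_algebra_ring\<close>), as the notion of an ideal
  presupposes. Associativity is the double counting of chains \<open>V \<subseteq> U \<subseteq> X\<close>. That products have
  finite support is where \<open>A\<close> being finitary enters: the extensions of \<open>M\<close> by \<open>N\<close> with a given
  underlying extension of abelian groups are parametrized by derivations of \<open>A\<close> with values in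
  the additive maps \<open>M \<rightarrow> N\<close>. For simple modules there are finitely many derivations, because modulo
  the finitely many inner ones they embed in \<open>Ext\<^sup>1\<close>, and since derivations depend left exactly on
  \<open>M\<close> and \<open>N\<close>, the finiteness carries over to all modules of finite length (\<open>finite_derivations\<close>,
  \<open>finite_middle_terms\<close>). As \<open>k\<close> is finite, the finite-dimensional modules are the finite ones, and
  all arguments are about finite modules.\<close>


section \<open>Modules and submodules\<close>

text \<open>The records here have no extra fields, so that \<open>sub_mod\<close> and the homomorphism sets apply to them.\<close>

locale lmod = left_module A M for A :: "('k, 'a) module" and M :: "('a, 'b) module"
begin

lemma smult_zero_right [simp]: "a \<in> carrier A \<Longrightarrow> a \<odot>\<^bsub>M\<^esub> \<zero>\<^bsub>M\<^esub> = \<zero>\<^bsub>M\<^esub>"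
  using smult_r_distr[of a "\<zero>\<^bsub>M\<^esub>" "\<zero>\<^bsub>M\<^esub>"] smult_closed[of a "\<zero>\<^bsub>M\<^esub>"]
  by (metis M.add.r_cancel_one' M.l_zero M.zero_closed)

lemma smult_zero_left [simp]: "x \<in> carrier M \<Longrightarrow> \<zero>\<^bsub>A\<^esub> \<odot>\<^bsub>M\<^esub> x = \<zero>\<^bsub>M\<^esub>"
  using smult_l_distr[of "\<zero>\<^bsub>A\<^esub>" "\<zero>\<^bsub>A\<^esub>" x] smult_closed[of "\<zero>\<^bsub>A\<^esub>" x]
  by (metis M.add.r_cancel_one' A.zero_closed A.l_zero)

lemma minus_as_smult: "x \<in> carrier M \<Longrightarrow> \<ominus>\<^bsub>M\<^esub> x = (\<ominus>\<^bsub>A\<^esub> \<one>\<^bsub>A\<^esub>) \<odot>\<^bsub>M\<^esub> x"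
  using smult_l_distr[of "\<ominus>\<^bsub>A\<^esub> \<one>\<^bsub>A\<^esub>" "\<one>\<^bsub>A\<^esub>" x] smult_closed[of "\<ominus>\<^bsub>A\<^esub> \<one>\<^bsub>A\<^esub>" x]
  by (simp add: smult_one A.l_neg M.minus_equality)

lemma smult_minus_right:
  "\<lbrakk>a \<in> carrier A; x \<in> carrier M\<rbrakk> \<Longrightarrow> a \<odot>\<^bsub>M\<^esub> (\<ominus>\<^bsub>M\<^esub> x) = \<ominus>\<^bsub>M\<^esub> (a \<odot>\<^bsub>M\<^esub> x)"
  using smult_r_distr[of a "\<ominus>\<^bsub>M\<^esub> x" x] smult_closed
  by (simp add: M.l_neg M.minus_equality)

text \<open>Negation is multiplication by \<open>-1\<close>, so closure under it comes for free.\<close>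

lemma submodule_iff:
  "submodule U A M \<longleftrightarrow> U \<subseteq> carrier M \<and> \<zero>\<^bsub>M\<^esub> \<in> U \<and>
     (\<forall>x\<in>U. \<forall>y\<in>U. x \<oplus>\<^bsub>M\<^esub> y \<in> U) \<and> (\<forall>a\<in>carrier A. \<forall>x\<in>U. a \<odot>\<^bsub>M\<^esub> x \<in> U)"
    (is "_ = ?R")
proof
  assume "submodule U A M"
  then interpret submodule U A M .
  show ?R using subset one_closed m_closed smult_closed by auto
next
  assume R: ?R
  have "\<ominus>\<^bsub>M\<^esub> x \<in> U" if "x \<in> U" for x
    using that R minus_as_smult[of x] by auto
  then show "submodule U A M"
    using R by (intro submodule.intro subgroup.intro submodule_axioms.intro)
      (auto simp: a_inv_def)
qed

lemma submoduleD:
  assumes "submodule U A M"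
  shows "U \<subseteq> carrier M" "\<zero>\<^bsub>M\<^esub> \<in> U" "\<And>x. x \<in> U \<Longrightarrow> x \<in> carrier M"
    "\<And>x y. x \<in> U \<Longrightarrow> y \<in> U \<Longrightarrow> x \<oplus>\<^bsub>M\<^esub> y \<in> U"
    "\<And>a x. a \<in> carrier A \<Longrightarrow> x \<in> U \<Longrightarrow> a \<odot>\<^bsub>M\<^esub> x \<in> U"
    "\<And>x. x \<in> U \<Longrightarrow> \<ominus>\<^bsub>M\<^esub> x \<in> U"
    "\<And>x y. x \<in> U \<Longrightarrow> y \<in> U \<Longrightarrow> x \<ominus>\<^bsub>M\<^esub> y \<in> U"
proof -
  note R = assms[unfolded submodule_iff]
  show "U \<subseteq> carrier M" "\<zero>\<^bsub>M\<^esub> \<in> U" "\<And>x. x \<in> U \<Longrightarrow> x \<in> carrier M"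
    "\<And>x y. x \<in> U \<Longrightarrow> y \<in> U \<Longrightarrow> x \<oplus>\<^bsub>M\<^esub> y \<in> U"
    "\<And>a x. a \<in> carrier A \<Longrightarrow> x \<in> U \<Longrightarrow> a \<odot>\<^bsub>M\<^esub> x \<in> U" using R by auto
  show neg: "\<And>x. x \<in> U \<Longrightarrow> \<ominus>\<^bsub>M\<^esub> x \<in> U"
    using R minus_as_smult by auto
  show "\<And>x y. x \<in> U \<Longrightarrow> y \<in> U \<Longrightarrow> x \<ominus>\<^bsub>M\<^esub> y \<in> U"
    using R neg by (simp add: a_minus_def)
qed

lemma submodule_carrier: "submodule (carrier M) A M"
  by (auto simp: submodule_iff smult_closed)

lemma submodule_zero: "submodule {\<zero>\<^bsub>M\<^esub>} A M"
  by (auto simp: submodule_iff)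

lemma submodule_Int: "submodule U A M \<Longrightarrow> submodule V A M \<Longrightarrow> submodule (U \<inter> V) A M"
  by (auto simp: submodule_iff)

lemma set_add_iff: "x \<in> U <+>\<^bsub>M\<^esub> V \<longleftrightarrow> (\<exists>u\<in>U. \<exists>v\<in>V. x = u \<oplus>\<^bsub>M\<^esub> v)"
  by (auto simp: set_add_def')

lemma set_addI: "u \<in> U \<Longrightarrow> v \<in> V \<Longrightarrow> u \<oplus>\<^bsub>M\<^esub> v \<in> U <+>\<^bsub>M\<^esub> V"
  unfolding set_add_iff by blast

lemma set_addE:
  assumes "x \<in> U <+>\<^bsub>M\<^esub> V"
  obtains u v where "u \<in> U" "v \<in> V" "x = u \<oplus>\<^bsub>M\<^esub> v"
  using assms unfolding set_add_iff by blast

lemma submodule_sum: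
  assumes "submodule U A M" "submodule V A M"
  shows "submodule (U <+>\<^bsub>M\<^esub> V) A M"
proof -
  note U = submoduleD[OF assms(1)] and V = submoduleD[OF assms(2)]
  show ?thesis unfolding submodule_iff
  proof (intro conjI ballI subsetI)
    fix x y assume "x \<in> U <+>\<^bsub>M\<^esub> V" "y \<in> U <+>\<^bsub>M\<^esub> V"
    then obtain u v u' v' where e: "x = u \<oplus>\<^bsub>M\<^esub> v" "y = u' \<oplus>\<^bsub>M\<^esub> v'"
      "u \<in> U" "u' \<in> U" "v \<in> V" "v' \<in> V" by (auto simp: set_add_iff)
    then have "x \<oplus>\<^bsub>M\<^esub> y = (u \<oplus>\<^bsub>M\<^esub> u') \<oplus>\<^bsub>M\<^esub> (v \<oplus>\<^bsub>M\<^esub> v')"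
      using U(3) V(3) by (simp add: M.a_ac)
    then show "x \<oplus>\<^bsub>M\<^esub> y \<in> U <+>\<^bsub>M\<^esub> V" using e U(4) V(4) by (auto intro: set_addI)
  next
    fix a x assume a: "a \<in> carrier A" and "x \<in> U <+>\<^bsub>M\<^esub> V"
    then obtain u v where e: "x = u \<oplus>\<^bsub>M\<^esub> v" "u \<in> U" "v \<in> V" by (auto simp: set_add_iff)
    then have "a \<odot>\<^bsub>M\<^esub> x = (a \<odot>\<^bsub>M\<^esub> u) \<oplus>\<^bsub>M\<^esub> (a \<odot>\<^bsub>M\<^esub> v)"
      using U(3) V(3) a by (simp add: smult_r_distr)
    then show "a \<odot>\<^bsub>M\<^esub> x \<in> U <+>\<^bsub>M\<^esub> V" using e a U(5) V(5) by (auto intro: set_addI)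
  next
    show "\<zero>\<^bsub>M\<^esub> \<in> U <+>\<^bsub>M\<^esub> V" using U(2) V(2) unfolding set_add_iff
      by (intro bexI[of _ "\<zero>\<^bsub>M\<^esub>"]) auto
  qed (use U(3) V(3) in \<open>auto simp: set_add_iff\<close>)
qed

lemma sum_mono: "U \<subseteq> U' \<Longrightarrow> V \<subseteq> V' \<Longrightarrow> U <+>\<^bsub>M\<^esub> V \<subseteq> U' <+>\<^bsub>M\<^esub> V'"
  by (auto elim!: set_addE intro: set_addI)

lemma sum_upper1: "submodule U A M \<Longrightarrow> submodule V A M \<Longrightarrow> U \<subseteq> U <+>\<^bsub>M\<^esub> V"
  using submoduleD(2,3) unfolding set_add_iff subset_iff by (metis M.r_zero)

lemma sum_upper2: "submodule U A M \<Longrightarrow> submodule V A M \<Longrightarrow> V \<subseteq> U <+>\<^bsub>M\<^esub> V"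
  using submoduleD(2,3) unfolding set_add_iff subset_iff by (metis M.l_zero)

lemma sum_least: "submodule T A M \<Longrightarrow> U \<subseteq> T \<Longrightarrow> V \<subseteq> T \<Longrightarrow> U <+>\<^bsub>M\<^esub> V \<subseteq> T"
  by (auto elim!: set_addE intro: submoduleD(4))

lemma sum_comm: "U \<subseteq> carrier M \<Longrightarrow> V \<subseteq> carrier M \<Longrightarrow> U <+>\<^bsub>M\<^esub> V = V <+>\<^bsub>M\<^esub> U"
  by (auto simp: set_add_iff subset_iff) (metis M.a_comm)+

lemma sum_assoc:
  assumes "submodule U A M" "submodule V A M" "submodule W A M"
  shows "(U <+>\<^bsub>M\<^esub> V) <+>\<^bsub>M\<^esub> W = U <+>\<^bsub>M\<^esub> (V <+>\<^bsub>M\<^esub> W)"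
  by (intro equalityI sum_least submodule_sum assms sum_mono order_refl sum_upper1 sum_upper2
      order_trans[OF sum_upper1 sum_mono[OF order_refl sum_upper1]]
      order_trans[OF sum_upper1 sum_upper2] order_trans[OF sum_upper2 sum_upper2]
      order_trans[OF sum_upper1 sum_upper1] order_trans[OF sum_upper2 sum_upper1])

text \<open>Dedekind's modular law.\<close>

lemma modular_law:
  assumes "submodule U A M" "submodule V A M" "submodule T A M" "U \<subseteq> T"
  shows "T \<inter> (U <+>\<^bsub>M\<^esub> V) = U <+>\<^bsub>M\<^esub> (T \<inter> V)"
proof (intro equalityI subsetI)
  note U = submoduleD[OF assms(1)] and V = submoduleD[OF assms(2)] and T = submoduleD[OF assms(3)]
  fix x assume x: "x \<in> T \<inter> (U <+>\<^bsub>M\<^esub> V)"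
  then obtain u v where e: "x = u \<oplus>\<^bsub>M\<^esub> v" "u \<in> U" "v \<in> V" by (auto simp: set_add_iff)
  then have "v = (\<ominus>\<^bsub>M\<^esub> u) \<oplus>\<^bsub>M\<^esub> x" using U(3) V(3) by (simp add: M.r_neg1)
  then have "v \<in> T" using e x assms(4) T(4)[OF T(6), of u x] by auto
  then show "x \<in> U <+>\<^bsub>M\<^esub> (T \<inter> V)" using e by (auto intro: set_addI)
next
  fix x assume "x \<in> U <+>\<^bsub>M\<^esub> (T \<inter> V)"
  then show "x \<in> T \<inter> (U <+>\<^bsub>M\<^esub> V)" using assms(4) submoduleD(4)[OF assms(3)] by (auto elim!: set_addE intro: set_addI)
qed

lemma lmod_sub_mod:
  assumes "submodule U A M" shows "lmod A (sub_mod M U)"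
proof -
  note U = submoduleD[OF assms]
  have "abelian_group (sub_mod M U)"
  proof (rule abelian_groupI)
    fix x assume "x \<in> carrier (sub_mod M U)"
    then show "\<exists>y\<in>carrier (sub_mod M U). y \<oplus>\<^bsub>sub_mod M U\<^esub> x = \<zero>\<^bsub>sub_mod M U\<^esub>"
      using U(3,6) by (auto intro!: bexI[of _ "\<ominus>\<^bsub>M\<^esub> x"] simp: M.l_neg)
  qed (use U(2,3,4) in \<open>auto simp: M.a_ac\<close>)
  then show ?thesis using U(3,5)
    by (intro lmod.intro left_module.intro left_module_axioms.intro A.ring_axioms)
      (auto simp: smult_l_distr smult_r_distr smult_assoc smult_one)
qed

lemma submodule_sub_mod_iff:
  assumes "submodule U A M"
  shows "submodule W A (sub_mod M U) \<longleftrightarrow> submodule W A M \<and> W \<subseteq> U"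
proof -
  interpret U: lmod A "sub_mod M U" by (rule lmod_sub_mod[OF assms])
  show ?thesis using submoduleD(1)[OF assms] unfolding submodule_iff U.submodule_iff by auto
qed

end

lemma set_add_sub_mod [simp]: "set_add (sub_mod M U) = set_add M"
  by (intro ext) (simp add: set_add_def')


section \<open>Homomorphisms\<close>

lemma mod_homI:
  assumes "\<And>x. x \<in> carrier M \<Longrightarrow> h x \<in> carrier N"
    "\<And>x y. x \<in> carrier M \<Longrightarrow> y \<in> carrier M \<Longrightarrow> h (x \<oplus>\<^bsub>M\<^esub> y) = h x \<oplus>\<^bsub>N\<^esub> h y"
    "\<And>a x. a \<in> carrier A \<Longrightarrow> x \<in> carrier M \<Longrightarrow> h (a \<odot>\<^bsub>M\<^esub> x) = a \<odot>\<^bsub>N\<^esub> h x"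
  shows "h \<in> mod_hom A M N"
  using assms by (auto simp: mod_hom_def)

lemma mod_homD:
  assumes "h \<in> mod_hom A M N"
  shows "x \<in> carrier M \<Longrightarrow> h x \<in> carrier N"
    "x \<in> carrier M \<Longrightarrow> y \<in> carrier M \<Longrightarrow> h (x \<oplus>\<^bsub>M\<^esub> y) = h x \<oplus>\<^bsub>N\<^esub> h y"
    "a \<in> carrier A \<Longrightarrow> x \<in> carrier M \<Longrightarrow> h (a \<odot>\<^bsub>M\<^esub> x) = a \<odot>\<^bsub>N\<^esub> h x"
  using assms by (auto simp: mod_hom_def)

lemma mod_hom_comp: "g \<in> mod_hom A M N \<Longrightarrow> h \<in> mod_hom A N P \<Longrightarrow> (\<lambda>x. h (g x)) \<in> mod_hom A M P"
  by (auto simp: mod_hom_def Pi_iff)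

lemma mod_hom_restrict: "h \<in> mod_hom A M N \<Longrightarrow> W \<subseteq> carrier M \<Longrightarrow> h \<in> mod_hom A (sub_mod M W) N"
  by (auto simp: mod_hom_def subset_iff)

lemma mod_hom_into_sub:
  "h \<in> mod_hom A M N \<Longrightarrow> h ` carrier M \<subseteq> W \<Longrightarrow> h \<in> mod_hom A M (sub_mod N W)"
  by (auto simp: mod_hom_def)

lemma mod_hom_from_into_sub:
  "h \<in> mod_hom A M (sub_mod N W) \<Longrightarrow> W \<subseteq> carrier N \<Longrightarrow> h \<in> mod_hom A M N"
  by (auto simp: mod_hom_def)

context lmod
begin


lemma hom_zero:
  assumes "lmod A N" "h \<in> mod_hom A M N" shows "h \<zero>\<^bsub>M\<^esub> = \<zero>\<^bsub>N\<^esub>"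
proof -
  interpret N: lmod A N by fact
  note h = mod_homD[OF assms(2)]
  show ?thesis using h(2)[of "\<zero>\<^bsub>M\<^esub>" "\<zero>\<^bsub>M\<^esub>"] h(1)[of "\<zero>\<^bsub>M\<^esub>"]
    by (metis M.l_zero M.zero_closed N.add.r_cancel_one')
qed

lemma hom_minus:
  assumes "lmod A N" "h \<in> mod_hom A M N" "x \<in> carrier M" shows "h (\<ominus>\<^bsub>M\<^esub> x) = \<ominus>\<^bsub>N\<^esub> h x"
proof -
  interpret N: lmod A N by fact
  note h = mod_homD[OF assms(2)]
  show ?thesis using h(1)[OF assms(3)] h(3)[of "\<ominus>\<^bsub>A\<^esub> \<one>\<^bsub>A\<^esub>" x] assms(3)
    by (simp add: minus_as_smult N.minus_as_smult)
qed

lemma hom_diff: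
  assumes "lmod A N" "h \<in> mod_hom A M N" "x \<in> carrier M" "y \<in> carrier M"
  shows "h (x \<ominus>\<^bsub>M\<^esub> y) = h x \<ominus>\<^bsub>N\<^esub> h y"
  using assms by (simp add: a_minus_def hom_minus mod_homD(2))

lemma diff_zero_iff:
  assumes "x \<in> carrier M" "y \<in> carrier M" shows "x \<ominus>\<^bsub>M\<^esub> y = \<zero>\<^bsub>M\<^esub> \<longleftrightarrow> x = y"
  using assms M.minus_equality[of x "\<ominus>\<^bsub>M\<^esub> y"] by (auto simp: a_minus_def M.r_neg)

lemma hom_eq_iff:
  assumes "lmod A N" "h \<in> mod_hom A M N" "x \<in> carrier M" "y \<in> carrier M"
  shows "h x = h y \<longleftrightarrow> h (x \<ominus>\<^bsub>M\<^esub> y) = \<zero>\<^bsub>N\<^esub>"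
proof -
  interpret N: lmod A N by fact
  show ?thesis using assms by (simp add: hom_diff N.diff_zero_iff mod_homD(1)[OF assms(2)])
qed

lemma hom_inj_on_iff:
  assumes "lmod A N" "h \<in> mod_hom A M N"
  shows "inj_on h (carrier M) \<longleftrightarrow> (\<forall>x\<in>carrier M. h x = \<zero>\<^bsub>N\<^esub> \<longrightarrow> x = \<zero>\<^bsub>M\<^esub>)"
proof
  assume "inj_on h (carrier M)"
  then show "\<forall>x\<in>carrier M. h x = \<zero>\<^bsub>N\<^esub> \<longrightarrow> x = \<zero>\<^bsub>M\<^esub>"
    using hom_zero[OF assms] unfolding inj_on_def by (metis M.zero_closed)
next
  assume "\<forall>x\<in>carrier M. h x = \<zero>\<^bsub>N\<^esub> \<longrightarrow> x = \<zero>\<^bsub>M\<^esub>"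
  then show "inj_on h (carrier M)"
    using hom_eq_iff[OF assms] by (intro inj_onI) (metis M.minus_closed diff_zero_iff)
qed

lemma submodule_image:
  assumes "lmod A N" "h \<in> mod_hom A M N" "submodule U A M"
  shows "submodule (h ` U) A N"
proof -
  interpret N: lmod A N by fact
  note h = mod_homD[OF assms(2)] and U = submoduleD[OF assms(3)]
  show ?thesis unfolding N.submodule_iff
  proof (intro conjI ballI)
    show "\<zero>\<^bsub>N\<^esub> \<in> h ` U" using hom_zero[OF assms(1,2)] U(2) by force
    show "x \<oplus>\<^bsub>N\<^esub> y \<in> h ` U" if "x \<in> h ` U" "y \<in> h ` U" for x y
      using that h(2) U(3,4) by (auto simp: image_iff) metis
    show "a \<odot>\<^bsub>N\<^esub> x \<in> h ` U" if "a \<in> carrier A" "x \<in> h ` U" for a x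
      using that h(3) U(3,5) by (auto simp: image_iff) metis
  qed (use h(1) U(3) in auto)
qed

lemma submodule_vimage:
  assumes "lmod A N" "h \<in> mod_hom A M N" "submodule W A N"
  shows "submodule {x \<in> carrier M. h x \<in> W} A M"
proof -
  interpret N: lmod A N by fact
  note h = mod_homD[OF assms(2)] and W = N.submoduleD[OF assms(3)]
  show ?thesis unfolding submodule_iff
    using h W hom_zero[OF assms(1,2)] by (auto simp: smult_closed)
qed

lemma submodule_kernel:
  assumes "lmod A N" "h \<in> mod_hom A M N"
  shows "submodule {x \<in> carrier M. h x = \<zero>\<^bsub>N\<^esub>} A M"
  using submodule_vimage[OF assms lmod.submodule_zero[OF assms(1)]] by simp

text \<open>This is the universal property of quotients. A quotient is represented below by any surjection with
  the given kernel, not by its cosets, and this lemma makes the representations interchangeable.\<close>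

lemma hom_factor:
  assumes "lmod A N" "lmod A P" "g \<in> mod_hom A M N" "g ` carrier M = carrier N"
    "h \<in> mod_hom A M P" "\<And>x. x \<in> carrier M \<Longrightarrow> g x = \<zero>\<^bsub>N\<^esub> \<Longrightarrow> h x = \<zero>\<^bsub>P\<^esub>"
  obtains k where "k \<in> mod_hom A N P" "\<And>x. x \<in> carrier M \<Longrightarrow> k (g x) = h x"
proof -
  interpret N: lmod A N by fact
  interpret P: lmod A P by fact
  note g = mod_homD[OF assms(3)] and h = mod_homD[OF assms(5)]
  define k where "k y = h (SOME x. x \<in> carrier M \<and> g x = y)" for y
  have k: "k (g x) = h x" if x: "x \<in> carrier M" for x
  proof -
    let ?y = "SOME y. y \<in> carrier M \<and> g y = g x"
    have y: "?y \<in> carrier M \<and> g ?y = g x" by (rule someI[of _ x]) (use x in simp)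
    then have "g (?y \<ominus>\<^bsub>M\<^esub> x) = \<zero>\<^bsub>N\<^esub>" using hom_eq_iff[OF assms(1,3)] x by blast
    then have "h (?y \<ominus>\<^bsub>M\<^esub> x) = \<zero>\<^bsub>P\<^esub>" using assms(6) x y by simp
    then show ?thesis using hom_eq_iff[OF assms(2,5), of ?y x] x y by (simp add: k_def)
  qed
  have im: "\<exists>x\<in>carrier M. g x = y" if "y \<in> carrier N" for y
    using that unfolding assms(4)[symmetric] by blast
  have "k \<in> mod_hom A N P"
  proof (rule mod_homI)
    fix y z assume "y \<in> carrier N" "z \<in> carrier N"
    then obtain x w where x: "x \<in> carrier M" "g x = y" and w: "w \<in> carrier M" "g w = z"
      using im by blast
    show "k (y \<oplus>\<^bsub>N\<^esub> z) = k y \<oplus>\<^bsub>P\<^esub> k z"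
      using k[of "x \<oplus>\<^bsub>M\<^esub> w"] k[OF x(1)] k[OF w(1)] g(2)[OF x(1) w(1)] h(2)[OF x(1) w(1)]
        x w by simp
  next
    fix a y assume a: "a \<in> carrier A" and "y \<in> carrier N"
    then obtain x where x: "x \<in> carrier M" "g x = y" using im by blast
    then show "k (a \<odot>\<^bsub>N\<^esub> y) = a \<odot>\<^bsub>P\<^esub> k y"
      using a k[of "a \<odot>\<^bsub>M\<^esub> x"] k[OF x(1)] g(3)[OF a x(1)] h(3)[OF a x(1)]
      by (simp add: smult_closed)
  next
    fix y assume "y \<in> carrier N"
    then obtain x where x: "x \<in> carrier M" "g x = y" using im by blast
    then show "k y \<in> carrier P" using k[OF x(1)] h(1)[OF x(1)] by simp
  qed
  with k show ?thesis by (rule that[rotated])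
qed

lemma hom_inv_into:
  assumes "lmod A N" "h \<in> mod_hom A M N" "bij_betw h (carrier M) (carrier N)"
  shows "inv_into (carrier M) h \<in> mod_hom A N M"
proof -
  interpret N: lmod A N by fact
  note h = mod_homD[OF assms(2)]
  note b = assms(3)
  note i = bij_betw_inv_into_right[OF b] bij_betw_apply[OF bij_betw_inv_into[OF b]]
  note eq = inj_onD[OF bij_betw_imp_inj_on[OF b]]
  show ?thesis
    by (rule mod_homI) (auto intro!: eq simp: i h smult_closed N.smult_closed)
qed


section \<open>Direct sums of indecomposable submodules\<close>

definition direct_sum :: "'b set \<Rightarrow> 'b set \<Rightarrow> 'b set \<Rightarrow> bool" where
  "direct_sum T U V \<longleftrightarrow>
     submodule U A M \<and> submodule V A M \<and> U \<inter> V = {\<zero>\<^bsub>M\<^esub>} \<and> T = U <+>\<^bsub>M\<^esub> V"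

lemma direct_sumD:
  assumes "direct_sum T U V"
  shows "submodule T A M" "submodule U A M" "submodule V A M" "U \<inter> V = {\<zero>\<^bsub>M\<^esub>}"
    "T = U <+>\<^bsub>M\<^esub> V" "U \<subseteq> T" "V \<subseteq> T"
  using assms sum_upper1 sum_upper2 by (auto simp: direct_sum_def submodule_sum)

lemma direct_sum_comm: "direct_sum T U V \<Longrightarrow> direct_sum T V U"
  unfolding direct_sum_def using sum_comm submoduleD(1) by (metis Int_commute)

lemma direct_sumI:
  assumes "submodule U A M" "submodule V A M" "submodule T A M" "U \<subseteq> T" "V \<subseteq> T"
    "\<And>x. x \<in> U \<Longrightarrow> x \<in> V \<Longrightarrow> x = \<zero>\<^bsub>M\<^esub>" "T \<subseteq> U <+>\<^bsub>M\<^esub> V"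
  shows "direct_sum T U V"
  unfolding direct_sum_def using assms sum_least[OF assms(3-5)] submoduleD(2) by blast

lemma direct_sum_zero: "submodule U A M \<Longrightarrow> direct_sum U U {\<zero>\<^bsub>M\<^esub>}"
  using sum_upper1 submodule_zero submoduleD(2)
  by (intro direct_sumI) auto

text \<open>The two projections of \<open>T = U \<oplus> V\<close>, as self-maps of \<open>T\<close> with their kernels and images. They are
  homomorphisms into the ambient module, because all submodules are treated as subsets of one
  module.\<close>

definition projections :: "'b set \<Rightarrow> 'b set \<Rightarrow> 'b set \<Rightarrow> ('b \<Rightarrow> 'b) \<Rightarrow> ('b \<Rightarrow> 'b) \<Rightarrow> bool" where
  "projections T U V p q \<longleftrightarrow> p \<in> mod_hom A (sub_mod M T) M \<and> q \<in> mod_hom A (sub_mod M T) M \<and>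
     (\<forall>x\<in>T. p x \<in> U \<and> q x \<in> V \<and> p x \<oplus>\<^bsub>M\<^esub> q x = x \<and>
       (p x = \<zero>\<^bsub>M\<^esub> \<longleftrightarrow> x \<in> V) \<and> (q x = \<zero>\<^bsub>M\<^esub> \<longleftrightarrow> x \<in> U)) \<and>
     (\<forall>u\<in>U. p u = u) \<and> (\<forall>v\<in>V. q v = v)"

lemma projectionsD:
  assumes "projections T U V p q"
  shows "p \<in> mod_hom A (sub_mod M T) M" "q \<in> mod_hom A (sub_mod M T) M"
    "\<And>x. x \<in> T \<Longrightarrow> p x \<in> U" "\<And>x. x \<in> T \<Longrightarrow> q x \<in> V"
    "\<And>x. x \<in> T \<Longrightarrow> p x \<oplus>\<^bsub>M\<^esub> q x = x"
    "\<And>u. u \<in> U \<Longrightarrow> p u = u" "\<And>v. v \<in> V \<Longrightarrow> q v = v"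
    "\<And>x. x \<in> T \<Longrightarrow> p x = \<zero>\<^bsub>M\<^esub> \<longleftrightarrow> x \<in> V" "\<And>x. x \<in> T \<Longrightarrow> q x = \<zero>\<^bsub>M\<^esub> \<longleftrightarrow> x \<in> U"
  using assms unfolding projections_def by simp_all

lemma direct_sum_projections:
  assumes "direct_sum T U V"
  obtains p q where "projections T U V p q"
proof -
  note d = direct_sumD[OF assms]
  note U = submoduleD[OF d(2)] and V = submoduleD[OF d(3)]
  have un: "u = u' \<and> v = v'"
    if "u \<in> U" "u' \<in> U" "v \<in> V" "v' \<in> V" "u \<oplus>\<^bsub>M\<^esub> v = u' \<oplus>\<^bsub>M\<^esub> v'" for u u' v v'
  proof -
    have c: "u \<in> carrier M" "u' \<in> carrier M" "v \<in> carrier M" "v' \<in> carrier M"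
      using that U(3) V(3) by auto
    have "u \<ominus>\<^bsub>M\<^esub> u' = (u \<oplus>\<^bsub>M\<^esub> v) \<ominus>\<^bsub>M\<^esub> v \<ominus>\<^bsub>M\<^esub> u'" using c by (simp add: a_minus_def M.a_ac M.r_neg)
    also have "\<dots> = (u' \<oplus>\<^bsub>M\<^esub> \<ominus>\<^bsub>M\<^esub> u') \<oplus>\<^bsub>M\<^esub> (v' \<ominus>\<^bsub>M\<^esub> v)"
      unfolding that(5) using c by (simp add: a_minus_def M.a_ac)
    also have "\<dots> = v' \<ominus>\<^bsub>M\<^esub> v" using c by (simp add: M.r_neg)
    finally have "u \<ominus>\<^bsub>M\<^esub> u' = v' \<ominus>\<^bsub>M\<^esub> v" .
    then have "u \<ominus>\<^bsub>M\<^esub> u' = \<zero>\<^bsub>M\<^esub>" "v' \<ominus>\<^bsub>M\<^esub> v = \<zero>\<^bsub>M\<^esub>"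
      using d(4) U(7)[OF that(1,2)] V(7)[OF that(4,3)] by auto
    then show ?thesis using c by (simp add: diff_zero_iff)
  qed
  define r where "r x = (SOME w. fst w \<in> U \<and> snd w \<in> V \<and> fst w \<oplus>\<^bsub>M\<^esub> snd w = x)" for x
  define p where "p x = fst (r x)" for x
  define q where "q x = snd (r x)" for x
  have pq: "p x \<in> U \<and> q x \<in> V \<and> p x \<oplus>\<^bsub>M\<^esub> q x = x" if "x \<in> T" for x
    unfolding p_def q_def r_def
  proof (rule someI_ex)
    show "\<exists>w. fst w \<in> U \<and> snd w \<in> V \<and> fst w \<oplus>\<^bsub>M\<^esub> snd w = x"
      using that unfolding d(5) by (auto elim!: set_addE intro: exI[of _ "(u, v)" for u v])
  qed
  have char: "p (u \<oplus>\<^bsub>M\<^esub> v) = u" "q (u \<oplus>\<^bsub>M\<^esub> v) = v" if "u \<in> U" "v \<in> V" for u v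
    using pq[of "u \<oplus>\<^bsub>M\<^esub> v"] un[of u "p (u \<oplus>\<^bsub>M\<^esub> v)" v "q (u \<oplus>\<^bsub>M\<^esub> v)"] that
      set_addI[OF that] unfolding d(5) by auto
  have pqU: "p u = u" "q u = \<zero>\<^bsub>M\<^esub>" if "u \<in> U" for u
    using char[of u "\<zero>\<^bsub>M\<^esub>"] that U(3) V(2) by auto
  have pqV: "q v = v" "p v = \<zero>\<^bsub>M\<^esub>" if "v \<in> V" for v
    using char[of "\<zero>\<^bsub>M\<^esub>" v] that V(3) U(2) by auto
  have add: "p (x \<oplus>\<^bsub>M\<^esub> y) = p x \<oplus>\<^bsub>M\<^esub> p y \<and> q (x \<oplus>\<^bsub>M\<^esub> y) = q x \<oplus>\<^bsub>M\<^esub> q y"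
    if "x \<in> T" "y \<in> T" for x y
  proof -
    note P = pq[OF that(1)] pq[OF that(2)]
    have "x \<oplus>\<^bsub>M\<^esub> y = (p x \<oplus>\<^bsub>M\<^esub> q x) \<oplus>\<^bsub>M\<^esub> (p y \<oplus>\<^bsub>M\<^esub> q y)" using P by auto
    also have "\<dots> = (p x \<oplus>\<^bsub>M\<^esub> p y) \<oplus>\<^bsub>M\<^esub> (q x \<oplus>\<^bsub>M\<^esub> q y)"
      using P[THEN conjunct1, THEN U(3)] P[THEN conjunct2, THEN conjunct1, THEN V(3)]
      by (simp add: M.a_ac)
    finally show ?thesis using char P U(4) V(4) by simp
  qed
  have smult: "p (a \<odot>\<^bsub>M\<^esub> x) = a \<odot>\<^bsub>M\<^esub> p x \<and> q (a \<odot>\<^bsub>M\<^esub> x) = a \<odot>\<^bsub>M\<^esub> q x"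
    if "x \<in> T" "a \<in> carrier A" for a x
  proof -
    note P = pq[OF that(1)]
    have "a \<odot>\<^bsub>M\<^esub> x = a \<odot>\<^bsub>M\<^esub> (p x \<oplus>\<^bsub>M\<^esub> q x)" using P by auto
    also have "\<dots> = a \<odot>\<^bsub>M\<^esub> p x \<oplus>\<^bsub>M\<^esub> a \<odot>\<^bsub>M\<^esub> q x"
      using P[THEN conjunct1, THEN U(3)] P[THEN conjunct2, THEN conjunct1, THEN V(3)] that(2)
      by (simp add: smult_r_distr)
    finally show ?thesis using char P that U(5) V(5) by simp
  qed
  have "(p x = \<zero>\<^bsub>M\<^esub> \<longleftrightarrow> x \<in> V) \<and> (q x = \<zero>\<^bsub>M\<^esub> \<longleftrightarrow> x \<in> U)" if x: "x \<in> T" for x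
  proof -
    note P = pq[OF x]
    have "p x = \<zero>\<^bsub>M\<^esub> \<longleftrightarrow> x \<in> V" using P pqV V(3) by (metis M.l_zero)
    moreover have "q x = \<zero>\<^bsub>M\<^esub> \<longleftrightarrow> x \<in> U" using P pqU U(3) by (metis M.r_zero)
    ultimately show ?thesis by simp
  qed
  moreover have "p \<in> mod_hom A (sub_mod M T) M" "q \<in> mod_hom A (sub_mod M T) M"
    by (rule mod_homI; use pq add smult U(3) V(3) in simp)+
  ultimately have "projections T U V p q"
    unfolding projections_def using pq pqU pqV by (intro conjI ballI) simp_all
  then show ?thesis by (rule that)
qed

end


context lmod
begin

lemma direct_sum_image:
  assumes "lmod A N" "direct_sum T U V" "h \<in> mod_hom A (sub_mod M T) N" "inj_on h T"
  shows "lmod.direct_sum A N (h ` T) (h ` U) (h ` V)"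
proof -
  note d = direct_sumD[OF assms(2)]
  interpret N: lmod A N by fact
  interpret T: lmod A "sub_mod M T" by (rule lmod_sub_mod[OF d(1)])
  note sub = T.submodule_image[OF assms(1,3)] submodule_sub_mod_iff[OF d(1)]
  have z: "h \<zero>\<^bsub>M\<^esub> = \<zero>\<^bsub>N\<^esub>" using T.hom_zero[OF assms(1,3)] by simp
  have add: "h (x \<oplus>\<^bsub>M\<^esub> y) = h x \<oplus>\<^bsub>N\<^esub> h y" if "x \<in> T" "y \<in> T" for x y
    using mod_homD(2)[OF assms(3), of x y] that by simp
  show ?thesis
  proof (rule N.direct_sumI)
    fix x assume "x \<in> h ` U" "x \<in> h ` V"
    then obtain u v where "u \<in> U" "v \<in> V" "x = h u" "x = h v" by blast
    moreover from this have "u = v" using d(6,7) inj_onD[OF assms(4), of u v] by auto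
    moreover from calculation have "u = \<zero>\<^bsub>M\<^esub>" using d(4) by blast
    ultimately show "x = \<zero>\<^bsub>N\<^esub>" using z by simp
  next
    show "h ` T \<subseteq> h ` U <+>\<^bsub>N\<^esub> h ` V"
    proof
      fix y assume "y \<in> h ` T"
      then obtain x where "x \<in> T" "y = h x" by blast
      then obtain u v where uv: "u \<in> U" "v \<in> V" "y = h (u \<oplus>\<^bsub>M\<^esub> v)"
        unfolding d(5) by (auto elim!: set_addE)
      have "y = h u \<oplus>\<^bsub>N\<^esub> h v"
        unfolding uv(3) by (rule add) (use uv d(6,7) in auto)
      then show "y \<in> h ` U <+>\<^bsub>N\<^esub> h ` V"
        using N.set_addI[OF imageI[OF uv(1), of h] imageI[OF uv(2), of h]] by simp
    qed
  qed (use sub d in auto)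
qed

text \<open>Indecomposability of a submodule, expressed inside the ambient module. This avoids nested
  submodule records in the arguments about direct sums.\<close>

definition indec :: "'b set \<Rightarrow> bool" where
  "indec U \<longleftrightarrow> submodule U A M \<and> U \<noteq> {\<zero>\<^bsub>M\<^esub>} \<and>
     (\<forall>P Q. direct_sum U P Q \<longrightarrow> P = {\<zero>\<^bsub>M\<^esub>} \<or> Q = {\<zero>\<^bsub>M\<^esub>})"

lemma direct_sum_sub_mod_iff:
  assumes "submodule U A M" "T \<subseteq> U"
  shows "lmod.direct_sum A (sub_mod M U) T P Q \<longleftrightarrow> direct_sum T P Q"
proof -
  interpret U: lmod A "sub_mod M U" by (rule lmod_sub_mod[OF assms(1)])
  show ?thesis using assms(2) direct_sumD(6,7)[of T P Q]
    unfolding U.direct_sum_def direct_sum_def submodule_sub_mod_iff[OF assms(1)] by auto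
qed

lemma indec_sub_mod_iff:
  assumes "submodule U A M" "T \<subseteq> U"
  shows "lmod.indec A (sub_mod M U) T \<longleftrightarrow> indec T"
proof -
  interpret U: lmod A "sub_mod M U" by (rule lmod_sub_mod[OF assms(1)])
  show ?thesis using assms(2)
    unfolding U.indec_def indec_def submodule_sub_mod_iff[OF assms(1)]
      direct_sum_sub_mod_iff[OF assms] by auto
qed

lemma indecomposable_mod_iff: "indecomposable_mod A M \<longleftrightarrow> indec (carrier M)"
  unfolding indecomposable_mod_def indec_def direct_sum_def using submodule_carrier by auto

lemma indecomposable_sub_mod_iff:
  assumes "submodule U A M" shows "indecomposable_mod A (sub_mod M U) \<longleftrightarrow> indec U"
proof -
  interpret U: lmod A "sub_mod M U" by (rule lmod_sub_mod[OF assms(1)])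
  show ?thesis unfolding U.indecomposable_mod_iff using indec_sub_mod_iff[OF assms order_refl] by simp
qed

text \<open>The inverse of \<open>h\<close> carries a decomposition of the image back to \<open>U\<close>.\<close>

lemma indec_image:
  assumes "lmod A N" "indec U" "h \<in> mod_hom A (sub_mod M U) N" "inj_on h U"
  shows "lmod.indec A N (h ` U)"
proof -
  have U: "submodule U A M" using assms(2) by (simp add: indec_def)
  interpret N: lmod A N by fact
  interpret U: lmod A "sub_mod M U" by (rule lmod_sub_mod[OF U])
  have sub: "submodule (h ` U) A N" using U.submodule_image[OF assms(1,3) U.submodule_carrier] by simp
  interpret hU: lmod A "sub_mod N (h ` U)" by (rule N.lmod_sub_mod[OF sub])
  have z: "h \<zero>\<^bsub>M\<^esub> = \<zero>\<^bsub>N\<^esub>" using U.hom_zero[OF assms(1,3)] by simp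
  let ?k = "inv_into U h"
  have hb: "bij_betw h (carrier (sub_mod M U)) (carrier (sub_mod N (h ` U)))"
    using assms(4) by (simp add: bij_betw_def)
  have h': "h \<in> mod_hom A (sub_mod M U) (sub_mod N (h ` U))"
    using mod_hom_into_sub[OF assms(3)] by simp
  have "?k \<in> mod_hom A (sub_mod N (h ` U)) (sub_mod M U)"
    using U.hom_inv_into[OF hU.lmod_axioms h' hb] by simp
  then have k: "?k \<in> mod_hom A (sub_mod N (h ` U)) M"
    by (rule mod_hom_from_into_sub) (rule submoduleD(1)[OF U])
  have kh: "?k ` h ` W = W" if "W \<subseteq> U" for W using inv_into_image_cancel[OF assms(4) that] .
  have hk: "h ` ?k ` W = W" if "W \<subseteq> h ` U" for W
    using that by (intro image_inv_into_cancel) auto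
  have "h ` U \<noteq> {\<zero>\<^bsub>N\<^esub>}"
  proof
    assume "h ` U = {\<zero>\<^bsub>N\<^esub>}"
    have "U \<subseteq> {\<zero>\<^bsub>M\<^esub>}"
    proof
      fix x assume x: "x \<in> U"
      then have "h x \<in> {\<zero>\<^bsub>N\<^esub>}" using \<open>h ` U = _\<close> by blast
      then have "h x = h \<zero>\<^bsub>M\<^esub>" using z by simp
      then show "x \<in> {\<zero>\<^bsub>M\<^esub>}" using inj_onD[OF assms(4) _ x submoduleD(2)[OF U]] by simp
    qed
    then have "U = {\<zero>\<^bsub>M\<^esub>}" using submoduleD(2)[OF U] by blast
    then show False using assms(2) by (simp add: indec_def)
  qed
  moreover have "P = {\<zero>\<^bsub>N\<^esub>} \<or> Q = {\<zero>\<^bsub>N\<^esub>}" if d: "N.direct_sum (h ` U) P Q" for P Q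
  proof -
    have i: "inj_on ?k (h ` U)" by (rule inj_on_inv_into) simp
    have "direct_sum (?k ` h ` U) (?k ` P) (?k ` Q)"
      by (rule N.direct_sum_image[OF lmod_axioms d k i])
    then have "?k ` P = {\<zero>\<^bsub>M\<^esub>} \<or> ?k ` Q = {\<zero>\<^bsub>M\<^esub>}"
      using assms(2) unfolding kh[OF order_refl] indec_def by blast
    moreover have "W = {\<zero>\<^bsub>N\<^esub>}" if "?k ` W = {\<zero>\<^bsub>M\<^esub>}" "W \<subseteq> h ` U" for W
      using hk[OF that(2)] z unfolding that(1) by simp
    ultimately show ?thesis using N.direct_sumD(6,7)[OF d] by blast
  qed
  ultimately show ?thesis unfolding N.indec_def using sub by blast
qed

text \<open>The submodule is a direct sum of \<open>n\<close> indecomposable submodules, split off one after the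
  other. Inductive proofs over this predicate replace manipulations of indexed families; the link to
  decompositions into a set of summands is made in \<open>num_summands_eq\<close>.\<close>

inductive indec_sum :: "nat \<Rightarrow> 'b set \<Rightarrow> bool" where
  indec_sum_zero: "indec_sum 0 {\<zero>\<^bsub>M\<^esub>}"
| indec_sum_Suc: "indec U \<Longrightarrow> indec_sum n V \<Longrightarrow> direct_sum T U V \<Longrightarrow> indec_sum (Suc n) T"

lemma indec_sum_submodule: "indec_sum n T \<Longrightarrow> submodule T A M"
  by (induction rule: indec_sum.induct) (auto simp: submodule_zero direct_sumD(1))

lemma indec_sum_0_iff: "indec_sum 0 T \<longleftrightarrow> T = {\<zero>\<^bsub>M\<^esub>}"
  by (auto elim: indec_sum.cases intro: indec_sum_zero)

lemma direct_sum_eq_zero: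
  assumes "direct_sum {\<zero>\<^bsub>M\<^esub>} U V" shows "U = {\<zero>\<^bsub>M\<^esub>}"
  using direct_sumD(6)[OF assms] submoduleD(2)[OF direct_sumD(2)[OF assms]] by auto

lemma indec_sum_of_zero: "indec_sum n {\<zero>\<^bsub>M\<^esub>} \<Longrightarrow> n = 0"
  by (erule indec_sum.cases) (auto dest: direct_sum_eq_zero simp: indec_def)

lemma indec_sum_1: "indec U \<Longrightarrow> indec_sum 1 U"
  using indec_sum_Suc[OF _ indec_sum_zero direct_sum_zero] by (auto simp: indec_def)

lemma indec_sum_image:
  assumes "lmod A N" "indec_sum n T" "h \<in> mod_hom A (sub_mod M T) N" "inj_on h T"
  shows "lmod.indec_sum A N n (h ` T)"
  using assms(2-4)
proof (induction rule: indec_sum.induct)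
  interpret N: lmod A N by fact
  case indec_sum_zero
  interpret Z: lmod A "sub_mod M {\<zero>\<^bsub>M\<^esub>}" by (rule lmod_sub_mod[OF submodule_zero])
  show ?case using Z.hom_zero[OF assms(1) indec_sum_zero(1)] N.indec_sum_zero by simp
next
  interpret N: lmod A N by fact
  case (indec_sum_Suc U n V T)
  note d = direct_sumD[OF indec_sum_Suc.hyps(3)]
  have "h \<in> mod_hom A (sub_mod M U) N" "h \<in> mod_hom A (sub_mod M V) N"
    using mod_hom_restrict[OF indec_sum_Suc.prems(1), of U] mod_hom_restrict[OF indec_sum_Suc.prems(1), of V] d(6,7) by auto
  moreover have "inj_on h U" "inj_on h V" using inj_on_subset[OF indec_sum_Suc.prems(2)] d(6,7) by auto
  ultimately show ?case
    using N.indec_sum_Suc[OF indec_image[OF assms(1) indec_sum_Suc.hyps(1)] indec_sum_Suc.IH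
      direct_sum_image[OF assms(1) indec_sum_Suc.hyps(3) indec_sum_Suc.prems]] by blast
qed

lemma indec_sum_sub_mod_iff:
  assumes "submodule U A M" "T \<subseteq> U"
  shows "lmod.indec_sum A (sub_mod M U) n T \<longleftrightarrow> indec_sum n T"
proof -
  interpret U: lmod A "sub_mod M U" by (rule lmod_sub_mod[OF assms(1)])
  have id: "(\<lambda>x. x) \<in> mod_hom A (sub_mod M T) (sub_mod M U)"
    using assms by (auto simp: mod_hom_def)
  have id': "(\<lambda>x. x) \<in> mod_hom A (sub_mod (sub_mod M U) T) M"
    using assms submoduleD(1)[OF assms(1)] by (auto simp: mod_hom_def)
  show ?thesis using indec_sum_image[OF U.lmod_axioms _ id] U.indec_sum_image[OF lmod_axioms _ id'] by auto
qed

text \<open>By the modular law \<open>W' + V\<close> meets \<open>U\<close> only in \<open>W'\<close>, hence meets \<open>W\<close> trivially. This is the tool for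
  regrouping nested decompositions.\<close>

lemma direct_sum_assoc:
  assumes "direct_sum T U V" "direct_sum U W W'"
  shows "direct_sum T W (W' <+>\<^bsub>M\<^esub> V)" "direct_sum (W' <+>\<^bsub>M\<^esub> V) W' V"
proof -
  note d = direct_sumD[OF assms(1)] and e = direct_sumD[OF assms(2)]
  have "(W' <+>\<^bsub>M\<^esub> V) \<inter> U = W'"
    using modular_law[OF e(3) d(3) d(2) e(7)] d(4) sum_comm[of W' "{\<zero>\<^bsub>M\<^esub>}"]
      direct_sumD(5)[OF direct_sum_zero[OF e(3)]] by (simp add: Int_commute)
  then have "W \<inter> (W' <+>\<^bsub>M\<^esub> V) = {\<zero>\<^bsub>M\<^esub>}" using e(4,6) by blast
  then show "direct_sum T W (W' <+>\<^bsub>M\<^esub> V)"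
    unfolding direct_sum_def using d e submodule_sum sum_assoc by auto
  show "direct_sum (W' <+>\<^bsub>M\<^esub> V) W' V"
    unfolding direct_sum_def using d(2-4) e(2,3,7) submoduleD(2) by blast
qed

lemma indec_sum_sum:
  assumes "indec_sum m U" "indec_sum n V" "direct_sum T U V"
  shows "indec_sum (m + n) T"
  using assms
proof (induction arbitrary: T rule: indec_sum.induct)
  case indec_sum_zero
  then have "T = V" using direct_sumD(5)[OF direct_sum_comm[OF indec_sum_zero(2)]]
      direct_sumD(5)[OF direct_sum_zero[OF indec_sum_submodule[OF indec_sum_zero(1)]]] by simp
  then show ?case using indec_sum_zero by simp
next
  case (indec_sum_Suc P k Q U)
  note a = direct_sum_assoc[OF indec_sum_Suc.prems(2) indec_sum_Suc.hyps(3)]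
  show ?case using indec_sum.indec_sum_Suc[OF indec_sum_Suc.hyps(1) indec_sum_Suc.IH[OF indec_sum_Suc.prems(1) a(2)] a(1)] by simp
qed

text \<open>Splitting a decomposable submodule yields smaller ones, so this terminates for finite modules.\<close>

lemma indec_sum_exists:
  assumes "submodule T A M" "finite T"
  shows "\<exists>n. indec_sum n T"
  using assms
proof (induction "card T" arbitrary: T rule: less_induct)
  case less
  show ?case
  proof (cases "T = {\<zero>\<^bsub>M\<^esub>} \<or> indec T")
    case True
    then show ?thesis using indec_sum_zero indec_sum_1 by auto
  next
    case False
    then obtain P Q where d: "direct_sum T P Q" "P \<noteq> {\<zero>\<^bsub>M\<^esub>}" "Q \<noteq> {\<zero>\<^bsub>M\<^esub>}"
      using less.prems(1) unfolding indec_def by blast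
    note e = direct_sumD[OF d(1)]
    have "P \<noteq> T" "Q \<noteq> T" using d(2,3) e(4,6,7) by blast+
    then have "card P < card T" "card Q < card T"
      using e(6,7) less.prems(2) by (auto intro!: psubset_card_mono)
    then obtain m n where "indec_sum m P" "indec_sum n Q"
      using less.hyps[of P] less.hyps[of Q] e(2,3,6,7) less.prems(2) finite_subset by metis
    then show ?thesis using indec_sum_sum d(1) by blast
  qed
qed

text \<open>Both complements of \<open>W\<close> map isomorphically onto the quotient by \<open>W\<close>; concretely, the
  projection onto \<open>V'\<close> along \<open>W\<close> restricts to an isomorphism on \<open>V\<close>.\<close>

lemma complements_isomorphic:
  assumes "direct_sum T W V" "direct_sum T W V'"
  obtains h where "h \<in> mod_hom A (sub_mod M V) M" "inj_on h V" "h ` V = V'"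
proof -
  note d = direct_sumD[OF assms(1)] and d' = direct_sumD[OF assms(2)]
  obtain p q where "projections T W V' p q"
    by (rule direct_sum_projections[OF assms(2)])
  note pq = projectionsD[OF this]
  interpret V: lmod A "sub_mod M V" by (rule lmod_sub_mod[OF d(3)])
  have q: "q \<in> mod_hom A (sub_mod M V) M"
    using mod_hom_restrict[OF pq(2), of V] d(7) by simp
  have "inj_on q V"
    using V.hom_inj_on_iff[OF lmod_axioms q] pq(9) d(4,7) by auto
  moreover have "V' \<subseteq> q ` V"
  proof
    fix x assume x: "x \<in> V'"
    then have "x \<in> W <+>\<^bsub>M\<^esub> V" using d'(7) d(5) by blast
    then obtain w v where wv: "w \<in> W" "v \<in> V" "x = w \<oplus>\<^bsub>M\<^esub> v" by (rule set_addE)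
    then have "q x = q w \<oplus>\<^bsub>M\<^esub> q v" using mod_homD(2)[OF pq(2), of w v] d(6,7) by auto
    moreover have "q w = \<zero>\<^bsub>M\<^esub>" using pq(9)[of w] wv(1) d(6) by auto
    moreover have "q v \<in> carrier M" using pq(4)[of v] wv d(7) submoduleD(3)[OF d'(3)] by auto
    ultimately show "x \<in> q ` V" using pq(7)[OF x] wv(2) by auto
  qed
  ultimately show ?thesis using that[OF q] pq(4) d(7) by blast
qed

lemma indec_sum_complement:
  assumes "direct_sum T W V" "direct_sum T W V'" "indec_sum n V"
  shows "indec_sum n V'"
  using complements_isomorphic[OF assms(1,2)] indec_sum_image[OF lmod_axioms assms(3)] by metis

lemma indec_complement:
  assumes "direct_sum T W V" "direct_sum T W V'" "indec V"
  shows "indec V'"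
  using complements_isomorphic[OF assms(1,2)] indec_image[OF lmod_axioms assms(3)] by metis

end

section \<open>Uniqueness of the number of summands\<close>

text \<open>The powers of \<open>f\<close> on a finite set repeat: \<open>f\<^sup>i = f\<^sup>i\<^sup>+\<^sup>p\<close> for some \<open>p > 0\<close>. Then \<open>f\<^sup>n\<close> is idempotent for
  every multiple \<open>n \<ge> i\<close> of \<open>p\<close>.\<close>

lemma idempotent_power:
  assumes "finite S" "f ` S \<subseteq> S"
  obtains n where "n > 0" "\<And>x. x \<in> S \<Longrightarrow> (f ^^ n) ((f ^^ n) x) = (f ^^ n) x"
proof -
  have cl: "(f ^^ k) x \<in> S" if "x \<in> S" for k x using that assms(2) by (induction k) auto
  have "finite (range (\<lambda>k. restrict (f ^^ k) S))"
    by (rule finite_subset[of _ "S \<rightarrow>\<^sub>E S"]) (use cl assms(1) in \<open>auto intro!: finite_PiE\<close>)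
  then have "\<not> inj (\<lambda>k. restrict (f ^^ k) S)" using finite_imageD infinite_UNIV_nat by blast
  then obtain i j where ij: "i < j" "restrict (f ^^ i) S = restrict (f ^^ j) S"
    unfolding inj_def by (metis nat_neq_iff)
  define p where "p = j - i"
  have per: "(f ^^ (k + p)) x = (f ^^ k) x" if "x \<in> S" "i \<le> k" for k x
  proof -
    have "k + p = (k - i) + j" "(k - i) + i = k" using ij(1) that(2) by (auto simp: p_def)
    moreover have "(f ^^ j) x = (f ^^ i) x" using fun_cong[OF ij(2), of x] that(1) by simp
    ultimately show ?thesis by (metis comp_apply funpow_add)
  qed
  have pers: "(f ^^ (k + m * p)) x = (f ^^ k) x" if "x \<in> S" "i \<le> k" for k m x
  proof (induction m)
    case (Suc m)
    have "k + Suc m * p = k + m * p + p" by simp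
    then show ?case using per[of x "k + m * p"] that Suc by (metis trans_le_add1)
  qed simp
  have "p > 0" using ij(1) by (simp add: p_def)
  then have "i * 1 \<le> Suc i * p" by (intro mult_le_mono) auto
  then have "i \<le> Suc i * p" by simp
  then have "(f ^^ (Suc i * p)) ((f ^^ (Suc i * p)) x) = (f ^^ (Suc i * p)) x" if "x \<in> S" for x
    using pers[OF that, of "Suc i * p" "Suc i"] by (metis comp_apply funpow_add)
  moreover have "Suc i * p > 0" using \<open>p > 0\<close> unfolding nat_0_less_mult_iff by blast
  ultimately show ?thesis using that by metis
qed

context lmod
begin

text \<open>This is Fitting's lemma in the form needed for the exchange property. An idempotent power \<open>e\<close> of \<open>f\<close>
  splits \<open>U\<close> into kernel and image, so by indecomposability either \<open>e\<close>, and with it \<open>f\<close>, has trivial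
  kernel, or \<open>e = 0\<close>. In the latter case \<open>f\<close> is nilpotent and \<open>g = 1 - f\<close> is injective, because on the
  kernel of \<open>g\<close> the map \<open>f\<close> is the identity.\<close>

lemma indec_endomorphisms_adding_to_id:
  assumes "indec U" "finite U" "f \<in> mod_hom A (sub_mod M U) (sub_mod M U)"
    "g \<in> mod_hom A (sub_mod M U) (sub_mod M U)" "\<And>x. x \<in> U \<Longrightarrow> f x \<oplus>\<^bsub>M\<^esub> g x = x"
  shows "inj_on f U \<or> inj_on g U"
proof -
  have U: "submodule U A M" using assms(1) by (simp add: indec_def)
  interpret U: lmod A "sub_mod M U" by (rule lmod_sub_mod[OF U])
  note f = mod_homD[OF assms(3), simplified] and g = mod_homD[OF assms(4), simplified]
  obtain n where n: "n > 0" "\<And>x. x \<in> U \<Longrightarrow> (f ^^ n) ((f ^^ n) x) = (f ^^ n) x"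
    using idempotent_power[OF assms(2), of f] f(1) by blast
  define e where "e = f ^^ n"
  have "f ^^ k \<in> mod_hom A (sub_mod M U) (sub_mod M U)" for k
  proof (induction k)
    case (Suc k)
    then show ?case using mod_hom_comp[OF Suc assms(3)] by (simp add: comp_def)
  qed (auto intro!: mod_homI)
  then have e: "e \<in> mod_hom A (sub_mod M U) (sub_mod M U)" by (simp add: e_def)
  note e' = mod_homD[OF e, simplified] U.hom_zero[OF U.lmod_axioms e, simplified]
  have idem: "e (e x) = e x" if "x \<in> U" for x using n(2)[OF that] by (simp add: e_def)
  define P where "P = {x \<in> U. e x = \<zero>\<^bsub>M\<^esub>}"
  have "U.direct_sum U P (e ` U)"
  proof (rule U.direct_sumI)
    show "submodule P A (sub_mod M U)"
      using U.submodule_kernel[OF U.lmod_axioms e] by (simp add: P_def)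
    show "submodule (e ` U) A (sub_mod M U)"
      using U.submodule_image[OF U.lmod_axioms e U.submodule_carrier] by simp
    show "submodule U A (sub_mod M U)" using U.submodule_carrier by simp
    show "x = \<zero>\<^bsub>sub_mod M U\<^esub>" if "x \<in> P" "x \<in> e ` U" for x
      using that idem by (auto simp: P_def)
    show "U \<subseteq> P <+>\<^bsub>sub_mod M U\<^esub> e ` U"
    proof
      fix x assume x: "x \<in> U"
      have ex: "e x \<in> U" using e'(1) x .
      have "e (x \<ominus>\<^bsub>sub_mod M U\<^esub> e x) = \<zero>\<^bsub>M\<^esub>"
        using U.hom_eq_iff[OF U.lmod_axioms e, of x "e x"] x ex idem[OF x] by simp
      moreover have m: "x \<ominus>\<^bsub>sub_mod M U\<^esub> e x \<in> U" using U.M.minus_closed[of x "e x"] x ex by simp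
      ultimately have "x \<ominus>\<^bsub>sub_mod M U\<^esub> e x \<in> P" by (simp add: P_def)
      moreover have "x = (x \<ominus>\<^bsub>sub_mod M U\<^esub> e x) \<oplus>\<^bsub>sub_mod M U\<^esub> e x"
        using U.M.a_assoc[of x "\<ominus>\<^bsub>sub_mod M U\<^esub> e x" "e x"] x ex U.M.a_inv_closed[of "e x"]
          U.M.l_neg[of "e x"] submoduleD(3)[OF U] by (simp add: a_minus_def)
      ultimately show "x \<in> P <+>\<^bsub>sub_mod M U\<^esub> e ` U" using U.set_addI x by (metis imageI)
    qed
  qed (use e'(1) in \<open>auto simp: P_def\<close>)
  then have "direct_sum U P (e ` U)" using direct_sum_sub_mod_iff[OF U order_refl] by simp
  then consider "P = {\<zero>\<^bsub>M\<^esub>}" | "e ` U = {\<zero>\<^bsub>M\<^esub>}" using assms(1) unfolding indec_def by blast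
  then show ?thesis
  proof cases
    case 1
    have f0: "f \<zero>\<^bsub>M\<^esub> = \<zero>\<^bsub>M\<^esub>" using U.hom_zero[OF U.lmod_axioms assms(3)] by simp
    have "(f ^^ k) \<zero>\<^bsub>M\<^esub> = \<zero>\<^bsub>M\<^esub>" for k by (induction k) (simp_all add: f0)
    then have "e x = \<zero>\<^bsub>M\<^esub>" if "f x = \<zero>\<^bsub>M\<^esub>" for x
      using that n(1) by (cases n) (simp_all add: e_def funpow_swap1 del: funpow.simps(2) add: funpow_Suc_right)
    then have "\<forall>x\<in>U. f x = \<zero>\<^bsub>M\<^esub> \<longrightarrow> x = \<zero>\<^bsub>M\<^esub>" using 1 unfolding P_def by blast
    then show ?thesis using U.hom_inj_on_iff[OF U.lmod_axioms assms(3)] by simp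
  next
    case 2
    have "x = \<zero>\<^bsub>M\<^esub>" if x: "x \<in> U" "g x = \<zero>\<^bsub>M\<^esub>" for x
    proof -
      have "f x = x" using assms(5)[OF x(1)] x f(1)[OF x(1)] submoduleD(3)[OF U] by simp
      then have "(f ^^ k) x = x" for k by (induction k) simp_all
      then have "e x = x" by (simp add: e_def)
      then show ?thesis using 2 x(1) by force
    qed
    then show ?thesis using U.hom_inj_on_iff[OF U.lmod_axioms assms(4)] by simp
  qed
qed

text \<open>Let \<open>\<pi>\<close> be the projection onto \<open>U\<close> along \<open>V\<close>, and \<open>p\<close>, \<open>q\<close> the projections onto \<open>P\<close> and \<open>Q\<close>. On \<open>U\<close>
  the endomorphisms \<open>\<pi> p\<close> and \<open>\<pi> q\<close> add up to the identity, so one of them, say \<open>\<pi> p\<close>, is injective and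
  hence bijective. Then \<open>\<pi>\<close> maps \<open>W = p(U)\<close> bijectively onto \<open>U\<close>, that is, \<open>W\<close> is a complement of
  \<open>V\<close>.\<close>

lemma exchange:
  assumes "direct_sum T U V" "direct_sum T P Q" "indec U" "finite U"
  obtains W where "direct_sum T W V" "W \<subseteq> P \<or> W \<subseteq> Q"
proof -
  note d = direct_sumD[OF assms(1)] and e = direct_sumD[OF assms(2)]
  note U = submoduleD[OF d(2)]
  obtain \<pi> s where "projections T U V \<pi> s"
    by (rule direct_sum_projections[OF assms(1)])
  note ps = projectionsD[OF this]
  obtain p q where "projections T P Q p q"
    by (rule direct_sum_projections[OF assms(2)])
  note pq = projectionsD[OF this]
  have pT: "p x \<in> T" "q x \<in> T" if "x \<in> T" for x using pq(3,4)[OF that] e(6,7) by auto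
  have UT: "x \<in> T" if "x \<in> U" for x using that d(6) by auto
  note \<pi> = mod_homD[OF ps(1), simplified]
  have endo: "(\<lambda>x. \<pi> (r x)) \<in> mod_hom A (sub_mod M U) (sub_mod M U)"
    if "r \<in> mod_hom A (sub_mod M T) M" "\<And>x. x \<in> T \<Longrightarrow> r x \<in> T" for r
    using mod_homD[OF that(1), simplified] \<pi> ps(3) that(2) UT by (auto intro!: mod_homI)
  have "\<pi> (p x) \<oplus>\<^bsub>M\<^esub> \<pi> (q x) = x" if "x \<in> U" for x
    using \<pi>(2)[OF pT[OF UT[OF that]]] pq(5)[OF UT[OF that]] ps(6)[OF that] by simp
  note id = this
  have inj: "inj_on (\<lambda>x. \<pi> (p x)) U \<or> inj_on (\<lambda>x. \<pi> (q x)) U"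
    by (rule indec_endomorphisms_adding_to_id[OF assms(3,4) endo[OF pq(1) pT(1)] endo[OF pq(2) pT(2)] id])
  have "direct_sum T (r ` U) V"
    if r: "r \<in> mod_hom A (sub_mod M T) M" "\<And>x. x \<in> T \<Longrightarrow> r x \<in> T" and i: "inj_on (\<lambda>x. \<pi> (r x)) U" for r
  proof (rule direct_sumI)
    interpret T: lmod A "sub_mod M T" by (rule lmod_sub_mod[OF d(1)])
    interpret U: lmod A "sub_mod M U" by (rule lmod_sub_mod[OF d(2)])
    have s: "(\<lambda>x. \<pi> (r x)) ` U = U"
      by (rule endo_inj_surj[OF assms(4) _ i]) (use r(2) ps(3) UT in auto)
    have sT: "submodule U A (sub_mod M T)" using submodule_sub_mod_iff[OF d(1)] d(2,6) by simp
    show "submodule (r ` U) A M" by (rule T.submodule_image[OF lmod_axioms r(1) sT])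
    show "r ` U \<subseteq> T" using r(2) UT by auto
    show "x = \<zero>\<^bsub>M\<^esub>" if "x \<in> r ` U" "x \<in> V" for x
    proof -
      obtain u where u: "u \<in> U" "x = r u" using \<open>x \<in> r ` U\<close> by (rule imageE) simp
      then have "\<pi> (r u) = \<zero>\<^bsub>M\<^esub>" using ps(8)[of x] r(2)[OF UT] that by auto
      then have "u = \<zero>\<^bsub>M\<^esub>" using U.hom_inj_on_iff[OF lmod_axioms mod_hom_from_into_sub[OF endo[OF r] U(1)]] i u by simp
      then show ?thesis using T.hom_zero[OF lmod_axioms r(1)] u by simp
    qed
    show "T \<subseteq> r ` U <+>\<^bsub>M\<^esub> V"
    proof
      fix x assume x: "x \<in> T"
      have "\<pi> x \<in> (\<lambda>x. \<pi> (r x)) ` U" unfolding s by (rule ps(3)[OF x])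
      then obtain u where u: "u \<in> U" "\<pi> (r u) = \<pi> x" by (rule imageE) simp
      have ru: "r u \<in> T" using r(2) UT u by auto
      have "\<pi> (x \<ominus>\<^bsub>sub_mod M T\<^esub> r u) = \<zero>\<^bsub>M\<^esub>"
        using T.hom_eq_iff[OF lmod_axioms ps(1), of x "r u"] x ru u by simp
      moreover have m: "x \<ominus>\<^bsub>sub_mod M T\<^esub> r u \<in> T" using T.M.minus_closed[of x "r u"] x ru by simp
      ultimately have "x \<ominus>\<^bsub>sub_mod M T\<^esub> r u \<in> V" using ps(8) by simp
      moreover have "x = r u \<oplus>\<^bsub>M\<^esub> (x \<ominus>\<^bsub>sub_mod M T\<^esub> r u)"
        using T.M.r_neg1[of "r u" x] T.M.a_comm[of x "\<ominus>\<^bsub>sub_mod M T\<^esub> r u"] T.M.a_assoc[of "r u" "\<ominus>\<^bsub>sub_mod M T\<^esub> r u" x] T.M.a_inv_closed[of "r u"] T.M.r_neg[of "r u"] x ru submoduleD(3)[OF d(1)]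
        by (simp add: a_minus_def)
      ultimately show "x \<in> r ` U <+>\<^bsub>M\<^esub> V"
        using set_addI[OF imageI[OF u(1), of r], of "x \<ominus>\<^bsub>sub_mod M T\<^esub> r u" V] by simp
    qed
  qed (use d in auto)
  note W = this[OF pq(1) pT(1)] this[OF pq(2) pT(2)]
  have "p ` U \<subseteq> P" "q ` U \<subseteq> Q" using pq(3,4) UT by auto
  with inj W show ?thesis using that by metis
qed

text \<open>By the exchange property \<open>U\<close> may be replaced by a summand \<open>W\<close> of the first summand \<open>P\<close>, which is then
  \<open>P\<close> itself, or of the complement \<open>Q\<close> of \<open>P\<close>, to which the induction hypothesis applies. In both
  cases a second complement of \<open>W\<close> with known decomposition appears, and complements are
  isomorphic.\<close>

lemma indec_sum_split_summand:
  assumes "indec_sum m T" "direct_sum T U V" "indec U" "finite T"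
  shows "\<exists>k. m = Suc k \<and> indec_sum k V"
  using assms
proof (induction arbitrary: U V rule: indec_sum.induct)
  case indec_sum_zero
  then show ?case using direct_sum_eq_zero by (auto simp: indec_def)
next
  case (indec_sum_Suc P m Q T)
  note d = direct_sumD[OF indec_sum_Suc.prems(1)] and e = direct_sumD[OF indec_sum_Suc.hyps(3)]
  have fin: "finite U" "finite Q" using d(6) e(7) indec_sum_Suc.prems(3) finite_subset by blast+
  obtain W where W: "direct_sum T W V" "W \<subseteq> P \<or> W \<subseteq> Q"
    using exchange[OF indec_sum_Suc.prems(1) indec_sum_Suc.hyps(3) indec_sum_Suc.prems(2) fin(1)] .
  note w = direct_sumD[OF W(1)]
  have iW: "indec W"
    using indec_complement[OF direct_sum_comm[OF indec_sum_Suc.prems(1)] direct_sum_comm[OF W(1)] indec_sum_Suc.prems(2)] .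
  have sub: "direct_sum S W (S \<inter> V)" if "submodule S A M" "S \<subseteq> T" "W \<subseteq> S" for S
    using modular_law[OF w(2,3) that(1,3)] that w submodule_Int
    unfolding direct_sum_def by auto
  from W(2) show ?case
  proof
    assume "W \<subseteq> P"
    from sub[OF e(2,6) this] have "direct_sum P W (P \<inter> V)" .
    moreover from this have "P \<inter> V = {\<zero>\<^bsub>M\<^esub>}"
      using indec_sum_Suc.hyps(1) iW unfolding indec_def by blast
    ultimately have "P = W" using direct_sum_zero[OF w(2)] by (metis direct_sumD(5))
    then show ?thesis using indec_sum_complement[OF indec_sum_Suc.hyps(3) _ indec_sum_Suc.hyps(2)] W(1) by blast
  next
    assume "W \<subseteq> Q"
    from sub[OF e(3,7) this] have Q: "direct_sum Q W (Q \<inter> V)" .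
    obtain k where k: "m = Suc k" "indec_sum k (Q \<inter> V)" using indec_sum_Suc.IH[OF Q iW fin(2)] by blast
    note a = direct_sum_assoc[OF direct_sum_comm[OF indec_sum_Suc.hyps(3)] Q]
    have "indec_sum (Suc k) ((Q \<inter> V) <+>\<^bsub>M\<^esub> P)"
      using indec_sum.indec_sum_Suc[OF indec_sum_Suc.hyps(1) k(2) direct_sum_comm[OF a(2)]] .
    then have "indec_sum (Suc k) V" using indec_sum_complement[OF a(1) W(1)] by blast
    then show ?thesis using k by blast
  qed
qed

text \<open>The part of the Krull-Schmidt theorem that concerns the number of summands.\<close>

theorem indec_sum_unique:
  assumes "indec_sum m T" "indec_sum n T" "finite T"
  shows "m = n"
  using assms
proof (induction arbitrary: n rule: indec_sum.induct)
  case indec_sum_zero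
  then show ?case using indec_sum_of_zero by simp
next
  case (indec_sum_Suc U m V T)
  obtain k where k: "n = Suc k" "indec_sum k V"
    using indec_sum_split_summand[OF indec_sum_Suc.prems(1) indec_sum_Suc.hyps(3,1) indec_sum_Suc.prems(2)] by blast
  moreover have "finite V" using direct_sumD(7)[OF indec_sum_Suc.hyps(3)] indec_sum_Suc.prems(2) finite_subset by blast
  ultimately show ?case using indec_sum_Suc.IH by blast
qed

end


section \<open>Decompositions into sets of summands\<close>

context lmod
begin

text \<open>The sums of families \<open>(u\<^sub>U)\<^sub>U\<close> with \<open>u\<^sub>U \<in> U\<close>. The set \<open>\<U>\<close> is independent iff this is injective on
  the extensional families.\<close>

abbreviation family_sum :: "'b set set \<Rightarrow> ('b set \<Rightarrow> 'b) \<Rightarrow> 'b" where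
  "family_sum \<U> u \<equiv> finsum M u \<U>"

lemma family_sum_insert:
  assumes "finite \<V>" "U \<notin> \<V>" "\<forall>V\<in>insert U \<V>. submodule V A M" "v \<in> (\<Pi>\<^sub>E V\<in>\<V>. V)" "w \<in> U"
  shows "family_sum (insert U \<V>) (v(U := w)) = w \<oplus>\<^bsub>M\<^esub> family_sum \<V> v"
proof -
  have c: "v \<in> \<V> \<rightarrow> carrier M" "w \<in> carrier M"
    using assms(3-5) submoduleD(3) by (auto simp: PiE_iff)
  have "family_sum \<V> (v(U := w)) = family_sum \<V> v"
    by (rule M.finsum_cong') (use assms(2) c in auto)
  then show ?thesis using M.finsum_insert[OF assms(1,2), of "v(U := w)"] c assms(2) by auto
qed

lemma family_sum_closed:
  assumes "\<forall>V\<in>\<V>. submodule V A M" "v \<in> (\<Pi>\<^sub>E V\<in>\<V>. V)"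
  shows "family_sum \<V> v \<in> carrier M"
  by (rule M.finsum_closed) (use assms submoduleD(3) in \<open>auto simp: PiE_iff\<close>)

lemma PiE_insert_split:
  assumes "u \<in> (\<Pi>\<^sub>E V\<in>insert U \<V>. V)" "U \<notin> \<V>"
  obtains v w where "v \<in> (\<Pi>\<^sub>E V\<in>\<V>. V)" "w \<in> U" "u = v(U := w)"
  using assms(1) unfolding PiE_insert_eq by auto

lemma image_family_sum_insert:
  assumes "finite \<V>" "U \<notin> \<V>" "\<forall>V\<in>insert U \<V>. submodule V A M"
  shows "family_sum (insert U \<V>) ` (\<Pi>\<^sub>E V\<in>insert U \<V>. V) = U <+>\<^bsub>M\<^esub> family_sum \<V> ` (\<Pi>\<^sub>E V\<in>\<V>. V)"
    (is "?L = ?R")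
proof (intro equalityI subsetI)
  fix x assume "x \<in> ?L"
  then obtain u where u: "u \<in> (\<Pi>\<^sub>E V\<in>insert U \<V>. V)" "x = family_sum (insert U \<V>) u" by blast
  obtain v w where vw: "v \<in> (\<Pi>\<^sub>E V\<in>\<V>. V)" "w \<in> U" "u = v(U := w)"
    using PiE_insert_split[OF u(1) assms(2)] .
  show "x \<in> ?R" unfolding u(2) vw(3) family_sum_insert[OF assms vw(1,2)]
    by (rule set_addI[OF vw(2) imageI[OF vw(1)]])
next
  fix x assume "x \<in> ?R"
  then obtain w v where vw: "v \<in> (\<Pi>\<^sub>E V\<in>\<V>. V)" "w \<in> U" "x = w \<oplus>\<^bsub>M\<^esub> family_sum \<V> v"
    by (auto elim!: set_addE)
  have "v(U := w) \<in> (\<Pi>\<^sub>E V\<in>insert U \<V>. V)" using vw(1,2) by (auto simp: PiE_iff extensional_def)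
  then show "x \<in> ?L" unfolding vw(3) family_sum_insert[OF assms vw(1,2), symmetric] by (rule imageI)
qed

lemma zero_family:
  assumes "\<forall>V\<in>\<V>. submodule V A M"
  shows "(\<lambda>V\<in>\<V>. \<zero>\<^bsub>M\<^esub>) \<in> (\<Pi>\<^sub>E V\<in>\<V>. V)" "family_sum \<V> (\<lambda>V\<in>\<V>. \<zero>\<^bsub>M\<^esub>) = \<zero>\<^bsub>M\<^esub>"
proof -
  show "(\<lambda>V\<in>\<V>. \<zero>\<^bsub>M\<^esub>) \<in> (\<Pi>\<^sub>E V\<in>\<V>. V)" using assms submoduleD(2) by auto
  have "family_sum \<V> (\<lambda>V\<in>\<V>. \<zero>\<^bsub>M\<^esub>) = family_sum \<V> (\<lambda>V. \<zero>\<^bsub>M\<^esub>)"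
    by (rule M.finsum_cong') auto
  then show "family_sum \<V> (\<lambda>V\<in>\<V>. \<zero>\<^bsub>M\<^esub>) = \<zero>\<^bsub>M\<^esub>" by simp
qed

text \<open>Induction on the set of summands: injectivity on the larger set of families says both that the
  smaller set is independent and that its span meets the additional summand trivially.\<close>

lemma indec_sum_of_family:
  assumes "finite \<U>" "\<forall>U\<in>\<U>. indec U" "inj_on (family_sum \<U>) (\<Pi>\<^sub>E U\<in>\<U>. U)"
  shows "indec_sum (card \<U>) (family_sum \<U> ` (\<Pi>\<^sub>E U\<in>\<U>. U))"
  using assms
proof (induction rule: finite_induct)
  case empty
  then show ?case using indec_sum_zero by simp
next
  case (insert U \<V>)
  have sub: "\<forall>V\<in>insert U \<V>. submodule V A M" using insert.prems(1) by (auto simp: indec_def)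
  note ins = family_sum_insert[OF insert.hyps sub]
  have mem: "v(U := w) \<in> (\<Pi>\<^sub>E V\<in>insert U \<V>. V)" if "v \<in> (\<Pi>\<^sub>E V\<in>\<V>. V)" "w \<in> U" for v w
    using that by (auto simp: PiE_iff extensional_def)
  have z: "\<zero>\<^bsub>M\<^esub> \<in> U" using sub submoduleD(2) by blast
  have upd: "v = v'" if "v \<in> (\<Pi>\<^sub>E V\<in>\<V>. V)" "v' \<in> (\<Pi>\<^sub>E V\<in>\<V>. V)" "v(U := w) = v'(U := w')" for v v' w w'
  proof
    fix V
    show "v V = v' V" using fun_cong[OF that(3), of V] that(1,2) insert.hyps(2)
      by (cases "V = U") (auto simp: PiE_iff extensional_def)
  qed
  have "inj_on (family_sum \<V>) (\<Pi>\<^sub>E V\<in>\<V>. V)"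
  proof (rule inj_onI)
    fix v v' assume v: "v \<in> (\<Pi>\<^sub>E V\<in>\<V>. V)" "v' \<in> (\<Pi>\<^sub>E V\<in>\<V>. V)" "family_sum \<V> v = family_sum \<V> v'"
    then have "family_sum (insert U \<V>) (v(U := \<zero>\<^bsub>M\<^esub>)) = family_sum (insert U \<V>) (v'(U := \<zero>\<^bsub>M\<^esub>))"
      using ins z by simp
    then have "v(U := \<zero>\<^bsub>M\<^esub>) = v'(U := \<zero>\<^bsub>M\<^esub>)"
      using inj_onD[OF insert.prems(2) _ mem[OF v(1) z] mem[OF v(2) z]] by blast
    then show "v = v'" using upd v(1,2) by blast
  qed
  then have IH: "indec_sum (card \<V>) (family_sum \<V> ` (\<Pi>\<^sub>E V\<in>\<V>. V))"
    using insert.IH insert.prems(1) by simp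
  have "direct_sum (U <+>\<^bsub>M\<^esub> family_sum \<V> ` (\<Pi>\<^sub>E V\<in>\<V>. V)) U (family_sum \<V> ` (\<Pi>\<^sub>E V\<in>\<V>. V))"
  proof (rule direct_sumI)
    fix x assume x: "x \<in> U" "x \<in> family_sum \<V> ` (\<Pi>\<^sub>E V\<in>\<V>. V)"
    then obtain v where v: "v \<in> (\<Pi>\<^sub>E V\<in>\<V>. V)" "x = family_sum \<V> v" by blast
    let ?o = "\<lambda>V\<in>\<V>. \<zero>\<^bsub>M\<^esub>"
    have o: "?o \<in> (\<Pi>\<^sub>E V\<in>\<V>. V)" "family_sum \<V> ?o = \<zero>\<^bsub>M\<^esub>" using zero_family[of \<V>] sub by auto
    have xc: "x \<in> carrier M" using x(1) sub submoduleD(3)[of U] by auto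
    have "family_sum (insert U \<V>) (v(U := \<zero>\<^bsub>M\<^esub>)) = family_sum (insert U \<V>) (?o(U := x))"
      unfolding ins[OF v(1) z] ins[OF o(1) x(1)] o(2) v(2)[symmetric] using xc by simp
    then have "v(U := \<zero>\<^bsub>M\<^esub>) = ?o(U := x)"
      using inj_onD[OF insert.prems(2) _ mem[OF v(1) z] mem[OF o(1) x(1)]] by blast
    from fun_cong[OF this, of U] show "x = \<zero>\<^bsub>M\<^esub>" by simp
  qed (use sub indec_sum_submodule[OF IH] submodule_sum sum_upper1 sum_upper2 in auto)
  then show ?case
    using indec_sum_Suc[OF _ IH, of U] insert.prems(1) insert.hyps
    unfolding image_family_sum_insert[OF insert.hyps sub] by simp
qed

text \<open>The summands split off one after the other are distinct as sets: one that occurred again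
  would lie in the complement of itself and be zero.\<close>

lemma family_of_indec_sum:
  assumes "indec_sum n T"
  shows "\<exists>\<U>. finite \<U> \<and> card \<U> = n \<and> (\<forall>U\<in>\<U>. indec U) \<and> inj_on (family_sum \<U>) (\<Pi>\<^sub>E U\<in>\<U>. U) \<and>
    family_sum \<U> ` (\<Pi>\<^sub>E U\<in>\<U>. U) = T"
  using assms
proof (induction rule: indec_sum.induct)
  case indec_sum_zero
  then show ?case by (intro exI[of _ "{}"]) simp
next
  case (indec_sum_Suc U n V T)
  then obtain \<V> where \<V>: "finite \<V>" "card \<V> = n" "\<forall>V\<in>\<V>. indec V"
    "inj_on (family_sum \<V>) (\<Pi>\<^sub>E V\<in>\<V>. V)" "family_sum \<V> ` (\<Pi>\<^sub>E V\<in>\<V>. V) = V" by blast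
  have sub: "\<forall>V\<in>insert U \<V>. submodule V A M" using \<V>(3) indec_sum_Suc.hyps(1) by (auto simp: indec_def)
  note d = direct_sumD[OF indec_sum_Suc.hyps(3)]
  have U: "U \<noteq> {\<zero>\<^bsub>M\<^esub>}" using indec_sum_Suc.hyps(1) by (simp add: indec_def)
  have "U \<notin> \<V>"
  proof
    assume "U \<in> \<V>"
    then obtain \<W> where W: "\<V> = insert U \<W>" "U \<notin> \<W>" by (meson Set.set_insert)
    have "finite \<W>" "\<forall>V\<in>insert U \<W>. submodule V A M" using W \<V>(1) sub by auto
    from image_family_sum_insert[OF this(1) W(2) this(2)] zero_family[of \<W>]
    have *: "V = U <+>\<^bsub>M\<^esub> family_sum \<W> ` (\<Pi>\<^sub>E V\<in>\<W>. V)" "\<zero>\<^bsub>M\<^esub> \<in> family_sum \<W> ` (\<Pi>\<^sub>E V\<in>\<W>. V)"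
      using \<V>(5) W sub by (auto simp: image_iff intro!: bexI[of _ "\<lambda>V\<in>\<W>. \<zero>\<^bsub>M\<^esub>"])
    have "U \<subseteq> V"
    proof
      fix x assume x: "x \<in> U"
      then show "x \<in> V" using set_addI[OF x *(2)] *(1) submoduleD(3)[OF d(2) x] by simp
    qed
    then show False using d(4) U by blast
  qed
  note ins = family_sum_insert[OF \<V>(1) this sub]
  obtain p q where "projections T U V p q"
    by (rule direct_sum_projections[OF indec_sum_Suc.hyps(3)])
  note pq = projectionsD[OF this]
  have sum: "p (w \<oplus>\<^bsub>M\<^esub> v) = w" "q (w \<oplus>\<^bsub>M\<^esub> v) = v" if "w \<in> U" "v \<in> V" for w v
  proof -
    have wv: "w \<in> T" "v \<in> T" using that d(6,7) by auto
    have z: "p v = \<zero>\<^bsub>M\<^esub>" "q w = \<zero>\<^bsub>M\<^esub>" using pq(8)[OF wv(2)] pq(9)[OF wv(1)] that by auto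
    have c: "w \<in> carrier M" "v \<in> carrier M" using that submoduleD(3)[OF d(2)] submoduleD(3)[OF d(3)] by auto
    show "p (w \<oplus>\<^bsub>M\<^esub> v) = w" using mod_homD(2)[OF pq(1), of w v] wv z c pq(6)[OF that(1)] by simp
    show "q (w \<oplus>\<^bsub>M\<^esub> v) = v" using mod_homD(2)[OF pq(2), of w v] wv z c pq(7)[OF that(2)] by simp
  qed
  have "inj_on (family_sum (insert U \<V>)) (\<Pi>\<^sub>E V\<in>insert U \<V>. V)"
  proof (rule inj_onI)
    fix u u' assume u: "u \<in> (\<Pi>\<^sub>E V\<in>insert U \<V>. V)" "u' \<in> (\<Pi>\<^sub>E V\<in>insert U \<V>. V)"
      and eq: "family_sum (insert U \<V>) u = family_sum (insert U \<V>) u'"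
    obtain v w where vw: "v \<in> (\<Pi>\<^sub>E V\<in>\<V>. V)" "w \<in> U" "u = v(U := w)"
      using PiE_insert_split[OF u(1) \<open>U \<notin> \<V>\<close>] .
    obtain v' w' where vw': "v' \<in> (\<Pi>\<^sub>E V\<in>\<V>. V)" "w' \<in> U" "u' = v'(U := w')"
      using PiE_insert_split[OF u(2) \<open>U \<notin> \<V>\<close>] .
    have fV: "family_sum \<V> v \<in> V" "family_sum \<V> v' \<in> V" using \<V>(5) vw(1) vw'(1) by auto
    have e: "w \<oplus>\<^bsub>M\<^esub> family_sum \<V> v = w' \<oplus>\<^bsub>M\<^esub> family_sum \<V> v'"
      using eq ins[OF vw(1,2)] ins[OF vw'(1,2)] vw(3) vw'(3) by simp
    have "w = w'" using sum(1)[OF vw(2) fV(1)] sum(1)[OF vw'(2) fV(2)] e by simp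
    moreover have "family_sum \<V> v = family_sum \<V> v'"
      using sum(2)[OF vw(2) fV(1)] sum(2)[OF vw'(2) fV(2)] e by simp
    then have "v = v'" using inj_onD[OF \<V>(4) _ vw(1) vw'(1)] by blast
    ultimately show "u = u'" using vw(3) vw'(3) by simp
  qed
  moreover have "family_sum (insert U \<V>) ` (\<Pi>\<^sub>E V\<in>insert U \<V>. V) = T"
    unfolding image_family_sum_insert[OF \<V>(1) \<open>U \<notin> \<V>\<close> sub] \<V>(5) using d(5) by simp
  ultimately show ?case
    using \<V> \<open>U \<notin> \<V>\<close> indec_sum_Suc.hyps(1) by (intro exI[of _ "insert U \<V>"]) auto
qed

lemma indec_decomposition_iff:
  "indec_decomposition A M \<U> \<longleftrightarrow> finite \<U> \<and> (\<forall>U\<in>\<U>. indec U) \<and>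
     inj_on (family_sum \<U>) (\<Pi>\<^sub>E U\<in>\<U>. U) \<and> family_sum \<U> ` (\<Pi>\<^sub>E U\<in>\<U>. U) = carrier M"
proof -
  have 1: "(\<forall>U\<in>\<U>. submodule U A M \<and> indecomposable_mod A (sub_mod M U)) \<longleftrightarrow> (\<forall>U\<in>\<U>. indec U)"
    using indecomposable_sub_mod_iff by (auto simp: indec_def)
  have 2: "(\<forall>x\<in>carrier M. \<exists>!u. u \<in> (\<Pi>\<^sub>E U\<in>\<U>. U) \<and> x = family_sum \<U> u) \<longleftrightarrow>
      inj_on (family_sum \<U>) (\<Pi>\<^sub>E U\<in>\<U>. U) \<and> family_sum \<U> ` (\<Pi>\<^sub>E U\<in>\<U>. U) = carrier M"
    (is "?L \<longleftrightarrow> ?R") if "\<forall>U\<in>\<U>. indec U"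
  proof -
    have c: "family_sum \<U> u \<in> carrier M" if "u \<in> (\<Pi>\<^sub>E U\<in>\<U>. U)" for u
      using family_sum_closed[OF _ that] \<open>\<forall>U\<in>\<U>. indec U\<close> by (auto simp: indec_def)
    show ?thesis
    proof
      assume L: ?L
      have "inj_on (family_sum \<U>) (\<Pi>\<^sub>E U\<in>\<U>. U)"
      proof (rule inj_onI)
        fix u v assume uv: "u \<in> (\<Pi>\<^sub>E U\<in>\<U>. U)" "v \<in> (\<Pi>\<^sub>E U\<in>\<U>. U)"
          "family_sum \<U> u = family_sum \<U> v"
        have "\<exists>!w. w \<in> (\<Pi>\<^sub>E U\<in>\<U>. U) \<and> family_sum \<U> u = family_sum \<U> w"
          using L c[OF uv(1)] by (rule bspec)
        then show "u = v" by (rule ex1E) (metis uv)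
      qed
      moreover have "carrier M \<subseteq> family_sum \<U> ` (\<Pi>\<^sub>E U\<in>\<U>. U)"
      proof
        fix x assume "x \<in> carrier M"
        from bspec[OF L this] show "x \<in> family_sum \<U> ` (\<Pi>\<^sub>E U\<in>\<U>. U)"
          by (rule ex1E) (metis imageI)
      qed
      moreover have "family_sum \<U> ` (\<Pi>\<^sub>E U\<in>\<U>. U) \<subseteq> carrier M" by (rule image_subsetI) (rule c)
      ultimately show ?R by (intro conjI equalityI)
    next
      assume R: ?R
      show ?L
      proof
        fix x assume "x \<in> carrier M"
        then have "x \<in> family_sum \<U> ` (\<Pi>\<^sub>E U\<in>\<U>. U)" using R by simp
        then obtain u where u: "u \<in> (\<Pi>\<^sub>E U\<in>\<U>. U)" "x = family_sum \<U> u" by (rule imageE) simp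
        show "\<exists>!u. u \<in> (\<Pi>\<^sub>E U\<in>\<U>. U) \<and> x = family_sum \<U> u"
        proof (rule ex1I[of _ u])
          fix v assume v: "v \<in> (\<Pi>\<^sub>E U\<in>\<U>. U) \<and> x = family_sum \<U> v"
          show "v = u"
            by (rule inj_onD[OF conjunct1[OF R] _ conjunct1[OF v] u(1)]) (use v u(2) in simp)
        qed (use u in simp)
      qed
    qed
  qed
  show ?thesis
  proof (cases "\<forall>U\<in>\<U>. indec U")
    case True
    show ?thesis unfolding indec_decomposition_def 1 2[OF True] by simp
  next
    case False
    then show ?thesis unfolding indec_decomposition_def 1 by (simp only: simp_thms)
  qed
qed

text \<open>Every decomposition into a set of summands can be split off step by step, and the number
  of steps is unique. So the definite description in \<open>num_summands\<close> is justified.\<close>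

theorem num_summands_eq:
  assumes "indec_sum n (carrier M)" "finite (carrier M)"
  shows "num_summands A M = n"
  unfolding num_summands_def
proof (rule the_equality)
  show "\<exists>\<U>. indec_decomposition A M \<U> \<and> card \<U> = n"
    using family_of_indec_sum[OF assms(1)] unfolding indec_decomposition_iff by blast
next
  fix m assume "\<exists>\<U>. indec_decomposition A M \<U> \<and> card \<U> = m"
  then obtain \<U> where U: "finite \<U>" "\<forall>U\<in>\<U>. indec U" "inj_on (family_sum \<U>) (\<Pi>\<^sub>E U\<in>\<U>. U)"
    "family_sum \<U> ` (\<Pi>\<^sub>E U\<in>\<U>. U) = carrier M" "card \<U> = m"
    unfolding indec_decomposition_iff by blast
  show "m = n" using indec_sum_of_family[OF U(1-3)] indec_sum_unique[OF _ assms] unfolding U(4,5) by blast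
qed

lemma indec_sum_num_summands: "finite (carrier M) \<Longrightarrow> indec_sum (num_summands A M) (carrier M)"
  using indec_sum_exists[OF submodule_carrier] num_summands_eq by metis


section \<open>Submodules and quotients of sums of uniserial modules\<close>

text \<open>Uniseriality of a submodule, expressed inside the ambient module.\<close>

definition chain_sub :: "'b set \<Rightarrow> bool" where
  "chain_sub K \<longleftrightarrow> submodule K A M \<and>
     (\<forall>P Q. submodule P A M \<longrightarrow> submodule Q A M \<longrightarrow> P \<subseteq> K \<longrightarrow> Q \<subseteq> K \<longrightarrow> P \<subseteq> Q \<or> Q \<subseteq> P)"

lemma uniserial_sub_mod_iff:
  assumes "submodule K A M" shows "uniserial_mod A (sub_mod M K) \<longleftrightarrow> chain_sub K"
  unfolding uniserial_mod_def chain_sub_def submodule_sub_mod_iff[OF assms] using assms by blast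

lemma chain_subset: "chain_sub K \<Longrightarrow> submodule L A M \<Longrightarrow> L \<subseteq> K \<Longrightarrow> chain_sub L"
  unfolding chain_sub_def by (meson subset_trans)

text \<open>Submodules of \<open>h(K)\<close> are images of their preimages in \<open>K\<close>.\<close>

lemma chain_image:
  assumes "lmod A N" "submodule T A M" "h \<in> mod_hom A (sub_mod M T) N" "chain_sub K" "K \<subseteq> T"
  shows "lmod.chain_sub A N (h ` K)"
proof -
  interpret N: lmod A N by fact
  interpret T: lmod A "sub_mod M T" by (rule lmod_sub_mod[OF assms(2)])
  have K: "submodule K A M" using assms(4) by (simp add: chain_sub_def)
  have hK: "submodule (h ` K) A N"
    by (rule T.submodule_image[OF assms(1,3)]) (use submodule_sub_mod_iff[OF assms(2)] K assms(5) in simp)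
  have pre: "submodule {x \<in> K. h x \<in> P} A M \<and> h ` {x \<in> K. h x \<in> P} = P"
    if P: "submodule P A N" "P \<subseteq> h ` K" for P
  proof -
    have "submodule {x \<in> T. h x \<in> P} A M"
      using T.submodule_vimage[OF assms(1,3) P(1)] submodule_sub_mod_iff[OF assms(2)] by simp
    moreover have "{x \<in> K. h x \<in> P} = K \<inter> {x \<in> T. h x \<in> P}" using assms(5) by auto
    moreover have "h ` {x \<in> K. h x \<in> P} = P" using P(2) by auto
    ultimately show ?thesis using submodule_Int[OF K] by simp
  qed
  show ?thesis unfolding N.chain_sub_def
  proof (intro conjI allI impI hK)
    fix P Q assume PQ: "submodule P A N" "submodule Q A N" "P \<subseteq> h ` K" "Q \<subseteq> h ` K"
    note p = pre[OF PQ(1,3)] pre[OF PQ(2,4)]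
    have "{x \<in> K. h x \<in> P} \<subseteq> {x \<in> K. h x \<in> Q} \<or> {x \<in> K. h x \<in> Q} \<subseteq> {x \<in> K. h x \<in> P}"
      using assms(4) p unfolding chain_sub_def by (metis (no_types, lifting) mem_Collect_eq subsetI)
    then show "P \<subseteq> Q \<or> Q \<subseteq> P" using p by (metis (no_types, lifting) image_mono)
  qed
qed

text \<open>If \<open>K\<close> meets the complement \<open>V\<close> of the first summand \<open>P\<close>, it cannot meet \<open>P\<close> as well, because \<open>K \<inter> P\<close>
  and \<open>K \<inter> V\<close> are comparable and \<open>P \<inter> V = 0\<close>. So the projection onto \<open>V\<close> is injective on \<open>K\<close>, and the
  summand can be found in \<open>V\<close> by induction.\<close>

lemma indec_sum_split_avoiding_chain:
  assumes "indec_sum m U" "m \<noteq> 0" "chain_sub K" "K \<subseteq> U"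
  shows "\<exists>k P Q. m = Suc k \<and> direct_sum U P Q \<and> indec_sum k Q \<and> K \<inter> Q = {\<zero>\<^bsub>M\<^esub>}"
  using assms
proof (induction arbitrary: K rule: indec_sum.induct)
  case indec_sum_zero
  then show ?case by simp
next
  case (indec_sum_Suc P n V U)
  note d = direct_sumD[OF indec_sum_Suc.hyps(3)]
  have K: "submodule K A M" using indec_sum_Suc.prems(2) by (simp add: chain_sub_def)
  show ?case
  proof (cases "K \<inter> V = {\<zero>\<^bsub>M\<^esub>}")
    case True
    then show ?thesis using indec_sum_Suc.hyps by blast
  next
    case False
    have zK: "\<zero>\<^bsub>M\<^esub> \<in> K \<inter> V" "\<zero>\<^bsub>M\<^esub> \<in> K \<inter> P"
      using submoduleD(2)[OF K] submoduleD(2)[OF d(2)] submoduleD(2)[OF d(3)] by auto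
    have n0: "n \<noteq> 0" using False indec_sum_Suc.hyps(2) zK by (auto simp: indec_sum_0_iff)
    have KP: "K \<inter> P = {\<zero>\<^bsub>M\<^esub>}"
    proof -
      have "K \<inter> P \<subseteq> K \<inter> V \<or> K \<inter> V \<subseteq> K \<inter> P"
        using indec_sum_Suc.prems(2) submodule_Int[OF K d(2)] submodule_Int[OF K d(3)]
        unfolding chain_sub_def by blast
      then show ?thesis using d(4) False zK by blast
    qed
    obtain p q where "projections U P V p q"
      by (rule direct_sum_projections[OF indec_sum_Suc.hyps(3)])
    note pq = projectionsD[OF this]
    have "q ` K \<subseteq> V" using pq(4) indec_sum_Suc.prems(3) by auto
    then obtain k S Q where IH: "n = Suc k" "direct_sum V S Q" "indec_sum k Q" "q ` K \<inter> Q = {\<zero>\<^bsub>M\<^esub>}"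
      using indec_sum_Suc.IH[OF n0 chain_image[OF lmod_axioms d(1) pq(2) indec_sum_Suc.prems(2,3)]] by blast
    note a = direct_sum_assoc[OF direct_sum_comm[OF indec_sum_Suc.hyps(3)] IH(2)]
    have "indec_sum (Suc k) (Q <+>\<^bsub>M\<^esub> P)"
      using indec_sum.indec_sum_Suc[OF indec_sum_Suc.hyps(1) IH(3) direct_sum_comm[OF a(2)]] .
    moreover have "K \<inter> (Q <+>\<^bsub>M\<^esub> P) \<subseteq> {\<zero>\<^bsub>M\<^esub>}"
    proof
      fix x assume x: "x \<in> K \<inter> (Q <+>\<^bsub>M\<^esub> P)"
      then obtain y z where yz: "y \<in> Q" "z \<in> P" "x = y \<oplus>\<^bsub>M\<^esub> z" by (auto elim!: set_addE)
      have yV: "y \<in> V" using yz(1) direct_sumD(7)[OF IH(2)] by auto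
      have U: "y \<in> U" "z \<in> U" "x \<in> U" using yV yz(2) d(6,7) x indec_sum_Suc.prems(3) by auto
      have "q z = \<zero>\<^bsub>M\<^esub>" using pq(9)[OF U(2)] yz(2) by simp
      then have "q x = y" using mod_homD(2)[OF pq(2), of y z] U yz(3) pq(7)[OF yV] submoduleD(3)[OF d(3) yV] by simp
      then have "q x = \<zero>\<^bsub>M\<^esub>" using IH(4) yz(1) x by blast
      then have "x \<in> P" using pq(9)[OF U(3)] by simp
      then show "x \<in> {\<zero>\<^bsub>M\<^esub>}" using KP x by blast
    qed
    moreover have "\<zero>\<^bsub>M\<^esub> \<in> K \<inter> (Q <+>\<^bsub>M\<^esub> P)"
      using submoduleD(2)[OF K] submoduleD(2)[OF direct_sumD(1)[OF a(2)]] by simp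
    ultimately show ?thesis using a(1) IH(1) by blast
  qed
qed

text \<open>Induction on the number of summands of \<open>T = X \<oplus> Y\<close>. The part of \<open>U\<close> in the uniserial summand \<open>X\<close> is a
  chain, so some indecomposable summand of \<open>U\<close> has a complement in \<open>U\<close> that avoids this part, and
  therefore embeds in \<open>Y\<close>.\<close>

theorem serial_submodule_summands:
  assumes "\<And>U. indec U \<Longrightarrow> chain_sub U" "indec_sum n T" "indec_sum m U" "U \<subseteq> T"
  shows "m \<le> n"
  using assms(2-4)
proof (induction arbitrary: U m rule: indec_sum.induct)
  case indec_sum_zero
  then have "U = {\<zero>\<^bsub>M\<^esub>}" using submoduleD(2)[OF indec_sum_submodule] by blast
  then show ?case using indec_sum_zero indec_sum_of_zero by blast
next
  case (indec_sum_Suc X n Y T)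
  note d = direct_sumD[OF indec_sum_Suc.hyps(3)]
  have U: "submodule U A M" using indec_sum_submodule[OF indec_sum_Suc.prems(1)] .
  show ?case
  proof (cases "m = 0")
    case False
    have "chain_sub (U \<inter> X)"
      using chain_subset[OF assms(1)[OF indec_sum_Suc.hyps(1)] submodule_Int[OF U d(2)]] by simp
    then obtain k P Q where k: "m = Suc k" "direct_sum U P Q" "indec_sum k Q" "(U \<inter> X) \<inter> Q = {\<zero>\<^bsub>M\<^esub>}"
      using indec_sum_split_avoiding_chain[OF indec_sum_Suc.prems(1) False] by blast
    note e = direct_sumD[OF k(2)]
    obtain p q where "projections T X Y p q"
      by (rule direct_sum_projections[OF indec_sum_Suc.hyps(3)])
    note pq = projectionsD[OF this]
    interpret Q: lmod A "sub_mod M Q" by (rule lmod_sub_mod[OF e(3)])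
    have QT: "Q \<subseteq> T" using e(7) indec_sum_Suc.prems(2) by blast
    have q: "q \<in> mod_hom A (sub_mod M Q) M" using mod_hom_restrict[OF pq(2), of Q] QT by simp
    have "\<forall>x\<in>Q. q x = \<zero>\<^bsub>M\<^esub> \<longrightarrow> x = \<zero>\<^bsub>M\<^esub>" using pq(9) QT k(4) e(7) by blast
    then have "inj_on q Q" using Q.hom_inj_on_iff[OF lmod_axioms q] by simp
    then have "indec_sum k (q ` Q)" using indec_sum_image[OF lmod_axioms k(3) q] by simp
    moreover have "q ` Q \<subseteq> Y" using pq(4) QT by auto
    ultimately show ?thesis using indec_sum_Suc.IH k(1) by blast
  qed simp
qed

text \<open>The dual of the previous splitting lemma: the assumption says that \<open>N / L\<close> is uniserial, and the
  conclusion that one indecomposable summand already maps onto it. If the first summand \<open>U\<close> does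
  not, then \<open>L + U\<close> and \<open>L + V\<close> being comparable with sum \<open>N\<close> forces \<open>L + V = N\<close>; so \<open>N / L\<close> is also
  a quotient of \<open>V\<close>, by \<open>V \<inter> L\<close>, and the summand can be found in \<open>V\<close>.\<close>

lemma indec_sum_split_covering_chain:
  assumes "indec_sum m N" "m \<noteq> 0" "submodule L A M" "L \<subseteq> N"
    "\<forall>P Q. submodule P A M \<longrightarrow> submodule Q A M \<longrightarrow> L \<subseteq> P \<longrightarrow> P \<subseteq> N \<longrightarrow> L \<subseteq> Q \<longrightarrow> Q \<subseteq> N \<longrightarrow>
      P \<subseteq> Q \<or> Q \<subseteq> P"
  shows "\<exists>k P Q. m = Suc k \<and> direct_sum N P Q \<and> indec_sum k Q \<and> L <+>\<^bsub>M\<^esub> P = N"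
  using assms
proof (induction arbitrary: L rule: indec_sum.induct)
  case indec_sum_zero
  then show ?case by simp
next
  case (indec_sum_Suc U n V N)
  note d = direct_sumD[OF indec_sum_Suc.hyps(3)] and L = indec_sum_Suc.prems(2,3)
  note chain = indec_sum_Suc.prems(4)[rule_format]
  note up = sum_upper1[OF L(1) d(2)] sum_upper2[OF L(1) d(2)] sum_upper1[OF L(1) d(3)] sum_upper2[OF L(1) d(3)]
  note least = sum_least[OF d(1) L(2) d(6)] sum_least[OF d(1) L(2) d(7)]
  show ?case
  proof (cases "L <+>\<^bsub>M\<^esub> U = N")
    case True
    then show ?thesis using indec_sum_Suc.hyps by blast
  next
    case False
    have LV: "L <+>\<^bsub>M\<^esub> V = N"
    proof -
      consider "L <+>\<^bsub>M\<^esub> V \<subseteq> L <+>\<^bsub>M\<^esub> U" | "L <+>\<^bsub>M\<^esub> U \<subseteq> L <+>\<^bsub>M\<^esub> V"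
        using chain[OF submodule_sum[OF L(1) d(3)] submodule_sum[OF L(1) d(2)] up(3) least(2) up(1) least(1)]
        by blast
      then show ?thesis
      proof cases
        case 1
        then have "U <+>\<^bsub>M\<^esub> V \<subseteq> L <+>\<^bsub>M\<^esub> U"
          using up by (intro sum_least submodule_sum L d) auto
        then show ?thesis using False least(1) d(5) by blast
      next
        case 2
        then have "U <+>\<^bsub>M\<^esub> V \<subseteq> L <+>\<^bsub>M\<^esub> V"
          using up by (intro sum_least submodule_sum L d) auto
        then show ?thesis using least(2) d(5) by blast
      qed
    qed
    have n0: "n \<noteq> 0"
    proof
      assume "n = 0"
      then have V: "V = {\<zero>\<^bsub>M\<^esub>}" using indec_sum_Suc.hyps(2) indec_sum_0_iff by simp
      have "L = N" using LV direct_sumD(5)[OF direct_sum_zero[OF L(1)]] unfolding V by simp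
      then show False using False up(1) least(1) by blast
    qed
    note LV' = submodule_Int[OF d(3) L(1)]
    have mod: "V \<inter> (L <+>\<^bsub>M\<^esub> P) = P"
      if "submodule P A M" "V \<inter> L \<subseteq> P" "P \<subseteq> V" for P
      using modular_law[OF that(1) L(1) d(3) that(3)] sum_upper1[OF that(1) LV']
        sum_least[OF that(1) order_refl that(2)] sum_comm[OF submoduleD(1)[OF L(1)] submoduleD(1)[OF that(1)]]
      by auto
    have "P \<subseteq> Q \<or> Q \<subseteq> P"
      if PQ: "submodule P A M" "submodule Q A M" "V \<inter> L \<subseteq> P" "P \<subseteq> V" "V \<inter> L \<subseteq> Q" "Q \<subseteq> V" for P Q
    proof -
      have "L <+>\<^bsub>M\<^esub> P \<subseteq> L <+>\<^bsub>M\<^esub> Q \<or> L <+>\<^bsub>M\<^esub> Q \<subseteq> L <+>\<^bsub>M\<^esub> P"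
        using d(7) PQ(4,6)
        by (intro chain submodule_sum L(1) PQ sum_upper1 sum_least[OF d(1) L(2)]) auto
      then have "V \<inter> (L <+>\<^bsub>M\<^esub> P) \<subseteq> V \<inter> (L <+>\<^bsub>M\<^esub> Q) \<or> V \<inter> (L <+>\<^bsub>M\<^esub> Q) \<subseteq> V \<inter> (L <+>\<^bsub>M\<^esub> P)"
        by blast
      then show ?thesis unfolding mod[OF PQ(1,3,4)] mod[OF PQ(2,5,6)] .
    qed
    then have "\<forall>P Q. submodule P A M \<longrightarrow> submodule Q A M \<longrightarrow> V \<inter> L \<subseteq> P \<longrightarrow> P \<subseteq> V \<longrightarrow>
        V \<inter> L \<subseteq> Q \<longrightarrow> Q \<subseteq> V \<longrightarrow> P \<subseteq> Q \<or> Q \<subseteq> P"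
      by (intro allI impI)
    from indec_sum_Suc.IH[OF n0 LV' _ this]
    obtain k P Q where IH: "n = Suc k" "direct_sum V P Q" "indec_sum k Q" "(V \<inter> L) <+>\<^bsub>M\<^esub> P = V" by auto
    note e = direct_sumD[OF IH(2)]
    note a = direct_sum_assoc[OF direct_sum_comm[OF indec_sum_Suc.hyps(3)] IH(2)]
    have "indec_sum (Suc k) (Q <+>\<^bsub>M\<^esub> U)"
      using indec_sum.indec_sum_Suc[OF indec_sum_Suc.hyps(1) IH(3) direct_sum_comm[OF a(2)]] .
    moreover have "L <+>\<^bsub>M\<^esub> P = N"
    proof
      show "L <+>\<^bsub>M\<^esub> P \<subseteq> N" using e(6) d(7) by (intro sum_least[OF d(1) L(2)]) auto
      have "V \<subseteq> L <+>\<^bsub>M\<^esub> P" using sum_mono[OF Int_lower2 order_refl, of V L P] IH(4) by simp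
      then have "L <+>\<^bsub>M\<^esub> V \<subseteq> L <+>\<^bsub>M\<^esub> P"
        by (intro sum_least submodule_sum L(1) e(2) sum_upper1)
      then show "N \<subseteq> L <+>\<^bsub>M\<^esub> P" unfolding LV .
    qed
    ultimately show ?thesis using a(1) IH(1) by blast
  qed
qed

lemma image_sum:
  assumes "submodule T A M" "h \<in> mod_hom A (sub_mod M T) N" "U \<subseteq> T" "V \<subseteq> T"
  shows "h ` (U <+>\<^bsub>M\<^esub> V) = h ` U <+>\<^bsub>N\<^esub> h ` V"
proof -
  have "h (u \<oplus>\<^bsub>M\<^esub> v) = h u \<oplus>\<^bsub>N\<^esub> h v" if "u \<in> U" "v \<in> V" for u v
    using mod_homD(2)[OF assms(2), of u v] assms(3,4) that by auto
  then have "(\<lambda>(u, v). h (u \<oplus>\<^bsub>M\<^esub> v)) ` (U \<times> V) = (\<lambda>(u, v). h u \<oplus>\<^bsub>N\<^esub> h v) ` (U \<times> V)"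
    by (intro image_cong) auto
  moreover have "h ` (U <+>\<^bsub>M\<^esub> V) = (\<lambda>(u, v). h (u \<oplus>\<^bsub>M\<^esub> v)) ` (U \<times> V)"
    unfolding set_add_def' by force
  moreover have "h ` U <+>\<^bsub>N\<^esub> h ` V = (\<lambda>(u, v). h u \<oplus>\<^bsub>N\<^esub> h v) ` (U \<times> V)"
    unfolding set_add_def' by force
  ultimately show ?thesis by simp
qed

text \<open>Induction on the number of summands of \<open>T = X \<oplus> Y\<close>. The cokernel of \<open>f\<close> restricted to \<open>Y\<close> is a
  quotient of the uniserial module \<open>X\<close>, so a single summand \<open>P\<close> of \<open>f(T)\<close> maps onto it. Hence the
  complement of \<open>P\<close>, with one summand less, is a quotient of \<open>Y\<close>.\<close>

theorem serial_quotient_summands: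
  assumes "lmod A N" "\<And>U. indec U \<Longrightarrow> chain_sub U" "indec_sum n T" "f \<in> mod_hom A (sub_mod M T) N"
    "lmod.indec_sum A N m (f ` T)"
  shows "m \<le> n"
  using assms(3-5)
proof (induction arbitrary: f m rule: indec_sum.induct)
  interpret N: lmod A N by fact
  case indec_sum_zero
  interpret Z: lmod A "sub_mod M {\<zero>\<^bsub>M\<^esub>}" by (rule lmod_sub_mod[OF submodule_zero])
  show ?case using Z.hom_zero[OF assms(1) indec_sum_zero(1)] indec_sum_zero(2) N.indec_sum_of_zero by simp
next
  interpret N: lmod A N by fact
  case (indec_sum_Suc X n Y T)
  note d = direct_sumD[OF indec_sum_Suc.hyps(3)] and f = indec_sum_Suc.prems(1)
  interpret T: lmod A "sub_mod M T" by (rule lmod_sub_mod[OF d(1)])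
  have sub: "submodule (f ` U) A N" if "submodule U A M" "U \<subseteq> T" for U
    using T.submodule_image[OF assms(1) f, of U] submodule_sub_mod_iff[OF d(1)] that by simp
  note sT = sub[OF d(1) order_refl] and sX = sub[OF d(2,6)] and sY = sub[OF d(3,7)]
  show ?case
  proof (cases "m = 0")
    case False
    have chX: "N.chain_sub (f ` X)"
      by (rule chain_image[OF assms(1) d(1) f assms(2)[OF indec_sum_Suc.hyps(1)] d(6)])
    have fT: "f ` T = f ` Y <+>\<^bsub>N\<^esub> f ` X"
      using image_sum[OF d(1) f d(7,6)] direct_sumD(5)[OF direct_sum_comm[OF indec_sum_Suc.hyps(3)]] by simp
    have "P \<subseteq> Q \<or> Q \<subseteq> P"
      if PQ: "submodule P A N" "submodule Q A N" "f ` Y \<subseteq> P" "P \<subseteq> f ` T" "f ` Y \<subseteq> Q" "Q \<subseteq> f ` T" for P Q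
    proof -
      have eq: "S = f ` Y <+>\<^bsub>N\<^esub> (S \<inter> f ` X)" if "submodule S A N" "f ` Y \<subseteq> S" "S \<subseteq> f ` T" for S
        using N.modular_law[OF sY sX that(1,2)] that(3) unfolding fT by auto
      have "P \<inter> f ` X \<subseteq> Q \<inter> f ` X \<or> Q \<inter> f ` X \<subseteq> P \<inter> f ` X"
        using chX N.submodule_Int[OF PQ(1) sX] N.submodule_Int[OF PQ(2) sX]
        unfolding N.chain_sub_def by blast
      then have "f ` Y <+>\<^bsub>N\<^esub> (P \<inter> f ` X) \<subseteq> f ` Y <+>\<^bsub>N\<^esub> (Q \<inter> f ` X) \<or>
          f ` Y <+>\<^bsub>N\<^esub> (Q \<inter> f ` X) \<subseteq> f ` Y <+>\<^bsub>N\<^esub> (P \<inter> f ` X)"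
        using N.sum_mono[OF order_refl] by blast
      then show ?thesis using eq[OF PQ(1,3,4)] eq[OF PQ(2,5,6)] by simp
    qed
    then have "\<forall>P Q. submodule P A N \<longrightarrow> submodule Q A N \<longrightarrow> f ` Y \<subseteq> P \<longrightarrow> P \<subseteq> f ` T \<longrightarrow>
        f ` Y \<subseteq> Q \<longrightarrow> Q \<subseteq> f ` T \<longrightarrow> P \<subseteq> Q \<or> Q \<subseteq> P"
      by (intro allI impI)
    from N.indec_sum_split_covering_chain[OF indec_sum_Suc.prems(2) False sY image_mono[OF d(7)] this]
    obtain k P Q where k: "m = Suc k" "N.direct_sum (f ` T) P Q" "N.indec_sum k Q" "f ` Y <+>\<^bsub>N\<^esub> P = f ` T"
      by blast
    note e = N.direct_sumD[OF k(2)]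
    obtain p q where "N.projections (f ` T) P Q p q"
      by (rule N.direct_sum_projections[OF k(2)])
    note pq = N.projectionsD[OF this]
    have qf: "(\<lambda>x. q (f x)) \<in> mod_hom A (sub_mod M Y) N"
      by (rule mod_hom_comp[OF _ pq(2)]) (use f d(7) in \<open>auto simp: mod_hom_def subset_iff\<close>)
    have "(\<lambda>x. q (f x)) ` Y = Q"
    proof
      show "(\<lambda>x. q (f x)) ` Y \<subseteq> Q" using pq(4) d(7) by auto
      show "Q \<subseteq> (\<lambda>x. q (f x)) ` Y"
      proof
        fix z assume z: "z \<in> Q"
        then have "z \<in> f ` Y <+>\<^bsub>N\<^esub> P" using e(7) unfolding k(4) by blast
        then obtain y w where yw: "y \<in> Y" "w \<in> P" "z = f y \<oplus>\<^bsub>N\<^esub> w" by (auto elim!: N.set_addE)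
        have T: "f y \<in> f ` T" "w \<in> f ` T" using yw d(7) e(6) by auto
        have "q w = \<zero>\<^bsub>N\<^esub>" using pq(9)[OF T(2)] yw(2) by simp
        moreover have "q (f y) \<in> carrier N" using pq(4)[OF T(1)] N.submoduleD(3)[OF e(3)] by simp
        ultimately have "q z = q (f y)" using mod_homD(2)[OF pq(2), of "f y" w] T yw(3) by simp
        then show "z \<in> (\<lambda>x. q (f x)) ` Y" using pq(7)[OF z] yw(1) by auto
      qed
    qed
    then show ?thesis using indec_sum_Suc.IH[OF qf] k(1,3) by simp
  qed simp
qed

end


section \<open>Quotients and isomorphisms\<close>

text \<open>Module axioms pass to homomorphic images; for quotients this saves computations with cosets.\<close>

lemma (in lmod) lmod_of_surjection:
  fixes Q :: "('a, 'c) module"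
  assumes "carrier Q = p ` carrier M" "p \<zero>\<^bsub>M\<^esub> = \<zero>\<^bsub>Q\<^esub>" 
    "\<And>x y. x \<in> carrier M \<Longrightarrow> y \<in> carrier M \<Longrightarrow> p x \<oplus>\<^bsub>Q\<^esub> p y = p (x \<oplus>\<^bsub>M\<^esub> y)"
    "\<And>a x. a \<in> carrier A \<Longrightarrow> x \<in> carrier M \<Longrightarrow> a \<odot>\<^bsub>Q\<^esub> p x = p (a \<odot>\<^bsub>M\<^esub> x)"
  shows "lmod A Q" "p \<in> mod_hom A M Q"
proof -
  have "abelian_group Q"
  proof (rule abelian_groupI)
    fix x assume "x \<in> carrier Q"
    then obtain y where y: "y \<in> carrier M" "x = p y" unfolding assms(1) by blast
    then have "p (\<ominus>\<^bsub>M\<^esub> y) \<oplus>\<^bsub>Q\<^esub> x = \<zero>\<^bsub>Q\<^esub>" using assms(2,3) by (simp add: M.l_neg)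
    then show "\<exists>y\<in>carrier Q. y \<oplus>\<^bsub>Q\<^esub> x = \<zero>\<^bsub>Q\<^esub>" using y(1) unfolding assms(1) by blast
  qed (auto simp: assms(1,3) assms(2)[symmetric] M.a_ac intro!: imageI)
  then show "lmod A Q"
    by (intro lmod.intro left_module.intro left_module_axioms.intro A.ring_axioms)
      (auto simp: assms(1,3,4) smult_closed smult_l_distr smult_r_distr smult_assoc smult_one)
  show "p \<in> mod_hom A M Q"
    by (rule mod_homI) (auto simp: assms(1,3,4))
qed

lemma (in lmod) quot_mod_projection:
  assumes "submodule U A M"
  defines "p \<equiv> \<lambda>x. a_r_coset M U x"
  shows "lmod A (quot_mod M U)" "p \<in> mod_hom A M (quot_mod M U)"
    "p ` carrier M = carrier (quot_mod M U)"
    "\<And>x. x \<in> carrier M \<Longrightarrow> p x = \<zero>\<^bsub>quot_mod M U\<^esub> \<longleftrightarrow> x \<in> U"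
proof -
  note U = submoduleD[OF assms(1)]
  interpret U: abelian_subgroup U M
    by (rule abelian_subgroupI3[OF additive_subgroupI])
      (use assms(1) M.abelian_group_axioms in \<open>auto simp: submodule_def\<close>)
  have p: "p x = {u \<oplus>\<^bsub>M\<^esub> x | u. u \<in> U}" for x
    by (auto simp: p_def a_r_coset_def')
  have self: "x \<in> p x" if "x \<in> carrier M" for x
  proof -
    have "x = \<zero>\<^bsub>M\<^esub> \<oplus>\<^bsub>M\<^esub> x" using that by simp
    then show ?thesis unfolding p using U(2) by blast
  qed
  have sm: "U <+>\<^bsub>M\<^esub> (\<lambda>x. a \<odot>\<^bsub>M\<^esub> x) ` p x = p (a \<odot>\<^bsub>M\<^esub> x)"
    if a: "a \<in> carrier A" and x: "x \<in> carrier M" for a x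
  proof (intro equalityI subsetI)
    fix y assume "y \<in> U <+>\<^bsub>M\<^esub> (\<lambda>x. a \<odot>\<^bsub>M\<^esub> x) ` p x"
    then obtain u w where uw: "u \<in> U" "w \<in> (\<lambda>x. a \<odot>\<^bsub>M\<^esub> x) ` p x" "y = u \<oplus>\<^bsub>M\<^esub> w"
      by (rule set_addE)
    then obtain v where uv: "u \<in> U" "v \<in> U" "y = u \<oplus>\<^bsub>M\<^esub> a \<odot>\<^bsub>M\<^esub> (v \<oplus>\<^bsub>M\<^esub> x)"
      unfolding p by blast
    have "u \<oplus>\<^bsub>M\<^esub> a \<odot>\<^bsub>M\<^esub> (v \<oplus>\<^bsub>M\<^esub> x) = (u \<oplus>\<^bsub>M\<^esub> a \<odot>\<^bsub>M\<^esub> v) \<oplus>\<^bsub>M\<^esub> a \<odot>\<^bsub>M\<^esub> x"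
      using a x U(3)[OF uv(1)] U(3)[OF uv(2)] smult_closed by (simp add: smult_r_distr M.a_assoc)
    then have "y = (u \<oplus>\<^bsub>M\<^esub> a \<odot>\<^bsub>M\<^esub> v) \<oplus>\<^bsub>M\<^esub> a \<odot>\<^bsub>M\<^esub> x" using uv(3) by simp
    moreover have "u \<oplus>\<^bsub>M\<^esub> a \<odot>\<^bsub>M\<^esub> v \<in> U" using uv U(4) U(5)[OF a] by blast
    ultimately show "y \<in> p (a \<odot>\<^bsub>M\<^esub> x)" unfolding p by blast
  next
    fix y assume "y \<in> p (a \<odot>\<^bsub>M\<^esub> x)"
    then obtain u where u: "u \<in> U" "y = u \<oplus>\<^bsub>M\<^esub> a \<odot>\<^bsub>M\<^esub> x" unfolding p by blast
    show "y \<in> U <+>\<^bsub>M\<^esub> (\<lambda>x. a \<odot>\<^bsub>M\<^esub> x) ` p x"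
      unfolding u(2) by (rule set_addI[OF u(1) imageI[OF self[OF x]]])
  qed
  have c: "carrier (quot_mod M U) = p ` carrier M"
    by (auto simp: quot_mod_def p_def A_RCOSETS_def' )
  have z: "p \<zero>\<^bsub>M\<^esub> = \<zero>\<^bsub>quot_mod M U\<^esub>"
    using M.a_coset_add_zero[OF U(1)] by (simp add: quot_mod_def p_def)
  note * = lmod_of_surjection[OF c z]
  have add: "p x \<oplus>\<^bsub>quot_mod M U\<^esub> p y = p (x \<oplus>\<^bsub>M\<^esub> y)" if "x \<in> carrier M" "y \<in> carrier M" for x y
    using U.a_rcos_sum[OF that] by (simp add: quot_mod_def p_def)
  have sm': "a \<odot>\<^bsub>quot_mod M U\<^esub> p x = p (a \<odot>\<^bsub>M\<^esub> x)" if "a \<in> carrier A" "x \<in> carrier M" for a x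
    using sm[OF that] by (simp add: quot_mod_def)
  show "lmod A (quot_mod M U)" "p \<in> mod_hom A M (quot_mod M U)"
    using *(1)[OF add sm'] *(2)[OF add sm'] by simp_all
  show "p ` carrier M = carrier (quot_mod M U)" by (rule c[symmetric])
  show "p x = \<zero>\<^bsub>quot_mod M U\<^esub> \<longleftrightarrow> x \<in> U" if x: "x \<in> carrier M" for x
  proof
    assume "p x = \<zero>\<^bsub>quot_mod M U\<^esub>"
    then show "x \<in> U" using self[OF x] by (simp add: quot_mod_def)
  next
    assume "x \<in> U"
    then show "p x = \<zero>\<^bsub>quot_mod M U\<^esub>"
      using U.a_rcos_const[of x] by (simp add: quot_mod_def p_def)
  qed
qed

lemma mod_isomorphicI: "h \<in> mod_hom A M N \<Longrightarrow> bij_betw h (carrier M) (carrier N) \<Longrightarrow> mod_isomorphic A M N"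
  unfolding mod_isomorphic_def mod_iso_def by blast

lemma mod_isomorphicE:
  assumes "mod_isomorphic A M N"
  obtains h where "h \<in> mod_hom A M N" "bij_betw h (carrier M) (carrier N)"
  using assms unfolding mod_isomorphic_def mod_iso_def by blast

lemma mod_isomorphic_refl: "mod_isomorphic A M M"
  by (rule mod_isomorphicI[of "\<lambda>x. x"]) (auto simp: mod_hom_def bij_betw_def)

lemma mod_isomorphic_trans:
  assumes "mod_isomorphic A M N" "mod_isomorphic A N P" shows "mod_isomorphic A M P"
proof -
  obtain g where g: "g \<in> mod_hom A M N" "bij_betw g (carrier M) (carrier N)"
    using assms(1) by (rule mod_isomorphicE)
  obtain h where h: "h \<in> mod_hom A N P" "bij_betw h (carrier N) (carrier P)"
    using assms(2) by (rule mod_isomorphicE)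
  show ?thesis
    by (rule mod_isomorphicI[OF mod_hom_comp[OF g(1) h(1)]])
      (use bij_betw_trans[OF g(2) h(2)] in \<open>simp add: comp_def\<close>)
qed

lemma mod_isomorphic_sym:
  assumes "lmod A M" "lmod A N" "mod_isomorphic A M N" shows "mod_isomorphic A N M"
proof -
  obtain h where h: "h \<in> mod_hom A M N" "bij_betw h (carrier M) (carrier N)"
    using assms(3) by (rule mod_isomorphicE)
  show ?thesis
    by (rule mod_isomorphicI[OF lmod.hom_inv_into[OF assms(1,2) h] bij_betw_inv_into[OF h(2)]])
qed

text \<open>The target \<open>Q\<close> is any model of the quotient \<open>M / U\<close>, in particular one with natural numbers as
  elements. With this notion a quotient can be quotiented again without leaving the type.\<close>

definition quotient_map ::
  "('k, 'a) module \<Rightarrow> ('a, 'b) module \<Rightarrow> ('a, 'c) module \<Rightarrow> 'b set \<Rightarrow> ('b \<Rightarrow> 'c) \<Rightarrow> bool" where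
  "quotient_map A M Q U g \<longleftrightarrow> g \<in> mod_hom A M Q \<and> g ` carrier M = carrier Q \<and>
     (\<forall>x\<in>carrier M. g x = \<zero>\<^bsub>Q\<^esub> \<longleftrightarrow> x \<in> U)"

text \<open>The first isomorphism theorem.\<close>

lemma (in lmod) quotient_maps_isomorphic:
  assumes "lmod A N" "lmod A P" "quotient_map A M N U g" "quotient_map A M P U h"
  obtains k where "k \<in> mod_hom A N P" "bij_betw k (carrier N) (carrier P)"
    "\<And>x. x \<in> carrier M \<Longrightarrow> k (g x) = h x"
proof -
  note gh = assms(3,4)[unfolded quotient_map_def]
  interpret N: lmod A N by fact
  obtain k where k: "k \<in> mod_hom A N P" "\<And>x. x \<in> carrier M \<Longrightarrow> k (g x) = h x"
    by (rule hom_factor[OF assms(1,2), of g h]) (use gh in auto)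
  have "inj_on k (carrier N)" unfolding N.hom_inj_on_iff[OF assms(2) k(1)]
  proof (intro ballI impI)
    fix y assume y: "y \<in> carrier N" "k y = \<zero>\<^bsub>P\<^esub>"
    then obtain x where x: "x \<in> carrier M" "y = g x" using gh by blast
    then show "y = \<zero>\<^bsub>N\<^esub>" using y(2) k(2)[OF x(1)] gh by simp
  qed
  moreover have "k ` carrier N = carrier P"
  proof -
    have "k ` carrier N = (\<lambda>x. k (g x)) ` carrier M" using gh by (auto simp: image_image[symmetric])
    also have "\<dots> = h ` carrier M" using k(2) by (intro image_cong) auto
    finally show ?thesis using gh by simp
  qed
  ultimately show ?thesis using that k by (auto simp: bij_betw_def)
qed

lemma (in lmod) quotient_map_quot_mod:
  assumes "submodule U A M" shows "quotient_map A M (quot_mod M U) U (a_r_coset M U)"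
  using quot_mod_projection[OF assms] unfolding quotient_map_def by blast

lemma quotient_map_comp_iso:
  assumes "lmod A N" "lmod A P" "quotient_map A M N U g" "k \<in> mod_hom A N P" "bij_betw k (carrier N) (carrier P)"
  shows "quotient_map A M P U (\<lambda>x. k (g x))"
  unfolding quotient_map_def
proof (intro conjI ballI)
  note g = assms(3)[unfolded quotient_map_def]
  interpret N: lmod A N by fact
  show "(\<lambda>x. k (g x)) \<in> mod_hom A M P" by (rule mod_hom_comp[OF conjunct1[OF g] assms(4)])
  have "(\<lambda>x. k (g x)) ` carrier M = k ` g ` carrier M" by (simp add: image_image)
  then show "(\<lambda>x. k (g x)) ` carrier M = carrier P" using g assms(5) by (simp add: bij_betw_def)
  fix x assume x: "x \<in> carrier M"
  have gx: "g x \<in> carrier N" by (rule mod_homD(1)[OF conjunct1[OF g] x])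
  have "\<forall>y\<in>carrier N. k y = \<zero>\<^bsub>P\<^esub> \<longrightarrow> y = \<zero>\<^bsub>N\<^esub>"
    using N.hom_inj_on_iff[OF assms(2,4)] bij_betw_imp_inj_on[OF assms(5)] by blast
  then have "k (g x) = \<zero>\<^bsub>P\<^esub> \<longleftrightarrow> g x = \<zero>\<^bsub>N\<^esub>"
    using gx N.hom_zero[OF assms(2,4)] by auto
  then show "k (g x) = \<zero>\<^bsub>P\<^esub> \<longleftrightarrow> x \<in> U" using g x by simp
qed

lemma (in lmod) isomorphic_quot_mod_iff:
  assumes "submodule U A M" "lmod A N"
  shows "mod_isomorphic A (quot_mod M U) N \<longleftrightarrow> (\<exists>g. quotient_map A M N U g)"
proof
  note q = quot_mod_projection(1)[OF assms(1)] quotient_map_quot_mod[OF assms(1)]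
  {
    assume "mod_isomorphic A (quot_mod M U) N"
    then obtain k where "k \<in> mod_hom A (quot_mod M U) N" "bij_betw k (carrier (quot_mod M U)) (carrier N)"
      by (rule mod_isomorphicE)
    from quotient_map_comp_iso[OF q(1) assms(2) q(2) this]
    show "\<exists>g. quotient_map A M N U g" by blast
  next
    assume "\<exists>g. quotient_map A M N U g"
    then obtain g where g: "quotient_map A M N U g" by (rule exE)
    obtain k where "k \<in> mod_hom A (quot_mod M U) N" "bij_betw k (carrier (quot_mod M U)) (carrier N)"
      by (rule quotient_maps_isomorphic[OF q(1) assms(2) q(2) g])
    then show "mod_isomorphic A (quot_mod M U) N" by (rule mod_isomorphicI)
  }
qed

lemma quotient_mapD:
  assumes "quotient_map A M Q U g"
  shows "g \<in> mod_hom A M Q" "g ` carrier M = carrier Q" "\<And>x. x \<in> carrier M \<Longrightarrow> g x = \<zero>\<^bsub>Q\<^esub> \<longleftrightarrow> x \<in> U"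
  using assms unfolding quotient_map_def by auto

lemma (in lmod) quotient_map_kernel:
  assumes "lmod A Q" "g \<in> mod_hom A M Q" "g ` carrier M = carrier Q"
  shows "quotient_map A M Q {x \<in> carrier M. g x = \<zero>\<^bsub>Q\<^esub>} g"
  using assms unfolding quotient_map_def by auto


section \<open>Finite modules\<close>

locale finite_field_algebra =
  fixes K :: "('k, 'm) ring_scheme" and A :: "('k, 'a) module"
  assumes K_field: "field K" and K_finite: "finite (carrier K)" and A_algebra: "assoc_algebra K A"
begin

lemma fd_iff: "fd_module K A M \<longleftrightarrow> lmod A M \<and> finite (carrier M)"
  using fd_module_iff_finite[OF K_finite A_algebra] by (simp add: lmod_def)

lemma fdD: "fd_module K A M \<Longrightarrow> lmod A M" "fd_module K A M \<Longrightarrow> finite (carrier M)"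
  by (auto simp: fd_iff)

lemma fd_sub_mod:
  assumes "fd_module K A M" "submodule U A M" shows "fd_module K A (sub_mod M U)"
proof -
  interpret M: lmod A M using fdD(1)[OF assms(1)] .
  show ?thesis unfolding fd_iff
    using M.lmod_sub_mod[OF assms(2)] finite_subset[OF M.submoduleD(1)[OF assms(2)] fdD(2)[OF assms(1)]] by simp
qed

lemma fd_quotient_exists:
  fixes M :: "('a, 'b) module"
  assumes "fd_module K A M" "submodule U A M"
  obtains Q :: "'a nmod" and g where "fd_module K A Q" "quotient_map A M Q U g"
proof -
  interpret M: lmod A M using fdD(1)[OF assms(1)] .
  note q = M.quot_mod_projection[OF assms(2)] M.quotient_map_quot_mod[OF assms(2)]
  have "fd_module K A (quot_mod M U)" unfolding fd_iff q(3)[symmetric] using q(1) fdD(2)[OF assms(1)] by simp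
  then obtain Q :: "'a nmod" where Q: "fd_module K A Q" "mod_isomorphic A (quot_mod M U) Q"
    using fd_module_on_nat[OF K_finite A_algebra] by blast
  then obtain g where "quotient_map A M Q U g"
    using M.isomorphic_quot_mod_iff[OF assms(2) fdD(1)[OF Q(1)]] by auto
  with Q(1) show ?thesis by (rule that)
qed

lemma card_quotient_less:
  assumes "fd_module K A M" "lmod A Q" "quotient_map A M Q U g" "submodule U A M" "U \<noteq> {\<zero>\<^bsub>M\<^esub>}"
  shows "card (carrier Q) < card (carrier M)"
proof -
  interpret M: lmod A M using fdD(1)[OF assms(1)] .
  note g = quotient_mapD[OF assms(3)]
  have "\<not> inj_on g (carrier M)"
    using M.hom_inj_on_iff[OF assms(2) g(1)] g(3) M.submoduleD(2,3)[OF assms(4)] assms(5) by blast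
  then have "card (g ` carrier M) \<noteq> card (carrier M)"
    using eq_card_imp_inj_on[OF fdD(2)[OF assms(1)]] by blast
  then show ?thesis using card_image_le[OF fdD(2)[OF assms(1)], of g] unfolding g(2) by simp
qed

text \<open>A module that is neither zero nor simple has a proper nonzero submodule, and this
  submodule and its quotient are smaller.\<close>

lemma extension_induct [consumes 1, case_names zero simple extension]:
  fixes P :: "'a nmod \<Rightarrow> bool"
  assumes "fd_module K A M"
    "\<And>M. fd_module K A M \<Longrightarrow> carrier M = {\<zero>\<^bsub>M\<^esub>} \<Longrightarrow> P M"
    "\<And>M. fd_module K A M \<Longrightarrow> simple_mod A M \<Longrightarrow> P M"
    "\<And>M U Q g. fd_module K A M \<Longrightarrow> submodule U A M \<Longrightarrow> fd_module K A Q \<Longrightarrow> quotient_map A M Q U g \<Longrightarrow>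
      P (sub_mod M U) \<Longrightarrow> P Q \<Longrightarrow> P M"
  shows "P M"
  using assms(1)
proof (induction "card (carrier M)" arbitrary: M rule: less_induct)
  case less
  interpret M: lmod A M using fdD(1)[OF less.prems] .
  consider "carrier M = {\<zero>\<^bsub>M\<^esub>}" | "simple_mod A M"
    | U where "submodule U A M" "U \<noteq> {\<zero>\<^bsub>M\<^esub>}" "U \<noteq> carrier M"
    unfolding simple_mod_def by blast
  then show ?case
  proof cases
    case 3
    obtain Q :: "'a nmod" and g where Q: "fd_module K A Q" "quotient_map A M Q U g"
      by (rule fd_quotient_exists[OF less.prems 3(1)])
    have "U \<subset> carrier M" using M.submoduleD(1)[OF 3(1)] 3(3) by blast
    then have "card (carrier (sub_mod M U)) < card (carrier M)"
      using psubset_card_mono[OF fdD(2)[OF less.prems]] by simp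
    then have "P (sub_mod M U)" using less.hyps fd_sub_mod[OF less.prems 3(1)] by blast
    moreover have "P Q"
      using less.hyps[OF card_quotient_less[OF less.prems fdD(1)[OF Q(1)] Q(2) 3(1,2)] Q(1)] .
    ultimately show ?thesis using assms(4)[OF less.prems 3(1) Q] by blast
  qed (use assms(2,3) less.prems in auto)
qed

end


section \<open>Derivations\<close>

text \<open>These are the derivations of \<open>A\<close> with values in the bimodule of additive maps \<open>M \<rightarrow> N\<close>, written as
  functions of two arguments. Extensional functions are used, since otherwise the values outside the
  carriers would make the set infinite.\<close>

definition derivations ::
  "('k, 'a) module \<Rightarrow> ('a, 'b) module \<Rightarrow> ('a, 'c) module \<Rightarrow> ('a \<times> 'b \<Rightarrow> 'c) set" where
  "derivations A M N = {d \<in> carrier A \<times> carrier M \<rightarrow>\<^sub>E carrier N.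
     (\<forall>a\<in>carrier A. \<forall>b\<in>carrier A. \<forall>m\<in>carrier M. d (a \<oplus>\<^bsub>A\<^esub> b, m) = d (a, m) \<oplus>\<^bsub>N\<^esub> d (b, m)) \<and>
     (\<forall>a\<in>carrier A. \<forall>m\<in>carrier M. \<forall>m'\<in>carrier M. d (a, m \<oplus>\<^bsub>M\<^esub> m') = d (a, m) \<oplus>\<^bsub>N\<^esub> d (a, m')) \<and>
     (\<forall>a\<in>carrier A. \<forall>b\<in>carrier A. \<forall>m\<in>carrier M.
        d (a \<otimes>\<^bsub>A\<^esub> b, m) = a \<odot>\<^bsub>N\<^esub> d (b, m) \<oplus>\<^bsub>N\<^esub> d (a, b \<odot>\<^bsub>M\<^esub> m))}"

lemma derivationsI:
  assumes "d \<in> extensional (carrier A \<times> carrier M)"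
    "\<And>a m. a \<in> carrier A \<Longrightarrow> m \<in> carrier M \<Longrightarrow> d (a, m) \<in> carrier N"
    "\<And>a b m. a \<in> carrier A \<Longrightarrow> b \<in> carrier A \<Longrightarrow> m \<in> carrier M \<Longrightarrow>
       d (a \<oplus>\<^bsub>A\<^esub> b, m) = d (a, m) \<oplus>\<^bsub>N\<^esub> d (b, m)"
    "\<And>a m m'. a \<in> carrier A \<Longrightarrow> m \<in> carrier M \<Longrightarrow> m' \<in> carrier M \<Longrightarrow>
       d (a, m \<oplus>\<^bsub>M\<^esub> m') = d (a, m) \<oplus>\<^bsub>N\<^esub> d (a, m')"
    "\<And>a b m. a \<in> carrier A \<Longrightarrow> b \<in> carrier A \<Longrightarrow> m \<in> carrier M \<Longrightarrow>
       d (a \<otimes>\<^bsub>A\<^esub> b, m) = a \<odot>\<^bsub>N\<^esub> d (b, m) \<oplus>\<^bsub>N\<^esub> d (a, b \<odot>\<^bsub>M\<^esub> m)"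
  shows "d \<in> derivations A M N"
  unfolding derivations_def PiE_iff using assms by simp

lemma derivationsD:
  assumes "d \<in> derivations A M N"
  shows "d \<in> extensional (carrier A \<times> carrier M)"
    "\<And>a m. a \<in> carrier A \<Longrightarrow> m \<in> carrier M \<Longrightarrow> d (a, m) \<in> carrier N"
    "\<And>a b m. a \<in> carrier A \<Longrightarrow> b \<in> carrier A \<Longrightarrow> m \<in> carrier M \<Longrightarrow>
       d (a \<oplus>\<^bsub>A\<^esub> b, m) = d (a, m) \<oplus>\<^bsub>N\<^esub> d (b, m)"
    "\<And>a m m'. a \<in> carrier A \<Longrightarrow> m \<in> carrier M \<Longrightarrow> m' \<in> carrier M \<Longrightarrow>
       d (a, m \<oplus>\<^bsub>M\<^esub> m') = d (a, m) \<oplus>\<^bsub>N\<^esub> d (a, m')"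
    "\<And>a b m. a \<in> carrier A \<Longrightarrow> b \<in> carrier A \<Longrightarrow> m \<in> carrier M \<Longrightarrow>
       d (a \<otimes>\<^bsub>A\<^esub> b, m) = a \<odot>\<^bsub>N\<^esub> d (b, m) \<oplus>\<^bsub>N\<^esub> d (a, b \<odot>\<^bsub>M\<^esub> m)"
  using assms unfolding derivations_def PiE_iff by simp_all

lemma derivation_eqI:
  assumes "d \<in> extensional (carrier A \<times> carrier M)" "d' \<in> extensional (carrier A \<times> carrier M)"
    "\<And>a m. a \<in> carrier A \<Longrightarrow> m \<in> carrier M \<Longrightarrow> d (a, m) = d' (a, m)"
  shows "d = d'"
  by (rule extensionalityI[OF assms(1,2)]) (use assms(3) in auto)

lemma derivation_zero_one:
  assumes "lmod A M" "lmod A N" "d \<in> derivations A M N"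
  shows "a \<in> carrier A \<Longrightarrow> d (a, \<zero>\<^bsub>M\<^esub>) = \<zero>\<^bsub>N\<^esub>" "m \<in> carrier M \<Longrightarrow> d (\<one>\<^bsub>A\<^esub>, m) = \<zero>\<^bsub>N\<^esub>"
proof -
  interpret M: lmod A M by fact
  interpret N: lmod A N by fact
  note d = derivationsD[OF assms(3)]
  show "d (a, \<zero>\<^bsub>M\<^esub>) = \<zero>\<^bsub>N\<^esub>" if "a \<in> carrier A"
    using d(4)[OF that M.M.zero_closed M.M.zero_closed] d(2)[OF that M.M.zero_closed]
    by (metis M.M.l_zero M.M.zero_closed N.M.add.r_cancel_one')
  show "d (\<one>\<^bsub>A\<^esub>, m) = \<zero>\<^bsub>N\<^esub>" if "m \<in> carrier M"
    using d(5)[OF M.A.one_closed M.A.one_closed that] d(2)[OF M.A.one_closed that]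
    by (simp add: M.smult_one N.smult_one that)
qed

text \<open>The extension of \<open>M\<close> by \<open>N\<close> given by a derivation, with pairs encoded as natural numbers: the
  action on \<open>N \<times> M\<close> is \<open>a (n, m) = (a n + d(a, m), a m)\<close>. For \<open>d = 0\<close> this is the direct sum.\<close>

definition ext_mod :: "'a nmod \<Rightarrow> 'a nmod \<Rightarrow> ('a \<times> nat \<Rightarrow> nat) \<Rightarrow> 'a nmod" where
  "ext_mod N M d =
     \<lparr>carrier = prod_encode ` (carrier N \<times> carrier M), mult = undefined, one = undefined,
      zero = prod_encode (\<zero>\<^bsub>N\<^esub>, \<zero>\<^bsub>M\<^esub>),
      add = (\<lambda>x y. prod_encode (fst (prod_decode x) \<oplus>\<^bsub>N\<^esub> fst (prod_decode y),
        snd (prod_decode x) \<oplus>\<^bsub>M\<^esub> snd (prod_decode y))),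
      smult = (\<lambda>a x. prod_encode (a \<odot>\<^bsub>N\<^esub> fst (prod_decode x) \<oplus>\<^bsub>N\<^esub> d (a, snd (prod_decode x)),
        a \<odot>\<^bsub>M\<^esub> snd (prod_decode x)))\<rparr>"

lemma ext_mod_simps:
  "carrier (ext_mod N M d) = prod_encode ` (carrier N \<times> carrier M)"
  "\<zero>\<^bsub>ext_mod N M d\<^esub> = prod_encode (\<zero>\<^bsub>N\<^esub>, \<zero>\<^bsub>M\<^esub>)"
  "prod_encode (n, m) \<oplus>\<^bsub>ext_mod N M d\<^esub> prod_encode (n', m') = prod_encode (n \<oplus>\<^bsub>N\<^esub> n', m \<oplus>\<^bsub>M\<^esub> m')"
  "a \<odot>\<^bsub>ext_mod N M d\<^esub> prod_encode (n, m) = prod_encode (a \<odot>\<^bsub>N\<^esub> n \<oplus>\<^bsub>N\<^esub> d (a, m), a \<odot>\<^bsub>M\<^esub> m)"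
  by (simp_all add: ext_mod_def)

lemma lmod_ext_mod:
  fixes M N :: "'a nmod"
  assumes "lmod A M" "lmod A N" "d \<in> derivations A M N"
  shows "lmod A (ext_mod N M d)"
proof -
  interpret M: lmod A M by fact
  interpret N: lmod A N by fact
  note d = derivationsD[OF assms(3)]
  have "abelian_group (ext_mod N M d)"
  proof (rule abelian_groupI)
    fix x assume "x \<in> carrier (ext_mod N M d)"
    then obtain n m where x: "n \<in> carrier N" "m \<in> carrier M" "x = prod_encode (n, m)"
      by (auto simp: ext_mod_simps)
    then have "prod_encode (\<ominus>\<^bsub>N\<^esub> n, \<ominus>\<^bsub>M\<^esub> m) \<oplus>\<^bsub>ext_mod N M d\<^esub> x = \<zero>\<^bsub>ext_mod N M d\<^esub>"
      "prod_encode (\<ominus>\<^bsub>N\<^esub> n, \<ominus>\<^bsub>M\<^esub> m) \<in> carrier (ext_mod N M d)"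
      by (auto simp: ext_mod_simps N.M.l_neg M.M.l_neg)
    then show "\<exists>y\<in>carrier (ext_mod N M d). y \<oplus>\<^bsub>ext_mod N M d\<^esub> x = \<zero>\<^bsub>ext_mod N M d\<^esub>" by blast
  qed (auto simp: ext_mod_simps N.M.a_ac M.M.a_ac)
  then show ?thesis
    by (intro lmod.intro left_module.intro left_module_axioms.intro M.A.ring_axioms)
      (auto simp: ext_mod_simps M.smult_closed N.smult_closed M.smult_l_distr N.smult_l_distr
        M.smult_r_distr N.smult_r_distr M.smult_assoc N.smult_assoc M.smult_one N.smult_one
        d N.M.a_ac derivation_zero_one[OF assms])
qed

context finite_field_algebra
begin

lemma ext_mod_extension:
  assumes "fd_module K A M" "fd_module K A N" "d \<in> derivations A M N"
  shows "(ext_mod N M d, \<lambda>n. prod_encode (n, \<zero>\<^bsub>M\<^esub>), \<lambda>x. snd (prod_decode x)) \<in> extensions K A M N"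
proof -
  interpret M: lmod A M using fdD(1)[OF assms(1)] .
  interpret N: lmod A N using fdD(1)[OF assms(2)] .
  have "fd_module K A (ext_mod N M d)"
    unfolding fd_iff using lmod_ext_mod[OF M.lmod_axioms N.lmod_axioms assms(3)] fdD(2)[OF assms(1)] fdD(2)[OF assms(2)]
    by (simp add: ext_mod_simps)
  moreover have "(\<lambda>n. prod_encode (n, \<zero>\<^bsub>M\<^esub>)) \<in> mod_hom A N (ext_mod N M d)"
    by (rule mod_homI) (auto simp: ext_mod_simps N.smult_closed
        derivation_zero_one(1)[OF M.lmod_axioms N.lmod_axioms assms(3)])
  moreover have "(\<lambda>x. snd (prod_decode x)) \<in> mod_hom A (ext_mod N M d) M"
    by (rule mod_homI) (auto simp: ext_mod_simps)
  moreover have "(\<lambda>x. snd (prod_decode x)) ` carrier (ext_mod N M d) = carrier M"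
    using N.M.zero_closed by (force simp: ext_mod_simps image_image)
  moreover have "(\<lambda>n. prod_encode (n, \<zero>\<^bsub>M\<^esub>)) ` carrier N =
      {x \<in> carrier (ext_mod N M d). snd (prod_decode x) = \<zero>\<^bsub>M\<^esub>}"
    by (auto simp: ext_mod_simps)
  moreover have "inj_on (\<lambda>n. prod_encode (n, \<zero>\<^bsub>M\<^esub>)) (carrier N)"
    by (rule inj_onI) (simp add: prod_encode_eq)
  ultimately show ?thesis unfolding extensions_def by simp
qed

lemma ext_equiv_refl: "e \<in> extensions K A M N \<Longrightarrow> (e, e) \<in> ext_equiv K A M N"
proof -
  assume e: "e \<in> extensions K A M N"
  obtain E f g where efg: "e = (E, f, g)" by (cases e)
  have i: "(\<lambda>x. x) \<in> mod_iso A E E" by (auto simp: mod_iso_def mod_hom_def bij_betw_def)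
  have "\<exists>h\<in>mod_iso A E E. (\<forall>x\<in>carrier N. h (f x) = f x) \<and> (\<forall>x\<in>carrier E. g (h x) = g x)"
    by (rule bexI[OF _ i]) simp
  then show "(e, e) \<in> ext_equiv K A M N" using e unfolding ext_equiv_def efg by simp
qed

text \<open>If the extensions of two derivations \<open>d\<close> and \<open>d'\<close> are equivalent, then \<open>d\<close> and \<open>d'\<close> differ by an inner
  derivation, given by an additive map \<open>\<phi> : M \<rightarrow> N\<close>. There are only finitely many functions
  \<open>\<phi>\<close>, so each element of \<open>Ext\<^sup>1\<close> comes from finitely many derivations.\<close>

lemma finite_derivations_of_finite_Ext1:
  assumes "fd_module K A M" "fd_module K A N" "finite (Ext1 K A M N)"
  shows "finite (derivations A M N)"
proof -
  interpret M: lmod A M using fdD(1)[OF assms(1)] .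
  interpret N: lmod A N using fdD(1)[OF assms(2)] .
  define e :: "('a \<times> nat \<Rightarrow> nat) \<Rightarrow> 'a extension" where
    "e d = (ext_mod N M d, \<lambda>n. prod_encode (n, \<zero>\<^bsub>M\<^esub>), \<lambda>x. snd (prod_decode x))" for d
  define c where "c d = ext_equiv K A M N `` {e d}" for d
  have eE: "e d \<in> extensions K A M N" if "d \<in> derivations A M N" for d
    using ext_mod_extension[OF assms(1,2) that] by (simp add: e_def)
  have fin: "finite (c ` derivations A M N)"
  proof (rule finite_subset[OF _ assms(3)])
    show "c ` derivations A M N \<subseteq> Ext1 K A M N"
      unfolding Ext1_def c_def using quotientI[OF eE] by blast
  qed
  have inner: "\<exists>\<phi>\<in>carrier M \<rightarrow>\<^sub>E carrier N. \<forall>a\<in>carrier A. \<forall>m\<in>carrier M.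
      d (a, m) \<oplus>\<^bsub>N\<^esub> \<phi> (a \<odot>\<^bsub>M\<^esub> m) = a \<odot>\<^bsub>N\<^esub> \<phi> m \<oplus>\<^bsub>N\<^esub> d' (a, m)"
    if d: "d \<in> derivations A M N" and d': "d' \<in> derivations A M N" and eq: "c d = c d'" for d d'
  proof -
    have "e d' \<in> c d" unfolding eq unfolding c_def using ext_equiv_refl[OF eE[OF d']] by simp
    then have "(e d, e d') \<in> ext_equiv K A M N" by (simp add: c_def)
    then obtain h where h: "h \<in> mod_iso A (ext_mod N M d) (ext_mod N M d')"
      "\<And>n. n \<in> carrier N \<Longrightarrow> h (prod_encode (n, \<zero>\<^bsub>M\<^esub>)) = prod_encode (n, \<zero>\<^bsub>M\<^esub>)"
      "\<And>x. x \<in> carrier (ext_mod N M d) \<Longrightarrow> snd (prod_decode (h x)) = snd (prod_decode x)"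
      unfolding e_def ext_equiv_def by (simp, elim conjE bexE, simp)
    \<comment> \<open>Compatibility with both ends forces the isomorphism to be \<open>(n, m) \<mapsto> (n + \<phi>(m), m)\<close>.\<close>
    have hom: "h \<in> mod_hom A (ext_mod N M d) (ext_mod N M d')" using h(1) by (simp add: mod_iso_def)
    note hh = mod_homD[OF hom]
    define \<phi> where "\<phi> = (\<lambda>m\<in>carrier M. fst (prod_decode (h (prod_encode (\<zero>\<^bsub>N\<^esub>, m)))))"
    have mem: "prod_encode (n, m) \<in> carrier (ext_mod N M d)" if "n \<in> carrier N" "m \<in> carrier M" for n m
      using that by (simp add: ext_mod_simps)
    have h0: "h (prod_encode (\<zero>\<^bsub>N\<^esub>, m)) = prod_encode (\<phi> m, m) \<and> \<phi> m \<in> carrier N"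
      if m: "m \<in> carrier M" for m
    proof -
      have "h (prod_encode (\<zero>\<^bsub>N\<^esub>, m)) \<in> carrier (ext_mod N M d')"
        using hh(1)[OF mem[OF N.M.zero_closed m]] .
      then obtain n m' where nm: "n \<in> carrier N" "h (prod_encode (\<zero>\<^bsub>N\<^esub>, m)) = prod_encode (n, m')"
        by (auto simp: ext_mod_simps)
      then show ?thesis using h(3)[OF mem[OF N.M.zero_closed m]] m by (simp add: \<phi>_def)
    qed
    have hnm: "h (prod_encode (n, m)) = prod_encode (n \<oplus>\<^bsub>N\<^esub> \<phi> m, m)"
      if n: "n \<in> carrier N" and m: "m \<in> carrier M" for n m
    proof -
      have "h (prod_encode (n, \<zero>\<^bsub>M\<^esub>) \<oplus>\<^bsub>ext_mod N M d\<^esub> prod_encode (\<zero>\<^bsub>N\<^esub>, m)) =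
          prod_encode (n, \<zero>\<^bsub>M\<^esub>) \<oplus>\<^bsub>ext_mod N M d'\<^esub> prod_encode (\<phi> m, m)"
        using hh(2)[OF mem[OF n M.M.zero_closed] mem[OF N.M.zero_closed m]] h(2)[OF n] h0[OF m] by simp
      then show ?thesis using n m by (simp add: ext_mod_simps)
    qed
    have "d (a, m) \<oplus>\<^bsub>N\<^esub> \<phi> (a \<odot>\<^bsub>M\<^esub> m) = a \<odot>\<^bsub>N\<^esub> \<phi> m \<oplus>\<^bsub>N\<^esub> d' (a, m)"
      if a: "a \<in> carrier A" and m: "m \<in> carrier M" for a m
    proof -
      note dc = derivationsD(2)[OF d a m] derivationsD(2)[OF d' a m]
      have "h (a \<odot>\<^bsub>ext_mod N M d\<^esub> prod_encode (\<zero>\<^bsub>N\<^esub>, m)) = a \<odot>\<^bsub>ext_mod N M d'\<^esub> prod_encode (\<phi> m, m)"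
        using hh(3)[OF a mem[OF N.M.zero_closed m]] h0[OF m] by simp
      then have "h (prod_encode (d (a, m), a \<odot>\<^bsub>M\<^esub> m)) = prod_encode (a \<odot>\<^bsub>N\<^esub> \<phi> m \<oplus>\<^bsub>N\<^esub> d' (a, m), a \<odot>\<^bsub>M\<^esub> m)"
        using a dc by (simp add: ext_mod_simps)
      then show ?thesis unfolding hnm[OF dc(1) M.smult_closed[OF a m]] by (simp add: prod_encode_eq)
    qed
    moreover have "\<phi> \<in> carrier M \<rightarrow>\<^sub>E carrier N"
      unfolding PiE_iff using h0 by (simp add: \<phi>_def)
    ultimately show ?thesis by blast
  qed
  have fib: "finite {d \<in> derivations A M N. c d = y}" for y
  proof (cases "{d \<in> derivations A M N. c d = y} = {}")
    case False
    then obtain d0 where d0: "d0 \<in> derivations A M N" "c d0 = y" by blast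
    define F where "F \<phi> = (\<lambda>(a, m) \<in> carrier A \<times> carrier M.
      (d0 (a, m) \<oplus>\<^bsub>N\<^esub> \<phi> (a \<odot>\<^bsub>M\<^esub> m)) \<ominus>\<^bsub>N\<^esub> a \<odot>\<^bsub>N\<^esub> \<phi> m)" for \<phi>
    have "d \<in> F ` (carrier M \<rightarrow>\<^sub>E carrier N)" if d: "d \<in> derivations A M N" "c d = y" for d
    proof -
      obtain \<phi> where \<phi>: "\<phi> \<in> carrier M \<rightarrow>\<^sub>E carrier N" "\<forall>a\<in>carrier A. \<forall>m\<in>carrier M.
          d0 (a, m) \<oplus>\<^bsub>N\<^esub> \<phi> (a \<odot>\<^bsub>M\<^esub> m) = a \<odot>\<^bsub>N\<^esub> \<phi> m \<oplus>\<^bsub>N\<^esub> d (a, m)"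
        using inner[OF d0(1) d(1)] d0(2) d(2) by auto
      have "d = F \<phi>"
      proof (rule derivation_eqI[OF derivationsD(1)[OF d(1)]])
        show "F \<phi> \<in> extensional (carrier A \<times> carrier M)" by (simp add: F_def)
        fix a m assume a: "a \<in> carrier A" and m: "m \<in> carrier M"
        have p: "\<phi> m \<in> carrier N" using \<phi>(1) m by auto
        have "F \<phi> (a, m) = (a \<odot>\<^bsub>N\<^esub> \<phi> m \<oplus>\<^bsub>N\<^esub> d (a, m)) \<ominus>\<^bsub>N\<^esub> a \<odot>\<^bsub>N\<^esub> \<phi> m"
          using a m \<phi>(2) by (simp add: F_def)
        also have "\<dots> = d (a, m) \<oplus>\<^bsub>N\<^esub> (a \<odot>\<^bsub>N\<^esub> \<phi> m \<oplus>\<^bsub>N\<^esub> (\<ominus>\<^bsub>N\<^esub> (a \<odot>\<^bsub>N\<^esub> \<phi> m)))"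
          using derivationsD(2)[OF d(1) a m] N.smult_closed[OF a p] by (simp add: a_minus_def N.M.a_ac)
        also have "\<dots> = d (a, m)"
          using derivationsD(2)[OF d(1) a m] N.smult_closed[OF a p] by (simp add: N.M.r_neg)
        finally show "d (a, m) = F \<phi> (a, m)" by simp
      qed
      then show ?thesis using \<phi>(1) by blast
    qed
    then have "{d \<in> derivations A M N. c d = y} \<subseteq> F ` (carrier M \<rightarrow>\<^sub>E carrier N)" by blast
    moreover have "finite (carrier M \<rightarrow>\<^sub>E carrier N)"
      by (rule finite_PiE) (use fdD(2)[OF assms(1)] fdD(2)[OF assms(2)] in auto)
    ultimately show ?thesis using finite_subset by blast
  next
    case True
    show ?thesis unfolding True by simp
  qed
  have "derivations A M N = (\<Union>y\<in>c ` derivations A M N. {d \<in> derivations A M N. c d = y})" by blast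
  also have "finite \<dots>" using fin fib by blast
  finally show ?thesis .
qed

lemma derivations_diff:
  assumes "lmod A M" "lmod A N" "d \<in> derivations A M N" "d' \<in> derivations A M N"
  shows "(\<lambda>p \<in> carrier A \<times> carrier M. d p \<ominus>\<^bsub>N\<^esub> d' p) \<in> derivations A M N"
proof -
  interpret M: lmod A M by fact
  interpret N: lmod A N by fact
  note d = derivationsD[OF assms(3)] and d' = derivationsD[OF assms(4)]
  have 4: "(x \<oplus>\<^bsub>N\<^esub> y) \<ominus>\<^bsub>N\<^esub> (x' \<oplus>\<^bsub>N\<^esub> y') = (x \<ominus>\<^bsub>N\<^esub> x') \<oplus>\<^bsub>N\<^esub> (y \<ominus>\<^bsub>N\<^esub> y')"
    if "x \<in> carrier N" "y \<in> carrier N" "x' \<in> carrier N" "y' \<in> carrier N" for x y x' y'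
    using that by (simp add: a_minus_def N.M.a_ac N.M.minus_add)
  have s: "a \<odot>\<^bsub>N\<^esub> (x \<ominus>\<^bsub>N\<^esub> y) = a \<odot>\<^bsub>N\<^esub> x \<ominus>\<^bsub>N\<^esub> a \<odot>\<^bsub>N\<^esub> y"
    if "a \<in> carrier A" "x \<in> carrier N" "y \<in> carrier N" for a x y
    using that by (simp add: a_minus_def N.smult_r_distr N.smult_minus_right)
  show ?thesis
    by (rule derivationsI)
      (simp_all add: d d' 4 s N.smult_closed M.smult_closed)
qed

text \<open>The set of derivations is a union of finitely many fibres of \<open>r\<close>. Subtracting a fixed
  element embeds a fibre into the set of derivations satisfying \<open>Z\<close>.\<close>

lemma finite_derivations_by_restriction:
  assumes "lmod A M" "lmod A N" "finite (r ` derivations A M N)"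
    "finite {d \<in> derivations A M N. Z d}"
    "\<And>d d'. d \<in> derivations A M N \<Longrightarrow> d' \<in> derivations A M N \<Longrightarrow> r d = r d' \<Longrightarrow>
       Z (\<lambda>p \<in> carrier A \<times> carrier M. d p \<ominus>\<^bsub>N\<^esub> d' p)"
  shows "finite (derivations A M N)"
proof -
  interpret N: lmod A N by fact
  have fib: "finite {d \<in> derivations A M N. r d = y}" for y
  proof (cases "{d \<in> derivations A M N. r d = y} = {}")
    case False
    then obtain d0 where d0: "d0 \<in> derivations A M N" "r d0 = y" by blast
    define F where "F d = (\<lambda>p \<in> carrier A \<times> carrier M. d p \<ominus>\<^bsub>N\<^esub> d0 p)" for d
    have "inj_on F {d \<in> derivations A M N. r d = y}"
    proof (rule inj_onI)
      fix d d' assume d: "d \<in> {d \<in> derivations A M N. r d = y}" "d' \<in> {d \<in> derivations A M N. r d = y}"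
        and eq: "F d = F d'"
      have dd: "d \<in> derivations A M N" "d' \<in> derivations A M N" using d by simp_all
      show "d = d'"
      proof (rule derivation_eqI[OF derivationsD(1)[OF dd(1)] derivationsD(1)[OF dd(2)]])
        fix a m assume am: "a \<in> carrier A" "m \<in> carrier M"
        note c = derivationsD(2)[OF dd(1) am] derivationsD(2)[OF dd(2) am] derivationsD(2)[OF d0(1) am]
        have "d (a, m) \<ominus>\<^bsub>N\<^esub> d0 (a, m) = d' (a, m) \<ominus>\<^bsub>N\<^esub> d0 (a, m)"
          using fun_cong[OF eq, of "(a, m)"] am by (simp add: F_def)
        then show "d (a, m) = d' (a, m)" using c by (simp add: a_minus_def)
      qed
    qed
    moreover have "F ` {d \<in> derivations A M N. r d = y} \<subseteq> {d \<in> derivations A M N. Z d}"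
    proof (rule image_subsetI)
      fix d assume "d \<in> {d \<in> derivations A M N. r d = y}"
      then have d: "d \<in> derivations A M N" "r d = r d0" using d0(2) by simp_all
      show "F d \<in> {d \<in> derivations A M N. Z d}"
        unfolding F_def using derivations_diff[OF assms(1,2) d(1) d0(1)] assms(5)[OF d(1) d0(1) d(2)] by simp
    qed
    ultimately show ?thesis using finite_imageD[OF finite_subset[OF _ assms(4)]] by simp
  next
    case True
    show ?thesis unfolding True by simp
  qed
  have "derivations A M N = (\<Union>y\<in>r ` derivations A M N. {d \<in> derivations A M N. r d = y})" by blast
  also have "finite \<dots>" using assms(3) fib by blast
  finally show ?thesis .
qed

text \<open>Left exactness in \<open>N\<close>: derivations with the same image in \<open>N / U\<close> differ by one with values in
  \<open>U\<close>.\<close>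

lemma finite_derivations_extension_right:
  fixes M :: "('a, 'b) module"
  assumes "fd_module K A M" "fd_module K A N" "submodule U A N" "lmod A Q" "quotient_map A N Q U g"
    "finite (derivations A M (sub_mod N U))" "finite (derivations A M Q)"
  shows "finite (derivations A M N)"
proof -
  interpret M: lmod A M using fdD(1)[OF assms(1)] .
  interpret N: lmod A N using fdD(1)[OF assms(2)] .
  note g = quotient_mapD[OF assms(5)] and gh = mod_homD[OF quotient_mapD(1)[OF assms(5)]]
  note U = N.submoduleD[OF assms(3)]
  define r where "r d = (\<lambda>p \<in> carrier A \<times> carrier M. g (d p))" for d
  show ?thesis
  proof (rule finite_derivations_by_restriction[OF M.lmod_axioms N.lmod_axioms, of r
        "\<lambda>d. \<forall>p \<in> carrier A \<times> carrier M. d p \<in> U"])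
    have "r d \<in> derivations A M Q" if "d \<in> derivations A M N" for d
      by (rule derivationsI) (simp_all add: r_def derivationsD[OF that] gh M.smult_closed N.smult_closed)
    then show "finite (r ` derivations A M N)"
      by (intro finite_subset[OF _ assms(7)]) auto
    have "d \<in> derivations A M (sub_mod N U)"
      if d: "d \<in> derivations A M N" and dU: "\<forall>p \<in> carrier A \<times> carrier M. d p \<in> U" for d
      by (rule derivationsI) (simp_all add: derivationsD[OF d] bspec[OF dU])
    then show "finite {d \<in> derivations A M N. \<forall>p \<in> carrier A \<times> carrier M. d p \<in> U}"
      by (intro finite_subset[OF _ assms(6)]) auto
    fix d d' assume d: "d \<in> derivations A M N" "d' \<in> derivations A M N" "r d = r d'"
    show "\<forall>p \<in> carrier A \<times> carrier M. (\<lambda>p \<in> carrier A \<times> carrier M. d p \<ominus>\<^bsub>N\<^esub> d' p) p \<in> U"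
    proof
      fix p assume "p \<in> carrier A \<times> carrier M"
      then obtain a m where p: "p = (a, m)" and am: "a \<in> carrier A" "m \<in> carrier M" by (rule SigmaE)
      note c = derivationsD(2)[OF d(1) am] derivationsD(2)[OF d(2) am]
      have "g (d (a, m)) = g (d' (a, m))" using fun_cong[OF d(3), of "(a, m)"] am by (simp add: r_def)
      then have "g (d (a, m) \<ominus>\<^bsub>N\<^esub> d' (a, m)) = \<zero>\<^bsub>Q\<^esub>" using N.hom_eq_iff[OF assms(4) g(1) c] by simp
      then show "(\<lambda>p \<in> carrier A \<times> carrier M. d p \<ominus>\<^bsub>N\<^esub> d' p) p \<in> U"
        using g(3)[OF N.M.minus_closed[OF c]] am by (simp add: p)
    qed
  qed
qed

text \<open>Left exactness in \<open>M\<close>: derivations with the same restriction to \<open>U\<close> differ by one that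
  vanishes on \<open>U\<close> and so factors through \<open>M / U\<close>.\<close>

lemma finite_derivations_extension_left:
  fixes M :: "('a, 'b) module" and N :: "('a, 'c) module"
  assumes "fd_module K A M" "fd_module K A N" "submodule U A M" "lmod A Q" "quotient_map A M Q U g"
    "finite (derivations A (sub_mod M U) N)" "finite (derivations A Q N)"
  shows "finite (derivations A M N)"
proof -
  interpret M: lmod A M using fdD(1)[OF assms(1)] .
  interpret N: lmod A N using fdD(1)[OF assms(2)] .
  interpret Q: lmod A Q by fact
  note g = quotient_mapD[OF assms(5)] and gh = mod_homD[OF quotient_mapD(1)[OF assms(5)]]
  note U = M.submoduleD[OF assms(3)]
  define r where "r d = (\<lambda>p \<in> carrier A \<times> U. d p)" for d :: "'a \<times> 'b \<Rightarrow> 'c"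
  show ?thesis
  proof (rule finite_derivations_by_restriction[OF M.lmod_axioms N.lmod_axioms, of r
        "\<lambda>d. \<forall>p \<in> carrier A \<times> U. d p = \<zero>\<^bsub>N\<^esub>"])
    have "r d \<in> derivations A (sub_mod M U) N" if "d \<in> derivations A M N" for d
      by (rule derivationsI) (simp_all add: r_def derivationsD[OF that] U)
    then show "finite (r ` derivations A M N)"
      by (intro finite_subset[OF _ assms(6)]) auto
    define s where "s q = (SOME m. m \<in> carrier M \<and> g m = q)" for q
    define F where "F d = (\<lambda>p \<in> carrier A \<times> carrier Q. d (fst p, s (snd p)))" for d :: "'a \<times> 'b \<Rightarrow> 'c"
    have s: "s q \<in> carrier M \<and> g (s q) = q" if "q \<in> carrier Q" for q
      unfolding s_def by (rule someI_ex) (use that[folded g(2)] in blast)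
    have Fg: "F d (a, g m) = d (a, m)"
      if d: "d \<in> derivations A M N" "\<forall>p \<in> carrier A \<times> U. d p = \<zero>\<^bsub>N\<^esub>"
        and am: "a \<in> carrier A" "m \<in> carrier M" for d a m
    proof -
      let ?n = "s (g m)"
      have gm: "g m \<in> carrier Q" using gh(1)[OF am(2)] .
      have n: "?n \<in> carrier M" "g ?n = g m" using s[OF gm] by auto
      have "g (?n \<ominus>\<^bsub>M\<^esub> m) = \<zero>\<^bsub>Q\<^esub>" using M.hom_eq_iff[OF assms(4) g(1) n(1) am(2)] n(2) by simp
      then have "?n \<ominus>\<^bsub>M\<^esub> m \<in> U" using g(3) n(1) am(2) by simp
      then have "d (a, ?n \<ominus>\<^bsub>M\<^esub> m) = \<zero>\<^bsub>N\<^esub>" using d(2) am(1) by auto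
      moreover have "(?n \<ominus>\<^bsub>M\<^esub> m) \<oplus>\<^bsub>M\<^esub> m = ?n" using n(1) am(2) by (simp add: a_minus_def M.M.a_assoc M.M.l_neg)
      ultimately have "d (a, ?n) = d (a, m)"
        using derivationsD(4)[OF d(1) am(1), of "?n \<ominus>\<^bsub>M\<^esub> m" m] derivationsD(2)[OF d(1) am] n(1) am(2) by simp
      then show ?thesis using am gm by (simp add: F_def)
    qed
    have "F d \<in> derivations A Q N"
      if d: "d \<in> derivations A M N" "\<forall>p \<in> carrier A \<times> U. d p = \<zero>\<^bsub>N\<^esub>" for d
    proof -
      note Fd = Fg[OF d] and D = derivationsD[OF d(1)]
      have ex: "\<exists>m\<in>carrier M. q = g m" if "q \<in> carrier Q" for q using s[OF that] by force
      show ?thesis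
      proof (rule derivationsI)
        show "F d \<in> extensional (carrier A \<times> carrier Q)" by (simp add: F_def)
        fix a q assume a: "a \<in> carrier A" and "q \<in> carrier Q"
        then obtain m where m: "m \<in> carrier M" "q = g m" using ex by blast
        show "F d (a, q) \<in> carrier N" unfolding m(2) Fd[OF a m(1)] by (rule D(2)[OF a m(1)])
        {
          fix b assume b: "b \<in> carrier A"
          show "F d (a \<oplus>\<^bsub>A\<^esub> b, q) = F d (a, q) \<oplus>\<^bsub>N\<^esub> F d (b, q)"
            unfolding m(2) using Fd[OF a m(1)] Fd[OF b m(1)] Fd[OF M.A.add.m_closed[OF a b] m(1)] D(3)[OF a b m(1)] by simp
          show "F d (a \<otimes>\<^bsub>A\<^esub> b, q) = a \<odot>\<^bsub>N\<^esub> F d (b, q) \<oplus>\<^bsub>N\<^esub> F d (a, b \<odot>\<^bsub>Q\<^esub> q)"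
            unfolding m(2) using Fd[OF b m(1)] Fd[OF M.A.m_closed[OF a b] m(1)]
              Fd[OF a M.smult_closed[OF b m(1)]] D(5)[OF a b m(1)] gh(3)[OF b m(1)] by simp
        }
        {
          fix q' assume "q' \<in> carrier Q"
          then obtain m' where m': "m' \<in> carrier M" "q' = g m'" using ex by blast
          show "F d (a, q \<oplus>\<^bsub>Q\<^esub> q') = F d (a, q) \<oplus>\<^bsub>N\<^esub> F d (a, q')"
            unfolding m(2) m'(2) using Fd[OF a m(1)] Fd[OF a m'(1)]
              Fd[OF a M.M.add.m_closed[OF m(1) m'(1)]] D(4)[OF a m(1) m'(1)] gh(2)[OF m(1) m'(1)] by simp
        }
      qed
    qed
    then have sub: "F ` {d \<in> derivations A M N. \<forall>p \<in> carrier A \<times> U. d p = \<zero>\<^bsub>N\<^esub>} \<subseteq> derivations A Q N"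
      by auto
    have "inj_on F {d \<in> derivations A M N. \<forall>p \<in> carrier A \<times> U. d p = \<zero>\<^bsub>N\<^esub>}"
    proof (rule inj_onI)
      fix d d' assume d: "d \<in> {d \<in> derivations A M N. \<forall>p \<in> carrier A \<times> U. d p = \<zero>\<^bsub>N\<^esub>}"
        "d' \<in> {d \<in> derivations A M N. \<forall>p \<in> carrier A \<times> U. d p = \<zero>\<^bsub>N\<^esub>}" and eq: "F d = F d'"
      then have D: "d \<in> derivations A M N" "\<forall>p \<in> carrier A \<times> U. d p = \<zero>\<^bsub>N\<^esub>"
        "d' \<in> derivations A M N" "\<forall>p \<in> carrier A \<times> U. d' p = \<zero>\<^bsub>N\<^esub>" by auto
      show "d = d'"
      proof (rule derivation_eqI[OF derivationsD(1)[OF D(1)] derivationsD(1)[OF D(3)]])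
        fix a m assume am: "a \<in> carrier A" "m \<in> carrier M"
        show "d (a, m) = d' (a, m)" using Fg[OF D(1,2) am] Fg[OF D(3,4) am] eq by simp
      qed
    qed
    then show "finite {d \<in> derivations A M N. \<forall>p \<in> carrier A \<times> U. d p = \<zero>\<^bsub>N\<^esub>}"
      by (rule finite_imageD[OF finite_subset[OF sub assms(7)]])
    fix d d' assume d: "d \<in> derivations A M N" "d' \<in> derivations A M N" "r d = r d'"
    show "\<forall>p \<in> carrier A \<times> U. (\<lambda>p \<in> carrier A \<times> carrier M. d p \<ominus>\<^bsub>N\<^esub> d' p) p = \<zero>\<^bsub>N\<^esub>"
    proof
      fix p assume "p \<in> carrier A \<times> U"
      then obtain a m where p: "p = (a, m)" and am: "a \<in> carrier A" "m \<in> U" by (rule SigmaE)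
      have "d (a, m) = d' (a, m)" using fun_cong[OF d(3), of "(a, m)"] am by (simp add: r_def)
      then show "(\<lambda>p \<in> carrier A \<times> carrier M. d p \<ominus>\<^bsub>N\<^esub> d' p) p = \<zero>\<^bsub>N\<^esub>"
        using derivationsD(2)[OF d(2) am(1) U(3)[OF am(2)]] am U(3)[OF am(2)]
        by (simp add: p a_minus_def N.M.r_neg)
    qed
  qed
qed

lemma finite_derivations_zero:
  assumes "lmod A M" "lmod A N" "carrier M = {\<zero>\<^bsub>M\<^esub>} \<or> carrier N = {\<zero>\<^bsub>N\<^esub>}"
  shows "finite (derivations A M N)"
proof -
  have "d (a, m) = \<zero>\<^bsub>N\<^esub>" if "d \<in> derivations A M N" "a \<in> carrier A" "m \<in> carrier M" for d a m
    using assms(3) derivationsD(2)[OF that] derivation_zero_one(1)[OF assms(1,2) that(1,2)] that(3) by auto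
  note zero = this
  have "derivations A M N \<subseteq> {\<lambda>p \<in> carrier A \<times> carrier M. \<zero>\<^bsub>N\<^esub>}"
  proof
    fix d assume d: "d \<in> derivations A M N"
    have "d = (\<lambda>p \<in> carrier A \<times> carrier M. \<zero>\<^bsub>N\<^esub>)"
      by (rule derivation_eqI[OF derivationsD(1)[OF d]]) (simp_all add: zero[OF d])
    then show "d \<in> {\<lambda>p \<in> carrier A \<times> carrier M. \<zero>\<^bsub>N\<^esub>}" by simp
  qed
  then show ?thesis using finite_subset by blast
qed

text \<open>Left exactness in both arguments reduces the claim to simple modules.\<close>

theorem finite_derivations:
  fixes M N :: "'a nmod"
  assumes "finitary K A" "fd_module K A M" "fd_module K A N"
  shows "finite (derivations A M N)"
  using assms(2)
proof (induction rule: extension_induct)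
  case (zero M)
  show ?case by (rule finite_derivations_zero[OF fdD(1)[OF zero(1)] fdD(1)[OF assms(3)] disjI1[OF zero(2)]])
next
  case (simple M)
  show ?case using assms(3)
  proof (induction rule: extension_induct)
    case (zero N)
    show ?case by (rule finite_derivations_zero[OF fdD(1)[OF simple(1)] fdD(1)[OF zero(1)] disjI2[OF zero(2)]])
  next
    case S: (simple N)
    show ?case
      using finite_derivations_of_finite_Ext1[OF simple(1) S(1)] assms(1) simple S
      unfolding finitary_def by simp
  next
    case (extension N U Q g)
    show ?case
      by (rule finite_derivations_extension_right[OF simple(1) extension(1,2) fdD(1)[OF extension(3)] extension(4-6)])
  qed
next
  case (extension M U Q g)
  show ?case
    by (rule finite_derivations_extension_left[OF extension(1) assms(3) extension(2) fdD(1)[OF extension(3)] extension(4-6)])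
qed

end


section \<open>Finitely many middle terms\<close>

text \<open>The classification of extensions proceeds in two steps, first by a finite invariant \<open>t\<close> and
  then within each class of \<open>t\<close>.\<close>

lemma finite_image_by_invariant:
  assumes "finite (t ` S)" "\<And>x. x \<in> S \<Longrightarrow> finite (c ` {y \<in> S. t y = t x})"
  shows "finite (c ` S)"
proof -
  have "c ` S \<subseteq> (\<Union>\<tau>\<in>t ` S. c ` {y \<in> S. t y = \<tau>})" by auto
  moreover have "finite (\<Union>\<tau>\<in>t ` S. c ` {y \<in> S. t y = \<tau>})"
    using assms by (intro finite_UN_I) auto
  ultimately show ?thesis by (rule finite_subset)
qed

text \<open>Here \<open>R\<close> relates an object to data that determine its value under \<open>c\<close>. A relation is used, because
  the data of an extension depend on a choice of an isomorphism.\<close>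

lemma finite_image_of_determining:
  assumes "finite D" "\<And>x. x \<in> S \<Longrightarrow> \<exists>d\<in>D. R x d"
    "\<And>x y d. x \<in> S \<Longrightarrow> y \<in> S \<Longrightarrow> R x d \<Longrightarrow> R y d \<Longrightarrow> c x = c y"
  shows "finite (c ` S)"
proof -
  obtain d where d: "\<forall>x\<in>S. d x \<in> D \<and> R x (d x)" using assms(2) bchoice[of S "\<lambda>x d. d \<in> D \<and> R x d"] by blast
  have "c x = c (inv_into S d (d x))" if x: "x \<in> S" for x
  proof -
    let ?y = "inv_into S d (d x)"
    have y: "?y \<in> S" "d ?y = d x" using inv_into_into[OF imageI[OF x]] f_inv_into_f[OF imageI[OF x]] by auto
    have "R ?y (d x)" using d y by metis
    then show ?thesis using assms(3)[OF x y(1), of "d x"] d x by blast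
  qed
  then have "c ` S \<subseteq> (\<lambda>z. c (inv_into S d z)) ` d ` S" by (auto simp: image_image)
  moreover have "d ` S \<subseteq> D" using d by blast
  ultimately show ?thesis using assms(1) by (meson finite_imageI finite_subset)
qed

context finite_field_algebra
begin

text \<open>A section of \<open>E \<rightarrow> M\<close> as a map of sets; an additive one need not exist.\<close>

definition ext_section :: "'a extension \<Rightarrow> nat \<Rightarrow> nat" where
  "ext_section e m = (SOME x. x \<in> carrier (fst e) \<and> snd (snd e) x = m)"

text \<open>The bijection \<open>(n, m) \<mapsto> f n + s m\<close> from \<open>N \<times> M\<close> to \<open>E\<close>. It transports all extensions to the
  same finite set, where only finitely many additions are possible.\<close>

definition ext_coord :: "'a extension \<Rightarrow> nat \<times> nat \<Rightarrow> nat" where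
  "ext_coord e = (\<lambda>(n, m). fst (snd e) n \<oplus>\<^bsub>fst e\<^esub> ext_section e m)"

text \<open>The addition of \<open>E\<close> and the inclusion of \<open>N\<close> in these coordinates, that is, the extension of
  abelian groups. The projection to \<open>M\<close> is the second coordinate.\<close>

definition ext_table ::
  "'a nmod \<Rightarrow> 'a nmod \<Rightarrow> 'a extension \<Rightarrow> ((nat \<times> nat) \<times> nat \<times> nat \<Rightarrow> nat \<times> nat) \<times> (nat \<Rightarrow> nat \<times> nat)" where
  "ext_table M N e = (let B = carrier N \<times> carrier M; r = inv_into B (ext_coord e) in
     (\<lambda>p \<in> B \<times> B. r (ext_coord e (fst p) \<oplus>\<^bsub>fst e\<^esub> ext_coord e (snd p)), \<lambda>n \<in> carrier N. r (fst (snd e) n)))"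

lemma extensionsD:
  assumes "(E, f, g) \<in> extensions K A M N"
  shows "fd_module K A E" "f \<in> mod_hom A N E" "g \<in> mod_hom A E M" "inj_on f (carrier N)"
    "g ` carrier E = carrier M" "f ` carrier N = {x \<in> carrier E. g x = \<zero>\<^bsub>M\<^esub>}"
  using assms unfolding extensions_def by auto

lemma ext_coord_bij:
  assumes "fd_module K A M" "fd_module K A N" "(E, f, g) \<in> extensions K A M N"
  shows "bij_betw (ext_coord (E, f, g)) (carrier N \<times> carrier M) (carrier E)"
    "\<And>n m. n \<in> carrier N \<Longrightarrow> m \<in> carrier M \<Longrightarrow> g (ext_coord (E, f, g) (n, m)) = m"
proof -
  note e = extensionsD[OF assms(3)]
  interpret M: lmod A M using fdD(1)[OF assms(1)] .
  interpret N: lmod A N using fdD(1)[OF assms(2)] .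
  interpret E: lmod A E using fdD(1)[OF e(1)] .
  note f = mod_homD[OF e(2)] and g = mod_homD[OF e(3)]
  let ?s = "ext_section (E, f, g)"
  have s: "?s m \<in> carrier E" "g (?s m) = m" if "m \<in> carrier M" for m
  proof -
    have "\<exists>x. x \<in> carrier E \<and> g x = m" using that[folded e(5)] by blast
    from someI_ex[OF this] show "?s m \<in> carrier E" "g (?s m) = m" by (simp_all add: ext_section_def)
  qed
  have gf: "g (f n) = \<zero>\<^bsub>M\<^esub>" if "n \<in> carrier N" for n
    using imageI[OF that, of f] unfolding e(6) by simp
  have c: "ext_coord (E, f, g) (n, m) = f n \<oplus>\<^bsub>E\<^esub> ?s m" for n m by (simp add: ext_coord_def)
  show gc: "g (ext_coord (E, f, g) (n, m)) = m" if "n \<in> carrier N" "m \<in> carrier M" for n m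
    unfolding c using g(2)[OF f(1)[OF that(1)] s(1)[OF that(2)]] gf[OF that(1)] s(2)[OF that(2)] that by simp
  have "inj_on (ext_coord (E, f, g)) (carrier N \<times> carrier M)"
  proof (rule inj_onI)
    fix p q assume "p \<in> carrier N \<times> carrier M" "q \<in> carrier N \<times> carrier M"
      and eq: "ext_coord (E, f, g) p = ext_coord (E, f, g) q"
    then obtain n m n' m' where p: "p = (n, m)" "n \<in> carrier N" "m \<in> carrier M"
      and q: "q = (n', m')" "n' \<in> carrier N" "m' \<in> carrier M" by (elim SigmaE)
    have mm: "m = m'" using gc[OF p(2,3)] gc[OF q(2,3)] eq p(1) q(1) by simp
    then have "f n \<oplus>\<^bsub>E\<^esub> ?s m = f n' \<oplus>\<^bsub>E\<^esub> ?s m" using eq unfolding p(1) q(1) c by simp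
    then have "f n = f n'" using f(1)[OF p(2)] f(1)[OF q(2)] s(1)[OF p(3)] by simp
    then show "p = q" using inj_onD[OF e(4) _ p(2) q(2)] mm p(1) q(1) by simp
  qed
  moreover have "ext_coord (E, f, g) ` (carrier N \<times> carrier M) = carrier E"
  proof (intro equalityI subsetI)
    fix x assume "x \<in> ext_coord (E, f, g) ` (carrier N \<times> carrier M)"
    then obtain n m where "n \<in> carrier N" "m \<in> carrier M" "x = f n \<oplus>\<^bsub>E\<^esub> ?s m" by (auto simp: c)
    then show "x \<in> carrier E" using f(1)[of n] s(1)[of m] by simp
  next
    fix x assume x: "x \<in> carrier E"
    have m: "g x \<in> carrier M" by (rule g(1)[OF x])
    have "g (x \<ominus>\<^bsub>E\<^esub> ?s (g x)) = \<zero>\<^bsub>M\<^esub>"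
      using E.hom_eq_iff[OF M.lmod_axioms e(3) x s(1)[OF m]] s(2)[OF m] by simp
    then have "x \<ominus>\<^bsub>E\<^esub> ?s (g x) \<in> f ` carrier N" unfolding e(6) using x s(1)[OF m] by simp
    then obtain n where n: "n \<in> carrier N" "x \<ominus>\<^bsub>E\<^esub> ?s (g x) = f n" by blast
    have "(x \<ominus>\<^bsub>E\<^esub> ?s (g x)) \<oplus>\<^bsub>E\<^esub> ?s (g x) = x"
      using x s(1)[OF m] by (simp add: a_minus_def E.M.a_assoc E.M.l_neg)
    then have "ext_coord (E, f, g) (n, g x) = x" unfolding c n(2) .
    then show "x \<in> ext_coord (E, f, g) ` (carrier N \<times> carrier M)"
      using n(1) m by (intro image_eqI[of _ _ "(n, g x)"]) auto
  qed
  ultimately show "bij_betw (ext_coord (E, f, g)) (carrier N \<times> carrier M) (carrier E)"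
    by (simp add: bij_betw_def)
qed

lemma finite_ext_tables:
  assumes "fd_module K A M" "fd_module K A N"
  shows "finite (ext_table M N ` extensions K A M N)"
proof -
  let ?B = "carrier N \<times> carrier M"
  have "ext_table M N e \<in> (?B \<times> ?B \<rightarrow>\<^sub>E ?B) \<times> (carrier N \<rightarrow>\<^sub>E ?B)" if "e \<in> extensions K A M N" for e
  proof -
    obtain E f g where e: "e = (E, f, g)" by (cases e)
    note D = extensionsD[OF that[unfolded e]]
    interpret E: lmod A E using fdD(1)[OF D(1)] .
    note b = ext_coord_bij(1)[OF assms that[unfolded e]]
    note r = bij_betw_apply[OF bij_betw_inv_into[OF b]]
    have c: "ext_coord (E, f, g) p \<in> carrier E" if "p \<in> ?B" for p using bij_betw_apply[OF b that] .
    have 1: "\<forall>p\<in>?B \<times> ?B. inv_into ?B (ext_coord (E, f, g))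
        (ext_coord (E, f, g) (fst p) \<oplus>\<^bsub>E\<^esub> ext_coord (E, f, g) (snd p)) \<in> ?B"
      by (intro ballI r E.M.a_closed c) (simp_all add: mem_Times_iff)
    have 2: "\<forall>n\<in>carrier N. inv_into ?B (ext_coord (E, f, g)) (f n) \<in> ?B"
      by (intro ballI r mod_homD(1)[OF D(2)])
    show ?thesis using 1 2 unfolding ext_table_def Let_def e mem_Times_iff fst_conv snd_conv restrict_PiE_iff
      by simp
  qed
  then have "ext_table M N ` extensions K A M N \<subseteq> (?B \<times> ?B \<rightarrow>\<^sub>E ?B) \<times> (carrier N \<rightarrow>\<^sub>E ?B)" by blast
  moreover have "finite ((?B \<times> ?B \<rightarrow>\<^sub>E ?B) \<times> (carrier N \<rightarrow>\<^sub>E ?B))"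
    using fdD(2)[OF assms(1)] fdD(2)[OF assms(2)] by (intro finite_cartesian_product finite_PiE) auto
  ultimately show ?thesis by (rule finite_subset)
qed

lemma ext_table_additive_iso:
  assumes "fd_module K A M" "fd_module K A N" "(E, f, g) \<in> extensions K A M N"
    "(E', f', g') \<in> extensions K A M N" "ext_table M N (E, f, g) = ext_table M N (E', f', g')"
  obtains h where "bij_betw h (carrier E) (carrier E')"
    "\<And>x y. x \<in> carrier E \<Longrightarrow> y \<in> carrier E \<Longrightarrow> h (x \<oplus>\<^bsub>E\<^esub> y) = h x \<oplus>\<^bsub>E'\<^esub> h y"
    "\<And>n. n \<in> carrier N \<Longrightarrow> h (f n) = f' n" "\<And>x. x \<in> carrier E \<Longrightarrow> g' (h x) = g x"
proof -
  let ?B = "carrier N \<times> carrier M"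
  let ?c = "ext_coord (E, f, g)" and ?c' = "ext_coord (E', f', g')"
  note D = extensionsD[OF assms(3)] and D' = extensionsD[OF assms(4)]
  interpret E: lmod A E using fdD(1)[OF D(1)] .
  interpret E': lmod A E' using fdD(1)[OF D'(1)] .
  note b = ext_coord_bij[OF assms(1-3)] and b' = ext_coord_bij[OF assms(1,2,4)]
  define r where "r = inv_into ?B ?c"
  define r' where "r' = inv_into ?B ?c'"
  have r: "r x \<in> ?B" "?c (r x) = x" if "x \<in> carrier E" for x
    unfolding r_def using bij_betw_apply[OF bij_betw_inv_into[OF b(1)] that] bij_betw_inv_into_right[OF b(1) that] .
  have rc: "r (?c p) = p" if "p \<in> ?B" for p
    unfolding r_def using bij_betw_inv_into_left[OF b(1) that] .
  have r': "?c' (r' x) = x" if "x \<in> carrier E'" for x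
    unfolding r'_def using bij_betw_inv_into_right[OF b'(1) that] .
  have c: "?c p \<in> carrier E" "?c' p \<in> carrier E'" if "p \<in> ?B" for p
    using bij_betw_apply[OF b(1) that] bij_betw_apply[OF b'(1) that] .
  have t1: "r (?c p \<oplus>\<^bsub>E\<^esub> ?c q) = r' (?c' p \<oplus>\<^bsub>E'\<^esub> ?c' q)" if "p \<in> ?B" "q \<in> ?B" for p q
    using fun_cong[OF arg_cong[OF assms(5), of fst], of "(p, q)"] that
    by (simp add: ext_table_def Let_def r_def r'_def)
  have t2: "r (f n) = r' (f' n)" if "n \<in> carrier N" for n
    using fun_cong[OF arg_cong[OF assms(5), of snd], of n] that
    by (simp add: ext_table_def Let_def r_def r'_def)
  define h where "h x = ?c' (r x)" for x
  show ?thesis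
  proof (rule that[of h])
    show "bij_betw h (carrier E) (carrier E')"
      using bij_betw_trans[OF bij_betw_inv_into[OF b(1)] b'(1)] by (simp add: h_def[abs_def] r_def comp_def)
    show "h (x \<oplus>\<^bsub>E\<^esub> y) = h x \<oplus>\<^bsub>E'\<^esub> h y" if x: "x \<in> carrier E" and y: "y \<in> carrier E" for x y
      using t1[OF r(1)[OF x] r(1)[OF y]] r(2)[OF x] r(2)[OF y] r' c(2)[OF r(1)[OF x]] c(2)[OF r(1)[OF y]]
      by (simp add: h_def)
    show "h (f n) = f' n" if n: "n \<in> carrier N" for n
      using t2[OF n] r'[OF mod_homD(1)[OF D'(2) n]] by (simp add: h_def)
    show "g' (h x) = g x" if x: "x \<in> carrier E" for x
    proof -
      obtain n m where nm: "r x = (n, m)" "n \<in> carrier N" "m \<in> carrier M" using r(1)[OF x] by (rule SigmaE)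
      show ?thesis using b(2)[OF nm(2,3)] b'(2)[OF nm(2,3)] r(2)[OF x] nm(1) by (simp add: h_def)
    qed
  qed
qed

text \<open>The difference \<open>h(a x) - a h(x)\<close> vanishes in \<open>M\<close>, because \<open>h\<close> is compatible with the projections to \<open>M\<close>
  and these are linear; so it comes from \<open>N\<close>. It is zero for \<open>x\<close> in the image of \<open>N\<close>, so it depends
  on the image of \<open>x\<close> in \<open>M\<close> only.\<close>

lemma derivation_of_additive_iso:
  assumes "fd_module K A M" "fd_module K A N" "(E, f, g) \<in> extensions K A M N"
    "(E', f', g') \<in> extensions K A M N" "bij_betw h (carrier E) (carrier E')"
    "\<And>x y. x \<in> carrier E \<Longrightarrow> y \<in> carrier E \<Longrightarrow> h (x \<oplus>\<^bsub>E\<^esub> y) = h x \<oplus>\<^bsub>E'\<^esub> h y"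
    "\<And>n. n \<in> carrier N \<Longrightarrow> h (f n) = f' n" "\<And>x. x \<in> carrier E \<Longrightarrow> g' (h x) = g x"
  shows "\<exists>d\<in>derivations A M N. \<forall>a\<in>carrier A. \<forall>x\<in>carrier E.
    h (a \<odot>\<^bsub>E\<^esub> x) = f' (d (a, g x)) \<oplus>\<^bsub>E'\<^esub> a \<odot>\<^bsub>E'\<^esub> h x"
proof -
  note D = extensionsD[OF assms(3)] and D' = extensionsD[OF assms(4)]
  interpret M: lmod A M using fdD(1)[OF assms(1)] .
  interpret N: lmod A N using fdD(1)[OF assms(2)] .
  interpret E: lmod A E using fdD(1)[OF D(1)] .
  interpret E': lmod A E' using fdD(1)[OF D'(1)] .
  note f = mod_homD[OF D(2)] and g = mod_homD[OF D(3)] and f' = mod_homD[OF D'(2)] and g' = mod_homD[OF D'(3)]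
  note h = bij_betw_apply[OF assms(5)]
  have ex: "\<exists>n\<in>carrier N. h (a \<odot>\<^bsub>E\<^esub> x) = f' n \<oplus>\<^bsub>E'\<^esub> a \<odot>\<^bsub>E'\<^esub> h x"
    if a: "a \<in> carrier A" and x: "x \<in> carrier E" for a x
  proof -
    have c: "h (a \<odot>\<^bsub>E\<^esub> x) \<in> carrier E'" "a \<odot>\<^bsub>E'\<^esub> h x \<in> carrier E'"
      using h[OF E.smult_closed[OF a x]] E'.smult_closed[OF a h[OF x]] .
    have "g' (h (a \<odot>\<^bsub>E\<^esub> x)) = g' (a \<odot>\<^bsub>E'\<^esub> h x)"
      using assms(8)[OF E.smult_closed[OF a x]] assms(8)[OF x] g(3)[OF a x] g'(3)[OF a h[OF x]] by simp
    then have "g' (h (a \<odot>\<^bsub>E\<^esub> x) \<ominus>\<^bsub>E'\<^esub> a \<odot>\<^bsub>E'\<^esub> h x) = \<zero>\<^bsub>M\<^esub>"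
      using E'.hom_eq_iff[OF M.lmod_axioms D'(3) c] by simp
    then have "h (a \<odot>\<^bsub>E\<^esub> x) \<ominus>\<^bsub>E'\<^esub> a \<odot>\<^bsub>E'\<^esub> h x \<in> f' ` carrier N" unfolding D'(6) using c by simp
    then obtain n where n: "n \<in> carrier N" "h (a \<odot>\<^bsub>E\<^esub> x) \<ominus>\<^bsub>E'\<^esub> a \<odot>\<^bsub>E'\<^esub> h x = f' n" by blast
    have "(h (a \<odot>\<^bsub>E\<^esub> x) \<ominus>\<^bsub>E'\<^esub> a \<odot>\<^bsub>E'\<^esub> h x) \<oplus>\<^bsub>E'\<^esub> a \<odot>\<^bsub>E'\<^esub> h x = h (a \<odot>\<^bsub>E\<^esub> x)"
      using c by (simp add: a_minus_def E'.M.a_assoc E'.M.l_neg)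
    then show ?thesis using n(1) unfolding n(2) by (intro bexI[of _ n]) simp_all
  qed
  define \<delta> where "\<delta> a x = (SOME n. n \<in> carrier N \<and> h (a \<odot>\<^bsub>E\<^esub> x) = f' n \<oplus>\<^bsub>E'\<^esub> a \<odot>\<^bsub>E'\<^esub> h x)" for a x
  have \<delta>: "\<delta> a x \<in> carrier N" "h (a \<odot>\<^bsub>E\<^esub> x) = f' (\<delta> a x) \<oplus>\<^bsub>E'\<^esub> a \<odot>\<^bsub>E'\<^esub> h x"
    if a: "a \<in> carrier A" and x: "x \<in> carrier E" for a x
    using someI_ex[OF ex[OF a x, unfolded Bex_def]] unfolding \<delta>_def by simp_all
  have \<delta>_unique: "\<delta> a x = n"
    if a: "a \<in> carrier A" and x: "x \<in> carrier E" and n: "n \<in> carrier N"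
      and eq: "h (a \<odot>\<^bsub>E\<^esub> x) = f' n \<oplus>\<^bsub>E'\<^esub> a \<odot>\<^bsub>E'\<^esub> h x" for a x n
  proof -
    have "f' (\<delta> a x) = f' n"
      using \<delta>(2)[OF a x] eq f'(1)[OF \<delta>(1)[OF a x]] f'(1)[OF n] E'.smult_closed[OF a h[OF x]] by simp
    then show ?thesis using inj_onD[OF D'(4) _ \<delta>(1)[OF a x] n] by simp
  qed
  have \<delta>_add: "\<delta> a (x \<oplus>\<^bsub>E\<^esub> y) = \<delta> a x \<oplus>\<^bsub>N\<^esub> \<delta> a y"
    if a: "a \<in> carrier A" and x: "x \<in> carrier E" and y: "y \<in> carrier E" for a x y
  proof (rule \<delta>_unique[OF a E.M.a_closed[OF x y] N.M.a_closed[OF \<delta>(1)[OF a x] \<delta>(1)[OF a y]]])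
    note c = f'(1)[OF \<delta>(1)[OF a x]] f'(1)[OF \<delta>(1)[OF a y]] E'.smult_closed[OF a h[OF x]] E'.smult_closed[OF a h[OF y]]
    have "h (a \<odot>\<^bsub>E\<^esub> (x \<oplus>\<^bsub>E\<^esub> y)) = (f' (\<delta> a x) \<oplus>\<^bsub>E'\<^esub> a \<odot>\<^bsub>E'\<^esub> h x) \<oplus>\<^bsub>E'\<^esub> (f' (\<delta> a y) \<oplus>\<^bsub>E'\<^esub> a \<odot>\<^bsub>E'\<^esub> h y)"
      using E.smult_r_distr[OF a x y] assms(6)[OF E.smult_closed[OF a x] E.smult_closed[OF a y]] \<delta>(2)[OF a x] \<delta>(2)[OF a y] by simp
    also have "\<dots> = (f' (\<delta> a x) \<oplus>\<^bsub>E'\<^esub> f' (\<delta> a y)) \<oplus>\<^bsub>E'\<^esub> (a \<odot>\<^bsub>E'\<^esub> h x \<oplus>\<^bsub>E'\<^esub> a \<odot>\<^bsub>E'\<^esub> h y)"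
      using c by (simp add: E'.M.a_ac)
    finally show "h (a \<odot>\<^bsub>E\<^esub> (x \<oplus>\<^bsub>E\<^esub> y)) = f' (\<delta> a x \<oplus>\<^bsub>N\<^esub> \<delta> a y) \<oplus>\<^bsub>E'\<^esub> a \<odot>\<^bsub>E'\<^esub> h (x \<oplus>\<^bsub>E\<^esub> y)"
      using f'(2)[OF \<delta>(1)[OF a x] \<delta>(1)[OF a y]] assms(6)[OF x y] E'.smult_r_distr[OF a h[OF x] h[OF y]] by simp
  qed
  have \<delta>_f: "\<delta> a (f n) = \<zero>\<^bsub>N\<^esub>" if a: "a \<in> carrier A" and n: "n \<in> carrier N" for a n
  proof (rule \<delta>_unique[OF a f(1)[OF n] N.M.zero_closed])
    have "h (a \<odot>\<^bsub>E\<^esub> f n) = f' (a \<odot>\<^bsub>N\<^esub> n)" using f(3)[OF a n] assms(7)[OF N.smult_closed[OF a n]] by simp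
    then show "h (a \<odot>\<^bsub>E\<^esub> f n) = f' \<zero>\<^bsub>N\<^esub> \<oplus>\<^bsub>E'\<^esub> a \<odot>\<^bsub>E'\<^esub> h (f n)"
      using f'(3)[OF a n] assms(7)[OF n] N.hom_zero[OF E'.lmod_axioms D'(2)] E'.smult_closed[OF a f'(1)[OF n]] by simp
  qed
  have \<delta>_cong: "\<delta> a x = \<delta> a y"
    if a: "a \<in> carrier A" and x: "x \<in> carrier E" and y: "y \<in> carrier E" and eq: "g x = g y" for a x y
  proof -
    have "g (x \<ominus>\<^bsub>E\<^esub> y) = \<zero>\<^bsub>M\<^esub>" using E.hom_eq_iff[OF M.lmod_axioms D(3) x y] eq by simp
    then have "x \<ominus>\<^bsub>E\<^esub> y \<in> f ` carrier N" unfolding D(6) using x y by simp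
    then obtain n where n: "n \<in> carrier N" "x \<ominus>\<^bsub>E\<^esub> y = f n" by blast
    have "(x \<ominus>\<^bsub>E\<^esub> y) \<oplus>\<^bsub>E\<^esub> y = x" using x y by (simp add: a_minus_def E.M.a_assoc E.M.l_neg)
    then have "x = f n \<oplus>\<^bsub>E\<^esub> y" unfolding n(2) by (rule sym)
    then show ?thesis using \<delta>_add[OF a f(1)[OF n(1)] y] \<delta>_f[OF a n(1)] \<delta>(1)[OF a y] by simp
  qed
  define s where "s m = (SOME x. x \<in> carrier E \<and> g x = m)" for m
  have s: "s m \<in> carrier E" "g (s m) = m" if "m \<in> carrier M" for m
  proof -
    have "\<exists>x. x \<in> carrier E \<and> g x = m" using that[folded D(5)] by blast
    from someI_ex[OF this] show "s m \<in> carrier E" "g (s m) = m" by (simp_all add: s_def)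
  qed
  define d where "d = (\<lambda>p \<in> carrier A \<times> carrier M. \<delta> (fst p) (s (snd p)))"
  have dg: "d (a, g x) = \<delta> a x" if a: "a \<in> carrier A" and x: "x \<in> carrier E" for a x
    using \<delta>_cong[OF a s(1)[OF g(1)[OF x]] x s(2)[OF g(1)[OF x]]] a g(1)[OF x] by (simp add: d_def)
  have "d \<in> derivations A M N"
  proof (rule derivationsI)
    show "d \<in> extensional (carrier A \<times> carrier M)" by (simp add: d_def)
    fix a m assume a: "a \<in> carrier A" and "m \<in> carrier M"
    then obtain x where x: "x \<in> carrier E" "g x = m" using s by blast
    note da = dg[OF a x(1), unfolded x(2)]
    show "d (a, m) \<in> carrier N" unfolding da by (rule \<delta>(1)[OF a x(1)])
    {
      fix m' assume "m' \<in> carrier M"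
      then obtain y where y: "y \<in> carrier E" "g y = m'" using s by blast
      show "d (a, m \<oplus>\<^bsub>M\<^esub> m') = d (a, m) \<oplus>\<^bsub>N\<^esub> d (a, m')"
        using dg[OF a E.M.a_closed[OF x(1) y(1)]] g(2)[OF x(1) y(1)] x(2) y(2) \<delta>_add[OF a x(1) y(1)]
          da dg[OF a y(1), unfolded y(2)] by simp
    }
    {
      fix b assume b: "b \<in> carrier A"
      note db = dg[OF b x(1), unfolded x(2)]
      note c = f'(1)[OF \<delta>(1)[OF a x(1)]] f'(1)[OF \<delta>(1)[OF b x(1)]]
        E'.smult_closed[OF a h[OF x(1)]] E'.smult_closed[OF b h[OF x(1)]]
      have "\<delta> (a \<oplus>\<^bsub>A\<^esub> b) x = \<delta> a x \<oplus>\<^bsub>N\<^esub> \<delta> b x"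
      proof (rule \<delta>_unique[OF M.A.a_closed[OF a b] x(1) N.M.a_closed[OF \<delta>(1)[OF a x(1)] \<delta>(1)[OF b x(1)]]])
        have "h ((a \<oplus>\<^bsub>A\<^esub> b) \<odot>\<^bsub>E\<^esub> x) =
            (f' (\<delta> a x) \<oplus>\<^bsub>E'\<^esub> a \<odot>\<^bsub>E'\<^esub> h x) \<oplus>\<^bsub>E'\<^esub> (f' (\<delta> b x) \<oplus>\<^bsub>E'\<^esub> b \<odot>\<^bsub>E'\<^esub> h x)"
          using E.smult_l_distr[OF a b x(1)] assms(6)[OF E.smult_closed[OF a x(1)] E.smult_closed[OF b x(1)]]
            \<delta>(2)[OF a x(1)] \<delta>(2)[OF b x(1)] by simp
        also have "\<dots> = (f' (\<delta> a x) \<oplus>\<^bsub>E'\<^esub> f' (\<delta> b x)) \<oplus>\<^bsub>E'\<^esub> (a \<odot>\<^bsub>E'\<^esub> h x \<oplus>\<^bsub>E'\<^esub> b \<odot>\<^bsub>E'\<^esub> h x)"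
          using c by (simp add: E'.M.a_ac)
        finally show "h ((a \<oplus>\<^bsub>A\<^esub> b) \<odot>\<^bsub>E\<^esub> x) = f' (\<delta> a x \<oplus>\<^bsub>N\<^esub> \<delta> b x) \<oplus>\<^bsub>E'\<^esub> (a \<oplus>\<^bsub>A\<^esub> b) \<odot>\<^bsub>E'\<^esub> h x"
          using f'(2)[OF \<delta>(1)[OF a x(1)] \<delta>(1)[OF b x(1)]] E'.smult_l_distr[OF a b h[OF x(1)]] by simp
      qed
      then show "d (a \<oplus>\<^bsub>A\<^esub> b, m) = d (a, m) \<oplus>\<^bsub>N\<^esub> d (b, m)"
        using dg[OF M.A.a_closed[OF a b] x(1)] x(2) da db by simp
      note bx = E.smult_closed[OF b x(1)]
      have "\<delta> (a \<otimes>\<^bsub>A\<^esub> b) x = a \<odot>\<^bsub>N\<^esub> \<delta> b x \<oplus>\<^bsub>N\<^esub> \<delta> a (b \<odot>\<^bsub>E\<^esub> x)"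
      proof (rule \<delta>_unique[OF M.A.m_closed[OF a b] x(1) N.M.a_closed[OF N.smult_closed[OF a \<delta>(1)[OF b x(1)]] \<delta>(1)[OF a bx]]])
        have "h ((a \<otimes>\<^bsub>A\<^esub> b) \<odot>\<^bsub>E\<^esub> x) = f' (\<delta> a (b \<odot>\<^bsub>E\<^esub> x)) \<oplus>\<^bsub>E'\<^esub> a \<odot>\<^bsub>E'\<^esub> (f' (\<delta> b x) \<oplus>\<^bsub>E'\<^esub> b \<odot>\<^bsub>E'\<^esub> h x)"
          using E.smult_assoc[OF a b x(1)] \<delta>(2)[OF a bx] \<delta>(2)[OF b x(1)] by simp
        also have "\<dots> = f' (\<delta> a (b \<odot>\<^bsub>E\<^esub> x)) \<oplus>\<^bsub>E'\<^esub> (f' (a \<odot>\<^bsub>N\<^esub> \<delta> b x) \<oplus>\<^bsub>E'\<^esub> (a \<otimes>\<^bsub>A\<^esub> b) \<odot>\<^bsub>E'\<^esub> h x)"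
          using E'.smult_r_distr[OF a c(2,4)] f'(3)[OF a \<delta>(1)[OF b x(1)]] E'.smult_assoc[OF a b h[OF x(1)]] by simp
        also have "\<dots> = (f' (a \<odot>\<^bsub>N\<^esub> \<delta> b x) \<oplus>\<^bsub>E'\<^esub> f' (\<delta> a (b \<odot>\<^bsub>E\<^esub> x))) \<oplus>\<^bsub>E'\<^esub> (a \<otimes>\<^bsub>A\<^esub> b) \<odot>\<^bsub>E'\<^esub> h x"
          using f'(1)[OF N.smult_closed[OF a \<delta>(1)[OF b x(1)]]] f'(1)[OF \<delta>(1)[OF a bx]]
            E'.smult_closed[OF M.A.m_closed[OF a b] h[OF x(1)]] by (simp add: E'.M.a_ac)
        finally show "h ((a \<otimes>\<^bsub>A\<^esub> b) \<odot>\<^bsub>E\<^esub> x) =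
            f' (a \<odot>\<^bsub>N\<^esub> \<delta> b x \<oplus>\<^bsub>N\<^esub> \<delta> a (b \<odot>\<^bsub>E\<^esub> x)) \<oplus>\<^bsub>E'\<^esub> (a \<otimes>\<^bsub>A\<^esub> b) \<odot>\<^bsub>E'\<^esub> h x"
          using f'(2)[OF N.smult_closed[OF a \<delta>(1)[OF b x(1)]] \<delta>(1)[OF a bx]] by simp
      qed
      then show "d (a \<otimes>\<^bsub>A\<^esub> b, m) = a \<odot>\<^bsub>N\<^esub> d (b, m) \<oplus>\<^bsub>N\<^esub> d (a, b \<odot>\<^bsub>M\<^esub> m)"
        using dg[OF M.A.m_closed[OF a b] x(1)] dg[OF a bx] g(3)[OF b x(1)] x(2) db by simp
    }
  qed
  moreover have "\<forall>a\<in>carrier A. \<forall>x\<in>carrier E. h (a \<odot>\<^bsub>E\<^esub> x) = f' (d (a, g x)) \<oplus>\<^bsub>E'\<^esub> a \<odot>\<^bsub>E'\<^esub> h x"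
    using \<delta>(2) dg by simp
  ultimately show ?thesis by (intro bexI[of _ d])
qed

text \<open>If the same function \<open>D\<close> describes both actions after transport to \<open>E'\<close>, then \<open>k\<inverse> h\<close> is linear.\<close>

lemma isomorphic_of_same_derivation:
  assumes "lmod A E" "lmod A F" "lmod A E'"
    "bij_betw h (carrier E) (carrier E')" "bij_betw k (carrier F) (carrier E')"
    "\<And>x y. x \<in> carrier E \<Longrightarrow> y \<in> carrier E \<Longrightarrow> h (x \<oplus>\<^bsub>E\<^esub> y) = h x \<oplus>\<^bsub>E'\<^esub> h y"
    "\<And>x y. x \<in> carrier F \<Longrightarrow> y \<in> carrier F \<Longrightarrow> k (x \<oplus>\<^bsub>F\<^esub> y) = k x \<oplus>\<^bsub>E'\<^esub> k y"
    "\<And>a x. a \<in> carrier A \<Longrightarrow> x \<in> carrier E \<Longrightarrow> h (a \<odot>\<^bsub>E\<^esub> x) = D a (h x)"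
    "\<And>a x. a \<in> carrier A \<Longrightarrow> x \<in> carrier F \<Longrightarrow> k (a \<odot>\<^bsub>F\<^esub> x) = D a (k x)"
  shows "mod_isomorphic A E F"
proof -
  interpret E: lmod A E by fact
  interpret F: lmod A F by fact
  define l where "l x = inv_into (carrier F) k (h x)" for x
  have b: "bij_betw l (carrier E) (carrier F)"
    using bij_betw_trans[OF assms(4) bij_betw_inv_into[OF assms(5)]] by (simp add: l_def[abs_def] comp_def)
  note lc = bij_betw_apply[OF b]
  have kl: "k (l x) = h x" if "x \<in> carrier E" for x
    unfolding l_def by (rule bij_betw_inv_into_right[OF assms(5) bij_betw_apply[OF assms(4) that]])
  have inj: "y = z" if "y \<in> carrier F" "z \<in> carrier F" "k y = k z" for y z
    using inj_onD[OF bij_betw_imp_inj_on[OF assms(5)] that(3,1,2)] .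
  have "l \<in> mod_hom A E F"
  proof (rule mod_homI)
    show "l x \<in> carrier F" if "x \<in> carrier E" for x using lc[OF that] .
    show "l (x \<oplus>\<^bsub>E\<^esub> y) = l x \<oplus>\<^bsub>F\<^esub> l y" if x: "x \<in> carrier E" and y: "y \<in> carrier E" for x y
      by (rule inj) (simp_all add: lc x y kl assms(6,7))
    show "l (a \<odot>\<^bsub>E\<^esub> x) = a \<odot>\<^bsub>F\<^esub> l x" if a: "a \<in> carrier A" and x: "x \<in> carrier E" for a x
      by (rule inj) (simp_all add: lc a x kl assms(8,9) E.smult_closed F.smult_closed)
  qed
  then show ?thesis using b by (rule mod_isomorphicI)
qed

lemma iso_class_eq:
  assumes "fd_module K A M" "fd_module K A N" "mod_isomorphic A M N"
  shows "iso_class K A M = iso_class K A N"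
proof -
  note s = mod_isomorphic_sym[OF fdD(1)[OF assms(1)] fdD(1)[OF assms(2)] assms(3)]
  show ?thesis unfolding iso_class_def
    using mod_isomorphic_trans[OF assms(3)] mod_isomorphic_trans[OF s] by (intro Collect_cong conj_cong iffI refl)
qed

text \<open>Finitely many tables are possible, and among the extensions with a fixed table the action
  is determined by a derivation relative to one of them.\<close>

theorem finite_middle_terms:
  assumes "finitary K A" "fd_module K A M" "fd_module K A N"
  shows "finite ((\<lambda>e. iso_class K A (fst e)) ` extensions K A M N)"
proof (rule finite_image_by_invariant[OF finite_ext_tables[OF assms(2,3)]])
  fix e' assume e': "e' \<in> extensions K A M N"
  obtain E' f' g' where E': "e' = (E', f', g')" by (cases e')
  note D' = extensionsD[OF e'[unfolded E']]
  define R where "R e d \<longleftrightarrow> (\<exists>h. bij_betw h (carrier (fst e)) (carrier E') \<and>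
    (\<forall>x\<in>carrier (fst e). \<forall>y\<in>carrier (fst e). h (x \<oplus>\<^bsub>fst e\<^esub> y) = h x \<oplus>\<^bsub>E'\<^esub> h y) \<and>
    (\<forall>a\<in>carrier A. \<forall>x\<in>carrier (fst e). h (a \<odot>\<^bsub>fst e\<^esub> x) = f' (d (a, g' (h x))) \<oplus>\<^bsub>E'\<^esub> a \<odot>\<^bsub>E'\<^esub> h x))"
    for e :: "'a extension" and d
  show "finite ((\<lambda>e. iso_class K A (fst e)) ` {e \<in> extensions K A M N. ext_table M N e = ext_table M N e'})"
  proof (rule finite_image_of_determining[OF finite_derivations[OF assms], of _ R])
    fix e assume "e \<in> {e \<in> extensions K A M N. ext_table M N e = ext_table M N e'}"
    then have e: "e \<in> extensions K A M N" "ext_table M N e = ext_table M N e'" by simp_all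
    obtain E f g where E: "e = (E, f, g)" by (cases e)
    obtain h where h: "bij_betw h (carrier E) (carrier E')"
      "\<And>x y. x \<in> carrier E \<Longrightarrow> y \<in> carrier E \<Longrightarrow> h (x \<oplus>\<^bsub>E\<^esub> y) = h x \<oplus>\<^bsub>E'\<^esub> h y"
      "\<And>n. n \<in> carrier N \<Longrightarrow> h (f n) = f' n" "\<And>x. x \<in> carrier E \<Longrightarrow> g' (h x) = g x"
      by (rule ext_table_additive_iso[OF assms(2,3) e(1)[unfolded E] e'[unfolded E'] e(2)[unfolded E E']])
        (rule that)
    obtain d where d: "d \<in> derivations A M N" "\<forall>a\<in>carrier A. \<forall>x\<in>carrier E.
      h (a \<odot>\<^bsub>E\<^esub> x) = f' (d (a, g x)) \<oplus>\<^bsub>E'\<^esub> a \<odot>\<^bsub>E'\<^esub> h x"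
      using derivation_of_additive_iso[OF assms(2,3) e(1)[unfolded E] e'[unfolded E'] h] by (rule bexE)
    have "R e d" unfolding R_def E fst_conv
      by (rule exI[of _ h]) (simp add: h(1,2,4) d(2))
    then show "\<exists>d\<in>derivations A M N. R e d" using d(1) by (rule bexI)
  next
    fix e1 e2 d assume "e1 \<in> {e \<in> extensions K A M N. ext_table M N e = ext_table M N e'}"
      "e2 \<in> {e \<in> extensions K A M N. ext_table M N e = ext_table M N e'}" and R: "R e1 d" "R e2 d"
    then have e: "e1 \<in> extensions K A M N" "e2 \<in> extensions K A M N" by simp_all
    have fd: "fd_module K A (fst e1)" "fd_module K A (fst e2)"
      using e extensionsD(1)[of "fst e1" "fst (snd e1)" "snd (snd e1)"]
        extensionsD(1)[of "fst e2" "fst (snd e2)" "snd (snd e2)"] by simp_all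
    obtain h where h: "bij_betw h (carrier (fst e1)) (carrier E')"
      "\<forall>x\<in>carrier (fst e1). \<forall>y\<in>carrier (fst e1). h (x \<oplus>\<^bsub>fst e1\<^esub> y) = h x \<oplus>\<^bsub>E'\<^esub> h y"
      "\<forall>a\<in>carrier A. \<forall>x\<in>carrier (fst e1). h (a \<odot>\<^bsub>fst e1\<^esub> x) = f' (d (a, g' (h x))) \<oplus>\<^bsub>E'\<^esub> a \<odot>\<^bsub>E'\<^esub> h x"
      using R(1) unfolding R_def by (elim exE conjE)
    obtain k where k: "bij_betw k (carrier (fst e2)) (carrier E')"
      "\<forall>x\<in>carrier (fst e2). \<forall>y\<in>carrier (fst e2). k (x \<oplus>\<^bsub>fst e2\<^esub> y) = k x \<oplus>\<^bsub>E'\<^esub> k y"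
      "\<forall>a\<in>carrier A. \<forall>x\<in>carrier (fst e2). k (a \<odot>\<^bsub>fst e2\<^esub> x) = f' (d (a, g' (k x))) \<oplus>\<^bsub>E'\<^esub> a \<odot>\<^bsub>E'\<^esub> k x"
      using R(2) unfolding R_def by (elim exE conjE)
    have "mod_isomorphic A (fst e1) (fst e2)"
      by (rule isomorphic_of_same_derivation[OF fdD(1)[OF fd(1)] fdD(1)[OF fd(2)] fdD(1)[OF D'(1)] h(1) k(1),
            of "\<lambda>a z. f' (d (a, g' z)) \<oplus>\<^bsub>E'\<^esub> a \<odot>\<^bsub>E'\<^esub> z"]) (simp_all add: h(2,3) k(2,3))
    then show "iso_class K A (fst e1) = iso_class K A (fst e2)" by (rule iso_class_eq[OF fd])
  qed
qed

end


section \<open>Hall numbers\<close>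

text \<open>The correspondence between the submodules of \<open>M / V\<close> and the submodules of \<open>M\<close> above \<open>V\<close>.\<close>

lemma (in lmod) quotient_map_submodule_corr:
  assumes "lmod A Q" "submodule V A M" "quotient_map A M Q V q"
  shows "submodule U A M \<Longrightarrow> V \<subseteq> U \<Longrightarrow> {x \<in> carrier M. q x \<in> q ` U} = U"
    "submodule W A Q \<Longrightarrow> q ` {x \<in> carrier M. q x \<in> W} = W"
    "submodule W A Q \<Longrightarrow> V \<subseteq> {x \<in> carrier M. q x \<in> W}"
proof -
  interpret Q: lmod A Q by fact
  note q = quotient_mapD[OF assms(3)]
  show "{x \<in> carrier M. q x \<in> q ` U} = U" if U: "submodule U A M" "V \<subseteq> U"
  proof (intro equalityI subsetI)
    fix x assume "x \<in> {x \<in> carrier M. q x \<in> q ` U}"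
    then have x: "x \<in> carrier M" "q x \<in> q ` U" by simp_all
    then obtain u where u: "u \<in> U" "q x = q u" by blast
    have uc: "u \<in> carrier M" using submoduleD(3)[OF U(1) u(1)] .
    have "q (x \<ominus>\<^bsub>M\<^esub> u) = \<zero>\<^bsub>Q\<^esub>" using hom_eq_iff[OF assms(1) q(1) x(1) uc] u(2) by simp
    then have "x \<ominus>\<^bsub>M\<^esub> u \<in> V" using q(3) x(1) uc by simp
    then have "(x \<ominus>\<^bsub>M\<^esub> u) \<oplus>\<^bsub>M\<^esub> u \<in> U" using U submoduleD(4)[OF U(1)] u(1) by blast
    moreover have "(x \<ominus>\<^bsub>M\<^esub> u) \<oplus>\<^bsub>M\<^esub> u = x" using x uc by (simp add: a_minus_def M.a_assoc M.l_neg)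
    ultimately show "x \<in> U" by simp
  qed (use submoduleD(3)[OF U(1)] in auto)
  show "q ` {x \<in> carrier M. q x \<in> W} = W" if W: "submodule W A Q"
  proof -
    have "W \<subseteq> q ` carrier M" using Q.submoduleD(1)[OF W] q(2) by simp
    then show ?thesis by auto
  qed
  show "V \<subseteq> {x \<in> carrier M. q x \<in> W}" if W: "submodule W A Q"
  proof
    fix x assume x: "x \<in> V"
    have xc: "x \<in> carrier M" using submoduleD(3)[OF assms(2) x] .
    show "x \<in> {x \<in> carrier M. q x \<in> W}" using q(3)[OF xc] x xc Q.submoduleD(2)[OF W] by simp
  qed
qed

text \<open>The third isomorphism theorem.\<close>

lemma (in lmod) quotient_of_quotient_iff:
  assumes "lmod A Q" "lmod A N" "submodule V A M" "quotient_map A M Q V q" "submodule U A M" "V \<subseteq> U"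
  shows "(\<exists>g. quotient_map A Q N (q ` U) g) \<longleftrightarrow> (\<exists>g. quotient_map A M N U g)"
proof
  note q = quotient_mapD[OF assms(4)]
  note corr = quotient_map_submodule_corr(1)[OF assms(1,3,4,5,6)]
  {
    assume "\<exists>g. quotient_map A Q N (q ` U) g"
    then obtain g where g: "quotient_map A Q N (q ` U) g" by (rule exE)
    note g' = quotient_mapD[OF g]
    have "quotient_map A M N U (\<lambda>x. g (q x))" unfolding quotient_map_def
    proof (intro conjI ballI)
      show "(\<lambda>x. g (q x)) \<in> mod_hom A M N" by (rule mod_hom_comp[OF q(1) g'(1)])
      have "(\<lambda>x. g (q x)) ` carrier M = g ` q ` carrier M" by (simp add: image_image)
      then show "(\<lambda>x. g (q x)) ` carrier M = carrier N" using q(2) g'(2) by simp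
      fix x assume x: "x \<in> carrier M"
      show "g (q x) = \<zero>\<^bsub>N\<^esub> \<longleftrightarrow> x \<in> U" using g'(3)[OF mod_homD(1)[OF q(1) x]] corr x by auto
    qed
    then show "\<exists>g. quotient_map A M N U g" by (rule exI[of _ "\<lambda>x. g (q x)"])
  next
    assume "\<exists>g. quotient_map A M N U g"
    then obtain g where g: "quotient_map A M N U g" by (rule exE)
    note g' = quotient_mapD[OF g]
    have ker: "g x = \<zero>\<^bsub>N\<^esub>" if "x \<in> carrier M" "q x = \<zero>\<^bsub>Q\<^esub>" for x
      using that q(3)[OF that(1)] g'(3)[OF that(1)] assms(6) by auto
    obtain k where k: "k \<in> mod_hom A Q N" "\<And>x. x \<in> carrier M \<Longrightarrow> k (q x) = g x"
      by (rule hom_factor[OF assms(1,2) q(1,2) g'(1) ker]) (assumption | rule that)+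
    have "quotient_map A Q N (q ` U) k" unfolding quotient_map_def
    proof (intro conjI ballI k(1))
      have "k ` q ` carrier M = g ` carrier M" unfolding image_image using k(2) by (intro image_cong) auto
      then show "k ` carrier Q = carrier N" using q(2) g'(2) by simp
      fix y assume "y \<in> carrier Q"
      then obtain x where x: "x \<in> carrier M" "y = q x" unfolding q(2)[symmetric] by (rule imageE) simp
      have "k y = \<zero>\<^bsub>N\<^esub> \<longleftrightarrow> x \<in> U" using k(2)[OF x(1)] g'(3)[OF x(1)] x(2) by simp
      then show "k y = \<zero>\<^bsub>N\<^esub> \<longleftrightarrow> y \<in> q ` U" using corr x by auto
    qed
    then show "\<exists>g. quotient_map A Q N (q ` U) g" by (rule exI[of _ k])
  }
qed

lemma (in lmod) sub_of_quotient_iff: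
  assumes "lmod A Q" "lmod A N" "submodule V A M" "quotient_map A M Q V q" "submodule U A M" "V \<subseteq> U"
  shows "mod_isomorphic A (sub_mod Q (q ` U)) N \<longleftrightarrow> (\<exists>g. quotient_map A (sub_mod M U) N V g)"
proof
  interpret Q: lmod A Q by fact
  interpret U: lmod A "sub_mod M U" by (rule lmod_sub_mod[OF assms(5)])
  note q = quotient_mapD[OF assms(4)]
  note qU = submodule_image[OF assms(1) q(1) assms(5)]
  interpret qU: lmod A "sub_mod Q (q ` U)" by (rule Q.lmod_sub_mod[OF qU])
  have qm: "quotient_map A (sub_mod M U) (sub_mod Q (q ` U)) V q" unfolding quotient_map_def
  proof (intro conjI ballI)
    show "q \<in> mod_hom A (sub_mod M U) (sub_mod Q (q ` U))"
      by (rule mod_hom_into_sub[OF mod_hom_restrict[OF q(1) submoduleD(1)[OF assms(5)]]]) simp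
    show "q x = \<zero>\<^bsub>sub_mod Q (q ` U)\<^esub> \<longleftrightarrow> x \<in> V" if "x \<in> carrier (sub_mod M U)" for x
      using q(3)[of x] submoduleD(3)[OF assms(5)] that by simp
  qed simp
  {
    assume "mod_isomorphic A (sub_mod Q (q ` U)) N"
    then obtain k where k: "k \<in> mod_hom A (sub_mod Q (q ` U)) N" "bij_betw k (carrier (sub_mod Q (q ` U))) (carrier N)"
      by (rule mod_isomorphicE)
    from quotient_map_comp_iso[OF qU.lmod_axioms assms(2) qm k]
    show "\<exists>g. quotient_map A (sub_mod M U) N V g" by (rule exI[of _ "\<lambda>x. k (q x)"])
  next
    assume "\<exists>g. quotient_map A (sub_mod M U) N V g"
    then obtain g where g: "quotient_map A (sub_mod M U) N V g" by (rule exE)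
    obtain k where "k \<in> mod_hom A (sub_mod Q (q ` U)) N" "bij_betw k (carrier (sub_mod Q (q ` U))) (carrier N)"
      by (rule U.quotient_maps_isomorphic[OF qU.lmod_axioms assms(2) qm g])
    then show "mod_isomorphic A (sub_mod Q (q ` U)) N" by (rule mod_isomorphicI)
  }
qed

definition hall_submodules :: "('k, 'a) module \<Rightarrow> 'a nmod \<Rightarrow> 'a nmod \<Rightarrow> 'a nmod \<Rightarrow> nat set set" where
  "hall_submodules A X M N = {U. submodule U A X \<and> mod_isomorphic A (sub_mod X U) N \<and>
     (\<exists>g. quotient_map A X M U g)}"

lemma hall_number_eq:
  assumes "lmod A X" "lmod A M"
  shows "hall_number A X M N = card (hall_submodules A X M N)"
proof -
  interpret X: lmod A X by fact
  have "{U. submodule U A X \<and> mod_isomorphic A (sub_mod X U) N \<and> mod_isomorphic A (quot_mod X U) M}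
      = hall_submodules A X M N"
    unfolding hall_submodules_def
    by (intro Collect_cong conj_cong refl X.isomorphic_quot_mod_iff assms)
  then show ?thesis unfolding hall_number_def by simp
qed

text \<open>Under the correspondence of submodules, a submodule of \<open>X / V\<close> with prescribed isomorphism
  types becomes a submodule \<open>U\<close> of \<open>X\<close> above \<open>V\<close> with prescribed \<open>U / V\<close> and \<open>X / U\<close>. With \<open>V = 0\<close> this
  also gives the invariance of Hall numbers under isomorphisms of \<open>X\<close>.\<close>

lemma hall_submodules_of_quotient:
  assumes "lmod A X" "lmod A Q" "lmod A M" "lmod A N" "submodule V A X" "quotient_map A X Q V q"
  shows "card (hall_submodules A Q M N) = card {U. submodule U A X \<and> V \<subseteq> U \<and>
    (\<exists>g. quotient_map A (sub_mod X U) N V g) \<and> (\<exists>g. quotient_map A X M U g)}" (is "_ = card ?S")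
proof -
  interpret X: lmod A X by fact
  interpret Q: lmod A Q by fact
  note q = quotient_mapD[OF assms(6)]
  note corr = X.quotient_map_submodule_corr[OF assms(2,5,6)]
  note iff = X.sub_of_quotient_iff[OF assms(2,4,5,6)] X.quotient_of_quotient_iff[OF assms(2,3,5,6)]
  have "bij_betw (image q) ?S (hall_submodules A Q M N)"
  proof (rule bij_betw_byWitness[where f' = "\<lambda>W. {x \<in> carrier X. q x \<in> W}"])
    show "\<forall>U\<in>?S. {x \<in> carrier X. q x \<in> q ` U} = U" using corr(1) by simp
    show "\<forall>W\<in>hall_submodules A Q M N. q ` {x \<in> carrier X. q x \<in> W} = W"
      using corr(2) by (simp add: hall_submodules_def)
    show "image q ` ?S \<subseteq> hall_submodules A Q M N"
    proof (rule image_subsetI)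
      fix U assume "U \<in> ?S"
      then have U: "submodule U A X" "V \<subseteq> U" "\<exists>g. quotient_map A (sub_mod X U) N V g" "\<exists>g. quotient_map A X M U g"
        by simp_all
      show "q ` U \<in> hall_submodules A Q M N" unfolding hall_submodules_def
        using X.submodule_image[OF assms(2) q(1) U(1)] iffD2[OF iff(1)[OF U(1,2)] U(3)] iffD2[OF iff(2)[OF U(1,2)] U(4)]
        by (intro CollectI conjI)
    qed
    show "(\<lambda>W. {x \<in> carrier X. q x \<in> W}) ` hall_submodules A Q M N \<subseteq> ?S"
    proof (rule image_subsetI)
      fix W assume "W \<in> hall_submodules A Q M N"
      then have W: "submodule W A Q" "mod_isomorphic A (sub_mod Q W) N" "\<exists>g. quotient_map A Q M W g"
        by (simp_all add: hall_submodules_def)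
      let ?U = "{x \<in> carrier X. q x \<in> W}"
      note s = X.submodule_vimage[OF assms(2) q(1) W(1)] corr(3)[OF W(1)]
      note i = iff(1)[OF s, unfolded corr(2)[OF W(1)]] iff(2)[OF s, unfolded corr(2)[OF W(1)]]
      show "?U \<in> ?S" using s iffD1[OF i(1) W(2)] iffD1[OF i(2) W(3)] by (intro CollectI conjI)
    qed
  qed
  then show ?thesis by (rule bij_betw_same_card[symmetric])
qed

lemma quotient_map_zero_iff:
  assumes "lmod A X" "lmod A N"
  shows "(\<exists>g. quotient_map A X N {\<zero>\<^bsub>X\<^esub>} g) \<longleftrightarrow> mod_isomorphic A X N"
proof
  interpret X: lmod A X by fact
  {
    assume "\<exists>g. quotient_map A X N {\<zero>\<^bsub>X\<^esub>} g"
    then obtain g where "quotient_map A X N {\<zero>\<^bsub>X\<^esub>} g" by (rule exE)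
    note g = quotient_mapD[OF this]
    have "inj_on g (carrier X)" unfolding X.hom_inj_on_iff[OF assms(2) g(1)] using g(3) by simp
    then show "mod_isomorphic A X N" by (intro mod_isomorphicI[OF g(1)]) (simp add: bij_betw_def g(2))
  next
    assume "mod_isomorphic A X N"
    then obtain h where h: "h \<in> mod_hom A X N" "bij_betw h (carrier X) (carrier N)" by (rule mod_isomorphicE)
    have "quotient_map A X N {\<zero>\<^bsub>X\<^esub>} h"
      using h X.hom_inj_on_iff[OF assms(2) h(1)] X.hom_zero[OF assms(2) h(1)]
      unfolding quotient_map_def bij_betw_def by auto
    then show "\<exists>g. quotient_map A X N {\<zero>\<^bsub>X\<^esub>} g" by (rule exI[of _ h])
  }
qed

lemma hall_submodules_cong:
  assumes "lmod A X" "lmod A X'" "lmod A M" "lmod A N" "mod_isomorphic A X X'"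
  shows "card (hall_submodules A X' M N) = card (hall_submodules A X M N)"
proof -
  interpret X: lmod A X by fact
  obtain q where q: "quotient_map A X X' {\<zero>\<^bsub>X\<^esub>} q"
    using quotient_map_zero_iff[OF assms(1,2)] assms(5) by auto
  have "{U. submodule U A X \<and> {\<zero>\<^bsub>X\<^esub>} \<subseteq> U \<and> (\<exists>g. quotient_map A (sub_mod X U) N {\<zero>\<^bsub>X\<^esub>} g) \<and>
      (\<exists>g. quotient_map A X M U g)} = hall_submodules A X M N"
    unfolding hall_submodules_def
  proof (rule Collect_cong)
    fix U
    have "submodule U A X \<Longrightarrow> (\<exists>g. quotient_map A (sub_mod X U) N {\<zero>\<^bsub>X\<^esub>} g) \<longleftrightarrow> mod_isomorphic A (sub_mod X U) N"
      using quotient_map_zero_iff[OF X.lmod_sub_mod assms(4), of U] by simp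
    then show "(submodule U A X \<and> {\<zero>\<^bsub>X\<^esub>} \<subseteq> U \<and> (\<exists>g. quotient_map A (sub_mod X U) N {\<zero>\<^bsub>X\<^esub>} g) \<and>
      (\<exists>g. quotient_map A X M U g)) \<longleftrightarrow>
      (submodule U A X \<and> mod_isomorphic A (sub_mod X U) N \<and> (\<exists>g. quotient_map A X M U g))"
      using X.submoduleD(2)[of U] by auto
  qed
  then show ?thesis
    using hall_submodules_of_quotient[OF assms(1-4) X.submodule_zero q] by simp
qed

context finite_field_algebra
begin

lemma iso_class_eq_iff:
  assumes "fd_module K A M" "fd_module K A N"
  shows "iso_class K A M = iso_class K A N \<longleftrightarrow> mod_isomorphic A M N"
proof
  assume "iso_class K A M = iso_class K A N"
  moreover have "N \<in> iso_class K A N" using assms(2) mod_isomorphic_refl by (simp add: iso_class_def)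
  ultimately show "mod_isomorphic A M N" unfolding iso_class_def by auto
qed (rule iso_class_eq[OF assms])

lemma iso_class_in: "fd_module K A M \<Longrightarrow> iso_class K A M \<in> iso_classes K A"
  unfolding iso_classes_def by auto

lemma class_rep:
  assumes "X \<in> iso_classes K A"
  shows "fd_module K A (class_rep X)" "iso_class K A (class_rep X) = X"
proof -
  obtain M where M: "fd_module K A M" "X = iso_class K A M" using assms unfolding iso_classes_def by auto
  have "M \<in> X" using M mod_isomorphic_refl by (simp add: iso_class_def)
  then have "class_rep X \<in> X" unfolding class_rep_def by (rule someI)
  then have r: "fd_module K A (class_rep X)" "mod_isomorphic A M (class_rep X)"
    unfolding M(2) iso_class_def by simp_all
  show "fd_module K A (class_rep X)" by (rule r(1))
  show "iso_class K A (class_rep X) = X" using iso_class_eq[OF M(1) r] M(2) by simp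
qed

lemma class_rep_iso:
  assumes "fd_module K A M" shows "mod_isomorphic A M (class_rep (iso_class K A M))"
  using iso_class_eq_iff[OF assms class_rep(1)[OF iso_class_in[OF assms]]]
    class_rep(2)[OF iso_class_in[OF assms]] by simp

text \<open>The structure constants of the Hall algebra, as functions of isomorphism classes.\<close>

definition hall_count :: "'a nmod set \<Rightarrow> 'a nmod set \<Rightarrow> 'a nmod set \<Rightarrow> nat" where
  "hall_count X M N = card (hall_submodules A (class_rep X) (class_rep M) (class_rep N))"

lemma hall_submodules_class:
  assumes "fd_module K A X" "M \<in> iso_classes K A" "N \<in> iso_classes K A"
  shows "card (hall_submodules A X (class_rep M) (class_rep N)) = hall_count (iso_class K A X) M N"
  unfolding hall_count_def
  by (rule hall_submodules_cong[OF fdD(1)[OF assms(1)] fdD(1)[OF class_rep(1)[OF iso_class_in[OF assms(1)]]]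
        fdD(1)[OF class_rep(1)[OF assms(2)]] fdD(1)[OF class_rep(1)[OF assms(3)]] class_rep_iso[OF assms(1)], symmetric])

lemma finite_submodules:
  assumes "fd_module K A X" shows "finite {U. submodule U A X \<and> P U}"
proof (rule finite_subset)
  interpret X: lmod A X using fdD(1)[OF assms] .
  show "{U. submodule U A X \<and> P U} \<subseteq> Pow (carrier X)" using X.submoduleD(1) by blast
  show "finite (Pow (carrier X))" using fdD(2)[OF assms] by simp
qed

lemma hall_submodules_nonempty:
  assumes "hall_count X M N \<noteq> 0"
  obtains U where "U \<in> hall_submodules A (class_rep X) (class_rep M) (class_rep N)"
  using assms unfolding hall_count_def by (metis card.empty equals0I)

text \<open>A quotient of \<open>X\<close> is determined up to isomorphism by its kernel, one of finitely many
  subsets.\<close>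

lemma finite_quotient_classes:
  assumes "X \<in> iso_classes K A"
  shows "finite {L \<in> iso_classes K A. \<exists>N. hall_count X L N \<noteq> 0}" (is "finite ?S")
proof -
  let ?X = "class_rep X"
  have X: "fd_module K A ?X" by (rule class_rep(1)[OF assms])
  interpret X: lmod A ?X using fdD(1)[OF X] .
  have "finite ((\<lambda>L. L) ` ?S)"
  proof (rule finite_image_of_determining[of "{U. submodule U A ?X \<and> True}" ?S "\<lambda>L U. \<exists>g. quotient_map A ?X (class_rep L) U g"])
    show "finite {U. submodule U A ?X \<and> True}" by (rule finite_submodules[OF X])
    fix L assume "L \<in> ?S"
    then obtain N where "hall_count X L N \<noteq> 0" by auto
    then obtain U where "U \<in> hall_submodules A ?X (class_rep L) (class_rep N)" by (rule hall_submodules_nonempty)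
    then show "\<exists>U\<in>{U. submodule U A ?X \<and> True}. \<exists>g. quotient_map A ?X (class_rep L) U g"
      by (intro bexI[of _ U]) (simp_all add: hall_submodules_def)
  next
    fix L L' U assume "L \<in> ?S" "L' \<in> ?S" and q: "\<exists>g. quotient_map A ?X (class_rep L) U g" "\<exists>g. quotient_map A ?X (class_rep L') U g"
    then have L: "L \<in> iso_classes K A" "L' \<in> iso_classes K A" by simp_all
    obtain g g' where g: "quotient_map A ?X (class_rep L) U g" "quotient_map A ?X (class_rep L') U g'"
      using q by (elim exE)
    obtain k where "k \<in> mod_hom A (class_rep L) (class_rep L')" "bij_betw k (carrier (class_rep L)) (carrier (class_rep L'))"
      by (rule X.quotient_maps_isomorphic[OF fdD(1)[OF class_rep(1)[OF L(1)]] fdD(1)[OF class_rep(1)[OF L(2)]] g])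
    then have "mod_isomorphic A (class_rep L) (class_rep L')" by (rule mod_isomorphicI)
    then show "L = L'" using iso_class_eq[OF class_rep(1)[OF L(1)] class_rep(1)[OF L(2)]] class_rep(2)[OF L(1)] class_rep(2)[OF L(2)] by simp
  qed
  then show ?thesis by simp
qed

lemma finite_submodule_classes:
  assumes "X \<in> iso_classes K A"
  shows "finite {L \<in> iso_classes K A. \<exists>M. hall_count X M L \<noteq> 0}" (is "finite ?S")
proof -
  let ?X = "class_rep X"
  have X: "fd_module K A ?X" by (rule class_rep(1)[OF assms])
  interpret X: lmod A ?X using fdD(1)[OF X] .
  have "?S \<subseteq> (\<lambda>U. iso_class K A (sub_mod ?X U)) ` {U. submodule U A ?X \<and> True}"
  proof
    fix L assume "L \<in> ?S"
    then obtain M where L: "L \<in> iso_classes K A" and "hall_count X M L \<noteq> 0" by auto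
    then obtain U where "U \<in> hall_submodules A ?X (class_rep M) (class_rep L)" by - (rule hall_submodules_nonempty)
    then have U: "submodule U A ?X" "mod_isomorphic A (sub_mod ?X U) (class_rep L)" by (simp_all add: hall_submodules_def)
    have "L = iso_class K A (sub_mod ?X U)"
      using iso_class_eq[OF fd_sub_mod[OF X U(1)] class_rep(1)[OF L] U(2)] class_rep(2)[OF L] by simp
    then show "L \<in> (\<lambda>U. iso_class K A (sub_mod ?X U)) ` {U. submodule U A ?X \<and> True}" using U(1) by simp
  qed
  then show ?thesis using finite_submodules[OF X] by (rule finite_subset[OF _ finite_imageI])
qed

text \<open>Chains \<open>V \<subseteq> U \<subseteq> X\<close> with \<open>V\<close>, \<open>U / V\<close> and \<open>X / U\<close> isomorphic to \<open>P\<close>, \<open>N\<close> and \<open>M\<close>. Both bracketings of a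
  triple product count them.\<close>

definition hall_chains :: "'a nmod \<Rightarrow> 'a nmod \<Rightarrow> 'a nmod \<Rightarrow> 'a nmod \<Rightarrow> (nat set \<times> nat set) set" where
  "hall_chains X M N P = {(V, U). submodule V A X \<and> submodule U A X \<and> V \<subseteq> U \<and>
     mod_isomorphic A (sub_mod X V) P \<and> (\<exists>g. quotient_map A (sub_mod X U) N V g) \<and> (\<exists>g. quotient_map A X M U g)}"

text \<open>Here \<open>V\<close> is chosen first. The class \<open>L\<close> of \<open>X / V\<close> then is the summation index, and the
  possible \<open>U\<close> correspond to submodules of \<open>X / V\<close>.\<close>

lemma hall_chains_left:
  assumes "X \<in> iso_classes K A" "M \<in> iso_classes K A" "N \<in> iso_classes K A" "P \<in> iso_classes K A"
    "finite T" "T \<subseteq> iso_classes K A" "{L \<in> iso_classes K A. \<exists>N. hall_count X L N \<noteq> 0} \<subseteq> T"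
  shows "(\<Sum>L\<in>T. hall_count L M N * hall_count X L P) =
    card (hall_chains (class_rep X) (class_rep M) (class_rep N) (class_rep P))"
proof -
  let ?X = "class_rep X" and ?M = "class_rep M" and ?N = "class_rep N" and ?P = "class_rep P"
  note rep = class_rep(1)[OF assms(1)] class_rep(1)[OF assms(2)] class_rep(1)[OF assms(3)] class_rep(1)[OF assms(4)]
  interpret X: lmod A ?X using fdD(1)[OF rep(1)] .
  let ?V = "{V. submodule V A ?X \<and> mod_isomorphic A (sub_mod ?X V) ?P}"
  let ?W = "\<lambda>V. {U. submodule U A ?X \<and> V \<subseteq> U \<and> (\<exists>g. quotient_map A (sub_mod ?X U) ?N V g) \<and> (\<exists>g. quotient_map A ?X ?M U g)}"
  have "\<exists>L. L \<in> iso_classes K A \<and> (\<exists>g. quotient_map A ?X (class_rep L) V g)" if V: "submodule V A ?X" for V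
  proof -
    obtain Q :: "'a nmod" and g where Q: "fd_module K A Q" "quotient_map A ?X Q V g"
      by (rule fd_quotient_exists[OF rep(1) V])
    obtain k where k: "k \<in> mod_hom A Q (class_rep (iso_class K A Q))" "bij_betw k (carrier Q) (carrier (class_rep (iso_class K A Q)))"
      using class_rep_iso[OF Q(1)] by (rule mod_isomorphicE)
    have "quotient_map A ?X (class_rep (iso_class K A Q)) V (\<lambda>x. k (g x))"
      by (rule quotient_map_comp_iso[OF fdD(1)[OF Q(1)] fdD(1)[OF class_rep(1)[OF iso_class_in[OF Q(1)]]] Q(2) k])
    then show ?thesis using iso_class_in[OF Q(1)] by (intro exI[of _ "iso_class K A Q"] conjI exI[of _ "\<lambda>x. k (g x)"])
  qed
  then obtain cl where cl: "\<And>V. submodule V A ?X \<Longrightarrow> cl V \<in> iso_classes K A \<and> (\<exists>g. quotient_map A ?X (class_rep (cl V)) V g)"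
    by metis
  have cl_unique: "(\<exists>g. quotient_map A ?X (class_rep L) V g) \<longleftrightarrow> cl V = L"
    if V: "submodule V A ?X" and L: "L \<in> iso_classes K A" for V L
  proof
    assume "\<exists>g. quotient_map A ?X (class_rep L) V g"
    then obtain g where g: "quotient_map A ?X (class_rep L) V g" by (rule exE)
    note l = cl[OF V]
    obtain g' where g': "quotient_map A ?X (class_rep (cl V)) V g'" using l by auto
    obtain k where "k \<in> mod_hom A (class_rep (cl V)) (class_rep L)" "bij_betw k (carrier (class_rep (cl V))) (carrier (class_rep L))"
      by (rule X.quotient_maps_isomorphic[OF fdD(1)[OF class_rep(1)] fdD(1)[OF class_rep(1)[OF L]] g' g]) (use l in simp_all)
    then have "mod_isomorphic A (class_rep (cl V)) (class_rep L)" by (rule mod_isomorphicI)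
    then show "cl V = L" using iso_class_eq[OF class_rep(1) class_rep(1)[OF L]] class_rep(2)[OF L] class_rep(2) l by simp
  next
    assume "cl V = L"
    then show "\<exists>g. quotient_map A ?X (class_rep L) V g" using cl[OF V] by simp
  qed
  have finV: "finite ?V" by (rule finite_submodules[OF rep(1)])
  have fib: "{V \<in> ?V. cl V = L} = hall_submodules A ?X (class_rep L) ?P" if L: "L \<in> iso_classes K A" for L
    unfolding hall_submodules_def using cl_unique[OF _ L] by auto
  have cl_T: "cl ` ?V \<subseteq> T"
  proof (rule image_subsetI)
    fix V assume V: "V \<in> ?V"
    then have l: "cl V \<in> iso_classes K A" using cl by simp
    have "V \<in> hall_submodules A ?X (class_rep (cl V)) ?P" using V fib[OF l] by auto
    then have "hall_count X (cl V) P \<noteq> 0"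
      unfolding hall_count_def using finite_subset[OF _ finV] fib[OF l] by (metis (no_types, lifting) card_eq_0_iff empty_iff mem_Collect_eq subsetI)
    then show "cl V \<in> T" using l assms(7) by auto
  qed
  have W: "card (?W V) = hall_count (cl V) M N" if V: "V \<in> ?V" for V
  proof -
    have sV: "submodule V A ?X" using V by simp
    note l = cl[OF sV]
    obtain g where g: "quotient_map A ?X (class_rep (cl V)) V g" using l by auto
    show ?thesis unfolding hall_count_def
      using hall_submodules_of_quotient[OF fdD(1)[OF rep(1)] fdD(1)[OF class_rep(1)] fdD(1)[OF rep(2)] fdD(1)[OF rep(3)] sV g] l
      by simp
  qed
  have "hall_chains ?X ?M ?N ?P = Sigma ?V ?W" unfolding hall_chains_def by auto
  then have "card (hall_chains ?X ?M ?N ?P) = (\<Sum>V\<in>?V. card (?W V))"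
    using card_SigmaI[OF finV, of ?W] finite_submodules[OF rep(1)] by simp
  also have "\<dots> = (\<Sum>V\<in>?V. hall_count (cl V) M N)" by (rule sum.cong[OF refl W])
  also have "\<dots> = (\<Sum>L\<in>T. \<Sum>V\<in>{V \<in> ?V. cl V = L}. hall_count (cl V) M N)"
    by (rule sum.group[OF finV assms(5) cl_T, symmetric])
  also have "\<dots> = (\<Sum>L\<in>T. hall_count L M N * hall_count X L P)"
  proof (rule sum.cong[OF refl])
    fix L assume "L \<in> T"
    then have L: "L \<in> iso_classes K A" using assms(6) by blast
    have "(\<Sum>V\<in>{V \<in> ?V. cl V = L}. hall_count (cl V) M N) = (\<Sum>V\<in>{V \<in> ?V. cl V = L}. hall_count L M N)"
      by (rule sum.cong) auto
    also have "\<dots> = hall_count L M N * hall_count X L P"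
      unfolding fib[OF L] by (simp add: hall_count_def)
    finally show "(\<Sum>V\<in>{V \<in> ?V. cl V = L}. hall_count (cl V) M N) = hall_count L M N * hall_count X L P" .
  qed
  finally show ?thesis by simp
qed

text \<open>Here \<open>U\<close> is chosen first, with class \<open>L\<close>, and \<open>V\<close> runs through submodules of \<open>U\<close>.\<close>

lemma hall_chains_right:
  assumes "X \<in> iso_classes K A" "M \<in> iso_classes K A" "N \<in> iso_classes K A" "P \<in> iso_classes K A"
    "finite T" "T \<subseteq> iso_classes K A" "{L \<in> iso_classes K A. \<exists>M. hall_count X M L \<noteq> 0} \<subseteq> T"
  shows "(\<Sum>L\<in>T. hall_count X M L * hall_count L N P) =
    card (hall_chains (class_rep X) (class_rep M) (class_rep N) (class_rep P))"
proof -
  let ?X = "class_rep X" and ?M = "class_rep M" and ?N = "class_rep N" and ?P = "class_rep P"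
  note rep = class_rep(1)[OF assms(1)] class_rep(1)[OF assms(2)] class_rep(1)[OF assms(3)] class_rep(1)[OF assms(4)]
  interpret X: lmod A ?X using fdD(1)[OF rep(1)] .
  let ?U = "{U. submodule U A ?X \<and> (\<exists>g. quotient_map A ?X ?M U g)}"
  let ?W = "\<lambda>U. {V. submodule V A ?X \<and> V \<subseteq> U \<and> mod_isomorphic A (sub_mod ?X V) ?P \<and> (\<exists>g. quotient_map A (sub_mod ?X U) ?N V g)}"
  let ?cl = "\<lambda>U. iso_class K A (sub_mod ?X U)"
  have finU: "finite ?U" by (rule finite_submodules[OF rep(1)])
  have fib: "{U \<in> ?U. ?cl U = L} = hall_submodules A ?X ?M (class_rep L)" if L: "L \<in> iso_classes K A" for L
  proof -
    have "?cl U = L \<longleftrightarrow> mod_isomorphic A (sub_mod ?X U) (class_rep L)" if "submodule U A ?X" for U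
      using iso_class_eq_iff[OF fd_sub_mod[OF rep(1) that] class_rep(1)[OF L]] class_rep(2)[OF L] by simp
    then show ?thesis unfolding hall_submodules_def by auto
  qed
  have cl_T: "?cl ` ?U \<subseteq> T"
  proof (rule image_subsetI)
    fix U assume U: "U \<in> ?U"
    then have l: "?cl U \<in> iso_classes K A" using iso_class_in fd_sub_mod[OF rep(1)] by simp
    have "U \<in> hall_submodules A ?X ?M (class_rep (?cl U))" using U fib[OF l] by auto
    then have "hall_count X M (?cl U) \<noteq> 0"
      unfolding hall_count_def using finite_subset[OF _ finU] fib[OF l] by (metis (no_types, lifting) card_eq_0_iff empty_iff mem_Collect_eq subsetI)
    then show "?cl U \<in> T" using l assms(7) by auto
  qed
  have W: "card (?W U) = hall_count (?cl U) N P" if U: "U \<in> ?U" for U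
  proof -
    have sU: "submodule U A ?X" using U by simp
    have "?W U = hall_submodules A (sub_mod ?X U) ?N ?P"
      unfolding hall_submodules_def X.submodule_sub_mod_iff[OF sU] by auto
    then show ?thesis using hall_submodules_class[OF fd_sub_mod[OF rep(1) sU] assms(3,4)] by simp
  qed
  have "card (hall_chains ?X ?M ?N ?P) = card (Sigma ?U ?W)"
  proof (rule bij_betw_same_card[of prod.swap])
    show "bij_betw prod.swap (hall_chains ?X ?M ?N ?P) (Sigma ?U ?W)"
      by (rule bij_betw_byWitness[where f' = prod.swap]) (auto simp: hall_chains_def)
  qed
  also have "\<dots> = (\<Sum>U\<in>?U. card (?W U))"
    using card_SigmaI[OF finU, of ?W] finite_submodules[OF rep(1)] by simp
  also have "\<dots> = (\<Sum>U\<in>?U. hall_count (?cl U) N P)" by (rule sum.cong[OF refl W])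
  also have "\<dots> = (\<Sum>L\<in>T. \<Sum>U\<in>{U \<in> ?U. ?cl U = L}. hall_count (?cl U) N P)"
    by (rule sum.group[OF finU assms(5) cl_T, symmetric])
  also have "\<dots> = (\<Sum>L\<in>T. hall_count X M L * hall_count L N P)"
  proof (rule sum.cong[OF refl])
    fix L assume "L \<in> T"
    then have L: "L \<in> iso_classes K A" using assms(6) by blast
    have "(\<Sum>U\<in>{U \<in> ?U. ?cl U = L}. hall_count (?cl U) N P) = (\<Sum>U\<in>{U \<in> ?U. ?cl U = L}. hall_count L N P)"
      by (rule sum.cong) auto
    also have "\<dots> = hall_count X M L * hall_count L N P"
      unfolding fib[OF L] by (simp add: hall_count_def)
    finally show "(\<Sum>U\<in>{U \<in> ?U. ?cl U = L}. hall_count (?cl U) N P) = hall_count X M L * hall_count L N P" .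
  qed
  finally show ?thesis by simp
qed

lemma hall_number_rep:
  assumes "X \<in> iso_classes K A" "M \<in> iso_classes K A"
  shows "hall_number A (class_rep X) (class_rep M) (class_rep N) = hall_count X M N"
  unfolding hall_count_def
  by (rule hall_number_eq[OF fdD(1)[OF class_rep(1)[OF assms(1)]] fdD(1)[OF class_rep(1)[OF assms(2)]]])

text \<open>A nonzero Hall number produces an extension of \<open>M\<close> by \<open>N\<close> with middle term \<open>X\<close>.\<close>

lemma finite_hall_product:
  assumes "finitary K A" "M \<in> iso_classes K A" "N \<in> iso_classes K A"
  shows "finite {X \<in> iso_classes K A. hall_count X M N \<noteq> 0}"
proof (rule finite_subset[OF _ finite_middle_terms[OF assms(1) class_rep(1)[OF assms(2)] class_rep(1)[OF assms(3)]]])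
  let ?M = "class_rep M" and ?N = "class_rep N"
  note rep = class_rep(1)[OF assms(2)] class_rep(1)[OF assms(3)]
  show "{X \<in> iso_classes K A. hall_count X M N \<noteq> 0} \<subseteq> (\<lambda>e. iso_class K A (fst e)) ` extensions K A ?M ?N"
  proof
    fix X assume "X \<in> {X \<in> iso_classes K A. hall_count X M N \<noteq> 0}"
    then have X: "X \<in> iso_classes K A" "hall_count X M N \<noteq> 0" by simp_all
    let ?X = "class_rep X"
    have fX: "fd_module K A ?X" by (rule class_rep(1)[OF X(1)])
    interpret X: lmod A ?X using fdD(1)[OF fX] .
    obtain U where "U \<in> hall_submodules A ?X ?M ?N" using X(2) by (rule hall_submodules_nonempty)
    then have U: "submodule U A ?X" "mod_isomorphic A (sub_mod ?X U) ?N" "\<exists>g. quotient_map A ?X ?M U g"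
      by (simp_all add: hall_submodules_def)
    obtain g where g: "quotient_map A ?X ?M U g" using U(3) by (rule exE)
    obtain f where f: "f \<in> mod_hom A ?N (sub_mod ?X U)" "bij_betw f (carrier ?N) (carrier (sub_mod ?X U))"
      using mod_isomorphic_sym[OF X.lmod_sub_mod[OF U(1)] fdD(1)[OF rep(2)] U(2)] by (rule mod_isomorphicE)
    have "f \<in> mod_hom A ?N ?X" by (rule mod_hom_from_into_sub[OF f(1) X.submoduleD(1)[OF U(1)]])
    moreover have "f ` carrier ?N = {x \<in> carrier ?X. g x = \<zero>\<^bsub>?M\<^esub>}"
      using f(2) quotient_mapD(3)[OF g] X.submoduleD(3)[OF U(1)] by (auto simp: bij_betw_def)
    ultimately have "(?X, f, g) \<in> extensions K A ?M ?N"
      using fX f(2) quotient_mapD(1,2)[OF g] by (simp add: extensions_def bij_betw_def)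
    then have "iso_class K A (fst (?X, f, g)) \<in> (\<lambda>e. iso_class K A (fst e)) ` extensions K A ?M ?N" by (rule imageI)
    then show "X \<in> (\<lambda>e. iso_class K A (fst e)) ` extensions K A ?M ?N" using class_rep(2)[OF X(1)] by simp
  qed
qed

end


section \<open>The Hall algebra is a ring\<close>

context finite_field_algebra
begin

lemma v_elem_nonzero: "v_elem K \<noteq> 0"
proof -
  interpret F: field K by (rule K_field)
  have "card (carrier K) \<noteq> 0" using K_finite F.zero_closed card_gt_0_iff[of "carrier K"] by force
  then show ?thesis unfolding v_elem_def by simp
qed

lemma Z_v_monomial: "of_int c * v_elem K powi i \<in> Z_v K"
  unfolding Z_v_def by (rule CollectI, rule exI[of _ "\<lambda>_. c"], rule exI[of _ "{i}"]) simp

lemma Z_v_of_int: "of_int c \<in> Z_v K"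
  using Z_v_monomial[of c 0] by simp

lemma Z_v_0: "0 \<in> Z_v K" and Z_v_1: "1 \<in> Z_v K" and Z_v_of_nat: "real n \<in> Z_v K"
  using Z_v_of_int[of 0] Z_v_of_int[of 1] Z_v_of_int[of "int n"] by simp_all

lemma Z_v_add:
  assumes "x \<in> Z_v K" "y \<in> Z_v K" shows "x + y \<in> Z_v K"
proof -
  let ?v = "v_elem K"
  obtain a I where x: "finite I" "x = (\<Sum>i\<in>I. of_int (a i) * ?v powi i)"
    using assms(1) unfolding Z_v_def by (elim CollectE exE conjE)
  obtain b J where y: "finite J" "y = (\<Sum>i\<in>J. of_int (b i) * ?v powi i)"
    using assms(2) unfolding Z_v_def by (elim CollectE exE conjE)
  define a' where "a' i = (if i \<in> I then a i else 0)" for i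
  define b' where "b' i = (if i \<in> J then b i else 0)" for i
  have "x = (\<Sum>i\<in>I \<union> J. of_int (a' i) * ?v powi i)"
    unfolding x(2) by (rule sum.mono_neutral_cong_left) (use x(1) y(1) in \<open>auto simp: a'_def\<close>)
  moreover have "y = (\<Sum>i\<in>I \<union> J. of_int (b' i) * ?v powi i)"
    unfolding y(2) by (rule sum.mono_neutral_cong_left) (use x(1) y(1) in \<open>auto simp: b'_def\<close>)
  ultimately have "x + y = (\<Sum>i\<in>I \<union> J. of_int (a' i + b' i) * ?v powi i)"
    by (simp add: sum.distrib algebra_simps)
  then show ?thesis unfolding Z_v_def using x(1) y(1)
    by (intro CollectI exI[of _ "\<lambda>i. a' i + b' i"] exI[of _ "I \<union> J"]) simp
qed

lemma Z_v_sum: "(\<And>i. i \<in> S \<Longrightarrow> x i \<in> Z_v K) \<Longrightarrow> sum x S \<in> Z_v K"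
  by (induction S rule: infinite_finite_induct) (simp_all add: Z_v_0 Z_v_add)

lemma Z_v_mult:
  assumes "x \<in> Z_v K" "y \<in> Z_v K" shows "x * y \<in> Z_v K"
proof -
  let ?v = "v_elem K"
  obtain a I where x: "finite I" "x = (\<Sum>i\<in>I. of_int (a i) * ?v powi i)"
    using assms(1) unfolding Z_v_def by (elim CollectE exE conjE)
  obtain b J where y: "finite J" "y = (\<Sum>i\<in>J. of_int (b i) * ?v powi i)"
    using assms(2) unfolding Z_v_def by (elim CollectE exE conjE)
  have "x * y = (\<Sum>i\<in>I. \<Sum>j\<in>J. of_int (a i * b j) * ?v powi (i + j))"
    unfolding x(2) y(2) sum_product using v_elem_nonzero
    by (intro sum.cong refl) (simp add: power_int_add)
  then show ?thesis by (simp only:) (intro Z_v_sum Z_v_monomial)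
qed

lemma Z_v_minus: "x \<in> Z_v K \<Longrightarrow> - x \<in> Z_v K"
  using Z_v_mult[OF Z_v_of_int[of "-1"], of x] by simp

abbreviation supp :: "('a nmod set \<Rightarrow> real) \<Rightarrow> 'a nmod set set" where
  "supp f \<equiv> {X. f X \<noteq> 0}"

abbreviation "H \<equiv> hall_algebra K A"

lemma hall_carrier_iff:
  "f \<in> carrier H \<longleftrightarrow> finite (supp f) \<and> supp f \<subseteq> iso_classes K A \<and> (\<forall>X. f X \<in> Z_v K)"
  unfolding hall_algebra_def by (simp add: image_subset_iff)

text \<open>The index sets are allowed to be larger than the supports, so that sums arising from
  different factors can be compared.\<close>

lemma hall_mult_eq:
  assumes "f \<in> carrier H" "g \<in> carrier H" "X \<in> iso_classes K A"
    "finite S" "supp f \<subseteq> S" "S \<subseteq> iso_classes K A" "finite S'" "supp g \<subseteq> S'" "S' \<subseteq> iso_classes K A"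
  shows "(f \<otimes>\<^bsub>H\<^esub> g) X = (\<Sum>M\<in>S. \<Sum>N\<in>S'. f M * g N * real (hall_count X M N))"
proof -
  have "(f \<otimes>\<^bsub>H\<^esub> g) X = (\<Sum>M\<in>supp f. \<Sum>N\<in>supp g.
      f M * g N * real (hall_number A (class_rep X) (class_rep M) (class_rep N)))"
    using assms(3) by (simp add: hall_algebra_def)
  also have "\<dots> = (\<Sum>M\<in>S. \<Sum>N\<in>S'. f M * g N * real (hall_count X M N))"
  proof (rule sum.mono_neutral_cong_left[OF assms(4,5)])
    show "\<forall>M\<in>S - supp f. (\<Sum>N\<in>S'. f M * g N * real (hall_count X M N)) = 0" by simp
    fix M assume "M \<in> supp f"
    then have M: "M \<in> iso_classes K A" using assms(5,6) by blast
    show "(\<Sum>N\<in>supp g. f M * g N * real (hall_number A (class_rep X) (class_rep M) (class_rep N))) =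
        (\<Sum>N\<in>S'. f M * g N * real (hall_count X M N))"
      by (rule sum.mono_neutral_cong_left[OF assms(7,8)]) (simp_all add: hall_number_rep[OF assms(3) M])
  qed
  finally show ?thesis .
qed

lemma hall_mult_outside: "X \<notin> iso_classes K A \<Longrightarrow> (f \<otimes>\<^bsub>H\<^esub> g) X = 0"
  by (simp add: hall_algebra_def)

lemma hall_simps [simp]:
  "(f \<oplus>\<^bsub>H\<^esub> g) X = f X + g X" "\<zero>\<^bsub>H\<^esub> X = 0" "\<one>\<^bsub>H\<^esub> = hall_basis K A zero_mod"
  by (simp_all add: hall_algebra_def)

lemma hall_mult_support:
  assumes "f \<in> carrier H" "g \<in> carrier H" "(f \<otimes>\<^bsub>H\<^esub> g) X \<noteq> 0"
  shows "X \<in> iso_classes K A \<and> (\<exists>M\<in>supp f. \<exists>N\<in>supp g. hall_count X M N \<noteq> 0)"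
proof -
  have X: "X \<in> iso_classes K A" using hall_mult_outside assms(3) by metis
  note f = assms(1)[unfolded hall_carrier_iff] and g = assms(2)[unfolded hall_carrier_iff]
  have "\<exists>M\<in>supp f. \<exists>N\<in>supp g. hall_count X M N \<noteq> 0"
  proof (rule ccontr)
    assume "\<not> ?thesis"
    then have z: "hall_count X M N = 0" if "M \<in> supp f" "N \<in> supp g" for M N using that by blast
    have "(\<Sum>M\<in>supp f. \<Sum>N\<in>supp g. f M * g N * real (hall_count X M N)) = 0"
      by (intro sum.neutral ballI) (simp add: z del: mem_Collect_eq)
    then show False using assms(3) hall_mult_eq[OF assms(1,2) X, of "supp f" "supp g"] f g by simp
  qed
  with X show ?thesis by simp
qed

lemma hall_mult_closed:
  assumes "finitary K A" "f \<in> carrier H" "g \<in> carrier H"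
  shows "f \<otimes>\<^bsub>H\<^esub> g \<in> carrier H"
  unfolding hall_carrier_iff
proof (intro conjI allI)
  note f = assms(2)[unfolded hall_carrier_iff] and g = assms(3)[unfolded hall_carrier_iff]
  show "supp (f \<otimes>\<^bsub>H\<^esub> g) \<subseteq> iso_classes K A" using hall_mult_support[OF assms(2,3)] by auto
  have "supp (f \<otimes>\<^bsub>H\<^esub> g) \<subseteq> (\<Union>M\<in>supp f. \<Union>N\<in>supp g. {X \<in> iso_classes K A. hall_count X M N \<noteq> 0})"
  proof
    fix X assume "X \<in> supp (f \<otimes>\<^bsub>H\<^esub> g)"
    then have X: "(f \<otimes>\<^bsub>H\<^esub> g) X \<noteq> 0" by simp
    obtain M N where "X \<in> iso_classes K A" "M \<in> supp f" "N \<in> supp g" "hall_count X M N \<noteq> 0"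
      using hall_mult_support[OF assms(2,3) X] by (elim conjE bexE)
    then show "X \<in> (\<Union>M\<in>supp f. \<Union>N\<in>supp g. {X \<in> iso_classes K A. hall_count X M N \<noteq> 0})" by blast
  qed
  moreover have "finite (\<Union>M\<in>supp f. \<Union>N\<in>supp g. {X \<in> iso_classes K A. hall_count X M N \<noteq> 0})"
    using f g by (intro finite_UN_I finite_hall_product[OF assms(1)]) auto
  ultimately show "finite (supp (f \<otimes>\<^bsub>H\<^esub> g))" by (rule finite_subset)
  fix X
  show "(f \<otimes>\<^bsub>H\<^esub> g) X \<in> Z_v K"
  proof (cases "X \<in> iso_classes K A")
    case True
    have "(f \<otimes>\<^bsub>H\<^esub> g) X = (\<Sum>M\<in>supp f. \<Sum>N\<in>supp g. f M * g N * real (hall_count X M N))"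
      using hall_mult_eq[OF assms(2,3) True, of "supp f" "supp g"] f g by simp
    then show ?thesis using f g by (simp only:) (intro Z_v_sum Z_v_mult Z_v_of_nat, simp_all)
  qed (simp add: hall_mult_outside Z_v_0)
qed

text \<open>Both sides expand into the triple sum with the numbers of chains as coefficients.\<close>

lemma hall_mult_assoc:
  assumes "finitary K A" "f \<in> carrier H" "g \<in> carrier H" "h \<in> carrier H"
  shows "(f \<otimes>\<^bsub>H\<^esub> g) \<otimes>\<^bsub>H\<^esub> h = f \<otimes>\<^bsub>H\<^esub> (g \<otimes>\<^bsub>H\<^esub> h)"
proof
  fix X
  note fg = hall_mult_closed[OF assms(1-3)] and gh = hall_mult_closed[OF assms(1,3,4)]
  note cf = assms(2)[unfolded hall_carrier_iff] and cg = assms(3)[unfolded hall_carrier_iff]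
    and ch = assms(4)[unfolded hall_carrier_iff] and cfg = fg[unfolded hall_carrier_iff]
    and cgh = gh[unfolded hall_carrier_iff]
  show "((f \<otimes>\<^bsub>H\<^esub> g) \<otimes>\<^bsub>H\<^esub> h) X = (f \<otimes>\<^bsub>H\<^esub> (g \<otimes>\<^bsub>H\<^esub> h)) X"
  proof (cases "X \<in> iso_classes K A")
    case X: True
    let ?c = "\<lambda>M N P. real (card (hall_chains (class_rep X) (class_rep M) (class_rep N) (class_rep P)))"
    let ?R = "\<Sum>M\<in>supp f. \<Sum>N\<in>supp g. \<Sum>P\<in>supp h. f M * g N * h P * ?c M N P"
    \<comment> \<open>This finite set contains all classes that contribute to the coefficient at \<open>X\<close>.\<close>
    define T where "T = {L \<in> iso_classes K A. \<exists>N. hall_count X L N \<noteq> 0} \<union> supp (f \<otimes>\<^bsub>H\<^esub> g)"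
    have T: "finite T" "T \<subseteq> iso_classes K A" "supp (f \<otimes>\<^bsub>H\<^esub> g) \<subseteq> T"
      "{L \<in> iso_classes K A. \<exists>N. hall_count X L N \<noteq> 0} \<subseteq> T"
      using finite_quotient_classes[OF X] cfg by (auto simp: T_def)
    define T' where "T' = {L \<in> iso_classes K A. \<exists>M. hall_count X M L \<noteq> 0} \<union> supp (g \<otimes>\<^bsub>H\<^esub> h)"
    have T': "finite T'" "T' \<subseteq> iso_classes K A" "supp (g \<otimes>\<^bsub>H\<^esub> h) \<subseteq> T'"
      "{L \<in> iso_classes K A. \<exists>M. hall_count X M L \<noteq> 0} \<subseteq> T'"
      using finite_submodule_classes[OF X] cgh by (auto simp: T'_def)
    have "((f \<otimes>\<^bsub>H\<^esub> g) \<otimes>\<^bsub>H\<^esub> h) X = (\<Sum>L\<in>T. \<Sum>P\<in>supp h. (f \<otimes>\<^bsub>H\<^esub> g) L * h P * real (hall_count X L P))"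
      using hall_mult_eq[OF fg assms(4) X T(1,3,2), of "supp h"] ch by simp
    also have "\<dots> = (\<Sum>L\<in>T. \<Sum>P\<in>supp h. (\<Sum>M\<in>supp f. \<Sum>N\<in>supp g. f M * g N * real (hall_count L M N)) * h P * real (hall_count X L P))"
    proof (intro sum.cong refl)
      fix L P assume "L \<in> T"
      then have L: "L \<in> iso_classes K A" using T(2) by blast
      show "(f \<otimes>\<^bsub>H\<^esub> g) L * h P * real (hall_count X L P) =
          (\<Sum>M\<in>supp f. \<Sum>N\<in>supp g. f M * g N * real (hall_count L M N)) * h P * real (hall_count X L P)"
        using hall_mult_eq[OF assms(2,3) L, of "supp f" "supp g"] cf cg by simp
    qed
    also have "\<dots> = (\<Sum>L\<in>T. \<Sum>P\<in>supp h. \<Sum>M\<in>supp f. \<Sum>N\<in>supp g. f M * g N * h P * real (hall_count L M N * hall_count X L P))"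
      by (simp add: sum_distrib_left sum_distrib_right mult_ac)
    also have "\<dots> = (\<Sum>M\<in>supp f. \<Sum>N\<in>supp g. \<Sum>P\<in>supp h. \<Sum>L\<in>T. f M * g N * h P * real (hall_count L M N * hall_count X L P))"
    proof -
      let ?t = "\<lambda>L P M N. f M * g N * h P * real (hall_count L M N * hall_count X L P)"
      have "(\<Sum>L\<in>T. \<Sum>P\<in>supp h. \<Sum>M\<in>supp f. \<Sum>N\<in>supp g. ?t L P M N)
          = (\<Sum>P\<in>supp h. \<Sum>L\<in>T. \<Sum>M\<in>supp f. \<Sum>N\<in>supp g. ?t L P M N)" by (rule sum.swap)
      also have "\<dots> = (\<Sum>P\<in>supp h. \<Sum>M\<in>supp f. \<Sum>L\<in>T. \<Sum>N\<in>supp g. ?t L P M N)"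
        by (rule sum.cong[OF refl]) (rule sum.swap)
      also have "\<dots> = (\<Sum>P\<in>supp h. \<Sum>M\<in>supp f. \<Sum>N\<in>supp g. \<Sum>L\<in>T. ?t L P M N)"
        by (rule sum.cong[OF refl], rule sum.cong[OF refl]) (rule sum.swap)
      also have "\<dots> = (\<Sum>M\<in>supp f. \<Sum>P\<in>supp h. \<Sum>N\<in>supp g. \<Sum>L\<in>T. ?t L P M N)" by (rule sum.swap)
      also have "\<dots> = (\<Sum>M\<in>supp f. \<Sum>N\<in>supp g. \<Sum>P\<in>supp h. \<Sum>L\<in>T. ?t L P M N)"
        by (rule sum.cong[OF refl]) (rule sum.swap)
      finally show ?thesis .
    qed
    also have "\<dots> = ?R"
    proof (intro sum.cong refl)
      fix M N P assume "M \<in> supp f" "N \<in> supp g" "P \<in> supp h"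
      then have MNP: "M \<in> iso_classes K A" "N \<in> iso_classes K A" "P \<in> iso_classes K A" using cf cg ch by auto
      show "(\<Sum>L\<in>T. f M * g N * h P * real (hall_count L M N * hall_count X L P)) = f M * g N * h P * ?c M N P"
        unfolding hall_chains_left[OF X MNP T(1,2,4), symmetric] by (simp add: sum_distrib_left)
    qed
    finally have left: "((f \<otimes>\<^bsub>H\<^esub> g) \<otimes>\<^bsub>H\<^esub> h) X = ?R" .
    have "(f \<otimes>\<^bsub>H\<^esub> (g \<otimes>\<^bsub>H\<^esub> h)) X = (\<Sum>M\<in>supp f. \<Sum>L\<in>T'. f M * (g \<otimes>\<^bsub>H\<^esub> h) L * real (hall_count X M L))"
      using hall_mult_eq[OF assms(2) gh X _ order_refl _ T'(1,3,2)] cf by simp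
    also have "\<dots> = (\<Sum>M\<in>supp f. \<Sum>L\<in>T'. f M * (\<Sum>N\<in>supp g. \<Sum>P\<in>supp h. g N * h P * real (hall_count L N P)) * real (hall_count X M L))"
    proof (intro sum.cong refl)
      fix M L assume "L \<in> T'"
      then have L: "L \<in> iso_classes K A" using T'(2) by blast
      show "f M * (g \<otimes>\<^bsub>H\<^esub> h) L * real (hall_count X M L) =
          f M * (\<Sum>N\<in>supp g. \<Sum>P\<in>supp h. g N * h P * real (hall_count L N P)) * real (hall_count X M L)"
        using hall_mult_eq[OF assms(3,4) L, of "supp g" "supp h"] cg ch by simp
    qed
    also have "\<dots> = (\<Sum>M\<in>supp f. \<Sum>L\<in>T'. \<Sum>N\<in>supp g. \<Sum>P\<in>supp h. f M * g N * h P * real (hall_count X M L * hall_count L N P))"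
      by (simp add: sum_distrib_left sum_distrib_right mult_ac)
    also have "\<dots> = (\<Sum>M\<in>supp f. \<Sum>N\<in>supp g. \<Sum>P\<in>supp h. \<Sum>L\<in>T'. f M * g N * h P * real (hall_count X M L * hall_count L N P))"
    proof (rule sum.cong[OF refl])
      fix M
      let ?t = "\<lambda>L N P. f M * g N * h P * real (hall_count X M L * hall_count L N P)"
      have "(\<Sum>L\<in>T'. \<Sum>N\<in>supp g. \<Sum>P\<in>supp h. ?t L N P) = (\<Sum>N\<in>supp g. \<Sum>L\<in>T'. \<Sum>P\<in>supp h. ?t L N P)" by (rule sum.swap)
      also have "\<dots> = (\<Sum>N\<in>supp g. \<Sum>P\<in>supp h. \<Sum>L\<in>T'. ?t L N P)"
        by (rule sum.cong[OF refl]) (rule sum.swap)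
      finally show "(\<Sum>L\<in>T'. \<Sum>N\<in>supp g. \<Sum>P\<in>supp h. ?t L N P) = (\<Sum>N\<in>supp g. \<Sum>P\<in>supp h. \<Sum>L\<in>T'. ?t L N P)" .
    qed
    also have "\<dots> = ?R"
    proof (intro sum.cong refl)
      fix M N P assume "M \<in> supp f" "N \<in> supp g" "P \<in> supp h"
      then have MNP: "M \<in> iso_classes K A" "N \<in> iso_classes K A" "P \<in> iso_classes K A" using cf cg ch by auto
      show "(\<Sum>L\<in>T'. f M * g N * h P * real (hall_count X M L * hall_count L N P)) = f M * g N * h P * ?c M N P"
        unfolding hall_chains_right[OF X MNP T'(1,2,4), symmetric] by (simp add: sum_distrib_left)
    qed
    finally show ?thesis using left by simp
  qed (simp add: hall_mult_outside)
qed

lemma fd_zero_mod: "fd_module K A (zero_mod :: 'a nmod)"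
proof -
  interpret R: ring A using A_algebra by (simp add: assoc_algebra_def)
  have "abelian_group (zero_mod :: 'a nmod)" by (rule abelian_groupI) (auto simp: zero_mod_def)
  then have "lmod A (zero_mod :: 'a nmod)"
    by (intro lmod.intro left_module.intro left_module_axioms.intro R.ring_axioms) (auto simp: zero_mod_def)
  then show ?thesis unfolding fd_iff by (simp add: zero_mod_def)
qed

lemma hall_basis_simp: "hall_basis K A M X = (if X = iso_class K A M then 1 else 0)"
  by (simp add: hall_basis_def)

lemma hall_basis_closed:
  assumes "fd_module K A M" shows "hall_basis K A M \<in> carrier H"
proof -
  have "supp (hall_basis K A M) = {iso_class K A M}" by (auto simp: hall_basis_simp)
  then show ?thesis unfolding hall_carrier_iff using iso_class_in[OF assms] Z_v_0 Z_v_1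
    by (simp add: hall_basis_simp)
qed

text \<open>Only \<open>U = X\<close> has the zero module as quotient.\<close>

lemma hall_submodules_zero_quotient:
  assumes "lmod A X" "lmod A Z" "carrier Z = {\<zero>\<^bsub>Z\<^esub>}"
  shows "hall_submodules A X Z N = (if mod_isomorphic A X N then {carrier X} else {})"
proof -
  interpret X: lmod A X by fact
  interpret Z: lmod A Z by fact
  have U: "U = carrier X" if "submodule U A X" "quotient_map A X Z U g" for U g
  proof
    note g = quotient_mapD[OF that(2)]
    show "carrier X \<subseteq> U"
    proof
      fix x assume x: "x \<in> carrier X"
      have "g x = \<zero>\<^bsub>Z\<^esub>" using mod_homD(1)[OF g(1) x] assms(3) by simp
      then show "x \<in> U" using g(3)[OF x] by simp
    qed
  qed (rule X.submoduleD(1)[OF that(1)])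
  have ex: "quotient_map A X Z (carrier X) (\<lambda>_. \<zero>\<^bsub>Z\<^esub>)"
    unfolding quotient_map_def using X.M.zero_closed by (auto intro!: mod_homI simp: assms(3) image_constant_conv)
  show ?thesis
  proof (intro equalityI subsetI)
    fix U assume "U \<in> hall_submodules A X Z N"
    then have h: "submodule U A X" "mod_isomorphic A (sub_mod X U) N" "\<exists>g. quotient_map A X Z U g"
      by (simp_all add: hall_submodules_def)
    have "U = carrier X" using h(3) by (rule exE) (rule U[OF h(1)])
    then show "U \<in> (if mod_isomorphic A X N then {carrier X} else {})" using h(2) by simp
  next
    fix U assume U: "U \<in> (if mod_isomorphic A X N then {carrier X} else {})"
    then have "U = carrier X" "mod_isomorphic A X N" by (simp_all split: if_splits)
    then show "U \<in> hall_submodules A X Z N"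
      unfolding hall_submodules_def using X.submodule_carrier ex by (intro CollectI conjI exI[of _ "\<lambda>_. \<zero>\<^bsub>Z\<^esub>"]) simp_all
  qed
qed

lemma hall_submodules_zero_sub:
  assumes "lmod A X" "lmod A Z" "lmod A M" "carrier Z = {\<zero>\<^bsub>Z\<^esub>}"
  shows "hall_submodules A X M Z = (if mod_isomorphic A X M then {{\<zero>\<^bsub>X\<^esub>}} else {})"
proof -
  interpret X: lmod A X by fact
  interpret Z: lmod A Z by fact
  have U: "mod_isomorphic A (sub_mod X U) Z \<longleftrightarrow> U = {\<zero>\<^bsub>X\<^esub>}" if s: "submodule U A X" for U
  proof
    interpret U: lmod A "sub_mod X U" by (rule X.lmod_sub_mod[OF s])
    assume "mod_isomorphic A (sub_mod X U) Z"
    then obtain h where h: "h \<in> mod_hom A (sub_mod X U) Z" "bij_betw h (carrier (sub_mod X U)) (carrier Z)"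
      by (rule mod_isomorphicE)
    have "U \<subseteq> {\<zero>\<^bsub>X\<^esub>}"
    proof
      fix u assume u: "u \<in> U"
      have "h u = \<zero>\<^bsub>Z\<^esub>" using mod_homD(1)[OF h(1), of u] u assms(4) by simp
      then show "u \<in> {\<zero>\<^bsub>X\<^esub>}"
        using U.hom_inj_on_iff[OF Z.lmod_axioms h(1)] bij_betw_imp_inj_on[OF h(2)] u by simp
    qed
    then show "U = {\<zero>\<^bsub>X\<^esub>}" using X.submoduleD(2)[OF s] by blast
  next
    assume "U = {\<zero>\<^bsub>X\<^esub>}"
    moreover have "(\<lambda>_. \<zero>\<^bsub>Z\<^esub>) \<in> mod_hom A (sub_mod X {\<zero>\<^bsub>X\<^esub>}) Z" by (rule mod_homI) simp_all
    moreover have "bij_betw (\<lambda>_. \<zero>\<^bsub>Z\<^esub>) (carrier (sub_mod X {\<zero>\<^bsub>X\<^esub>})) (carrier Z)" by (simp add: assms(4) bij_betw_def)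
    ultimately show "mod_isomorphic A (sub_mod X U) Z" using mod_isomorphicI by metis
  qed
  have "hall_submodules A X M Z = {U. U = {\<zero>\<^bsub>X\<^esub>} \<and> (\<exists>g. quotient_map A X M {\<zero>\<^bsub>X\<^esub>} g)}"
    unfolding hall_submodules_def
  proof (rule Collect_cong)
    fix W
    show "(submodule W A X \<and> mod_isomorphic A (sub_mod X W) Z \<and> (\<exists>g. quotient_map A X M W g)) \<longleftrightarrow>
        (W = {\<zero>\<^bsub>X\<^esub>} \<and> (\<exists>g. quotient_map A X M {\<zero>\<^bsub>X\<^esub>} g))"
    proof (cases "W = {\<zero>\<^bsub>X\<^esub>}")
      case True
      show ?thesis unfolding True using U[OF X.submodule_zero] X.submodule_zero by simp
    next
      case False
      then show ?thesis using U[of W] by auto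
    qed
  qed
  then show ?thesis unfolding quotient_map_zero_iff[OF assms(1,3)] by simp
qed

lemma hall_count_zero:
  assumes "X \<in> iso_classes K A" "M \<in> iso_classes K A"
  shows "hall_count X (iso_class K A zero_mod) M = (if X = M then 1 else 0)"
    "hall_count X M (iso_class K A zero_mod) = (if X = M then 1 else 0)"
proof -
  let ?Z = "class_rep (iso_class K A (zero_mod :: 'a nmod))"
  have Z: "fd_module K A ?Z" by (rule class_rep(1)[OF iso_class_in[OF fd_zero_mod]])
  interpret Z: lmod A ?Z using fdD(1)[OF Z] .
  interpret O: lmod A "zero_mod :: 'a nmod" using fdD(1)[OF fd_zero_mod] .
  obtain h where h: "h \<in> mod_hom A (zero_mod :: 'a nmod) ?Z" "bij_betw h (carrier (zero_mod :: 'a nmod)) (carrier ?Z)"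
    using class_rep_iso[OF fd_zero_mod] by (rule mod_isomorphicE)
  have "carrier ?Z = {h 0}" using bij_betw_imp_surj_on[OF h(2)] by (simp add: zero_mod_def)
  then have cZ: "carrier ?Z = {\<zero>\<^bsub>?Z\<^esub>}" using Z.M.zero_closed by simp
  note rep = class_rep[OF assms(1)] class_rep[OF assms(2)]
  have eq: "X = M \<longleftrightarrow> mod_isomorphic A (class_rep X) (class_rep M)"
    using iso_class_eq_iff[OF rep(1,3)] rep(2,4) by simp
  show "hall_count X (iso_class K A zero_mod) M = (if X = M then 1 else 0)"
    unfolding hall_count_def hall_submodules_zero_quotient[OF fdD(1)[OF rep(1)] Z.lmod_axioms cZ] eq by simp
  show "hall_count X M (iso_class K A zero_mod) = (if X = M then 1 else 0)"
    unfolding hall_count_def hall_submodules_zero_sub[OF fdD(1)[OF rep(1)] Z.lmod_axioms fdD(1)[OF rep(3)] cZ] eq by simp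
qed

lemma hall_one:
  assumes "f \<in> carrier H"
  shows "\<one>\<^bsub>H\<^esub> \<otimes>\<^bsub>H\<^esub> f = f" "f \<otimes>\<^bsub>H\<^esub> \<one>\<^bsub>H\<^esub> = f"
proof -
  note f = assms[unfolded hall_carrier_iff]
  let ?o = "iso_class K A (zero_mod :: 'a nmod)"
  have o: "supp (hall_basis K A zero_mod) = {?o}" by (auto simp: hall_basis_simp)
  note oI = iso_class_in[OF fd_zero_mod]
  have *: "(\<one>\<^bsub>H\<^esub> \<otimes>\<^bsub>H\<^esub> f) X = f X \<and> (f \<otimes>\<^bsub>H\<^esub> \<one>\<^bsub>H\<^esub>) X = f X" for X
  proof (cases "X \<in> iso_classes K A")
    case X: True
    let ?S = "insert X (supp f)"
    have S: "finite ?S" "supp f \<subseteq> ?S" "?S \<subseteq> iso_classes K A" using f X by auto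
    have "(\<one>\<^bsub>H\<^esub> \<otimes>\<^bsub>H\<^esub> f) X = (\<Sum>N\<in>?S. f N * real (hall_count X ?o N))"
      using hall_mult_eq[OF hall_basis_closed[OF fd_zero_mod] assms X, of "{?o}" ?S] S oI o
      by (simp add: hall_basis_simp)
    also have "\<dots> = (\<Sum>N\<in>?S. if X = N then f N else 0)"
    proof (rule sum.cong[OF refl])
      fix N assume "N \<in> ?S"
      then have "N \<in> iso_classes K A" using S(3) by blast
      from hall_count_zero(1)[OF X this] show "f N * real (hall_count X ?o N) = (if X = N then f N else 0)"
        by simp
    qed
    also have "\<dots> = f X" using S(1) by (simp only: sum.delta' sum.delta) simp
    finally have 1: "(\<one>\<^bsub>H\<^esub> \<otimes>\<^bsub>H\<^esub> f) X = f X" .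
    have "(f \<otimes>\<^bsub>H\<^esub> \<one>\<^bsub>H\<^esub>) X = (\<Sum>N\<in>?S. f N * real (hall_count X N ?o))"
      using hall_mult_eq[OF assms hall_basis_closed[OF fd_zero_mod] X S, of "{?o}"] oI o
      by (simp add: hall_basis_simp)
    also have "\<dots> = (\<Sum>N\<in>?S. if X = N then f N else 0)"
    proof (rule sum.cong[OF refl])
      fix N assume "N \<in> ?S"
      then have "N \<in> iso_classes K A" using S(3) by blast
      from hall_count_zero(2)[OF X this] show "f N * real (hall_count X N ?o) = (if X = N then f N else 0)"
        by simp
    qed
    also have "\<dots> = f X" using S(1) by (simp only: sum.delta' sum.delta) simp
    finally show ?thesis using 1 by simp
  next
    case False
    moreover have "f X = 0" using f False by auto
    ultimately show ?thesis by (simp add: hall_mult_outside)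
  qed
  show "\<one>\<^bsub>H\<^esub> \<otimes>\<^bsub>H\<^esub> f = f" using * by (intro ext) simp
  show "f \<otimes>\<^bsub>H\<^esub> \<one>\<^bsub>H\<^esub> = f" using * by (intro ext) simp
qed

lemma hall_add_closed:
  assumes "f \<in> carrier H" "g \<in> carrier H" shows "f \<oplus>\<^bsub>H\<^esub> g \<in> carrier H"
proof -
  note f = assms(1)[unfolded hall_carrier_iff] and g = assms(2)[unfolded hall_carrier_iff]
  have s: "supp (f \<oplus>\<^bsub>H\<^esub> g) \<subseteq> supp f \<union> supp g" by auto
  moreover have "finite (supp f \<union> supp g)" using f g by simp
  ultimately have "finite (supp (f \<oplus>\<^bsub>H\<^esub> g))" by (rule finite_subset)
  then show ?thesis unfolding hall_carrier_iff using f g s by (simp add: Z_v_add) blast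
qed

lemma hall_neg_closed:
  assumes "f \<in> carrier H" shows "(\<lambda>X. - f X) \<in> carrier H"
  using assms unfolding hall_carrier_iff by (simp add: Z_v_minus)

theorem hall_algebra_ring:
  assumes "finitary K A" shows "ring H"
proof (rule ringI)
  show "abelian_group H"
  proof (rule abelian_groupI)
    show "\<zero>\<^bsub>H\<^esub> \<in> carrier H" by (simp add: hall_carrier_iff Z_v_0)
    fix f assume f: "f \<in> carrier H"
    have "(\<lambda>X. - f X) \<oplus>\<^bsub>H\<^esub> f = \<zero>\<^bsub>H\<^esub>" by (rule ext) simp
    then show "\<exists>y\<in>carrier H. y \<oplus>\<^bsub>H\<^esub> f = \<zero>\<^bsub>H\<^esub>" using hall_neg_closed[OF f] by (rule bexI)
  qed (simp_all add: hall_add_closed fun_eq_iff)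
  show "monoid H"
    using hall_one hall_mult_closed[OF assms] hall_mult_assoc[OF assms] hall_basis_closed[OF fd_zero_mod]
    by (intro monoidI) simp_all
  fix f g h assume fgh: "f \<in> carrier H" "g \<in> carrier H" "h \<in> carrier H"
  note f = fgh(1)[unfolded hall_carrier_iff] and g = fgh(2)[unfolded hall_carrier_iff]
    and h = fgh(3)[unfolded hall_carrier_iff]
  let ?S = "supp f \<union> supp g"
  have S: "finite ?S" "?S \<subseteq> iso_classes K A" "supp f \<subseteq> ?S" "supp g \<subseteq> ?S" "supp (f \<oplus>\<^bsub>H\<^esub> g) \<subseteq> ?S"
    using f g by auto
  have hh: "finite (supp h)" "supp h \<subseteq> supp h" "supp h \<subseteq> iso_classes K A" using h by auto
  show "(f \<oplus>\<^bsub>H\<^esub> g) \<otimes>\<^bsub>H\<^esub> h = f \<otimes>\<^bsub>H\<^esub> h \<oplus>\<^bsub>H\<^esub> g \<otimes>\<^bsub>H\<^esub> h"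
  proof
    fix X
    show "((f \<oplus>\<^bsub>H\<^esub> g) \<otimes>\<^bsub>H\<^esub> h) X = (f \<otimes>\<^bsub>H\<^esub> h \<oplus>\<^bsub>H\<^esub> g \<otimes>\<^bsub>H\<^esub> h) X"
    proof (cases "X \<in> iso_classes K A")
      case X: True
      show ?thesis
        unfolding hall_simps hall_mult_eq[OF hall_add_closed[OF fgh(1,2)] fgh(3) X S(1,5,2) hh]
          hall_mult_eq[OF fgh(1,3) X S(1,3,2) hh] hall_mult_eq[OF fgh(2,3) X S(1,4,2) hh]
        by (simp add: sum.distrib algebra_simps)
    qed (simp add: hall_mult_outside)
  qed
  show "h \<otimes>\<^bsub>H\<^esub> (f \<oplus>\<^bsub>H\<^esub> g) = h \<otimes>\<^bsub>H\<^esub> f \<oplus>\<^bsub>H\<^esub> h \<otimes>\<^bsub>H\<^esub> g"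
  proof
    fix X
    show "(h \<otimes>\<^bsub>H\<^esub> (f \<oplus>\<^bsub>H\<^esub> g)) X = (h \<otimes>\<^bsub>H\<^esub> f \<oplus>\<^bsub>H\<^esub> h \<otimes>\<^bsub>H\<^esub> g) X"
    proof (cases "X \<in> iso_classes K A")
      case X: True
      show ?thesis
        unfolding hall_simps hall_mult_eq[OF fgh(3) hall_add_closed[OF fgh(1,2)] X hh S(1,5,2)]
          hall_mult_eq[OF fgh(3,1) X hh S(1,3,2)] hall_mult_eq[OF fgh(3,2) X hh S(1,4,2)]
        by (simp add: sum.distrib algebra_simps)
    qed (simp add: hall_mult_outside)
  qed
qed

end


section \<open>Ideals spanned by modules with many summands\<close>

context finite_field_algebra
begin

lemma num_summands_iso:
  assumes "fd_module K A M" "fd_module K A N" "mod_isomorphic A M N"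
  shows "num_summands A N = num_summands A M"
proof -
  interpret M: lmod A M using fdD(1)[OF assms(1)] .
  interpret N: lmod A N using fdD(1)[OF assms(2)] .
  obtain h where h: "h \<in> mod_hom A M N" "bij_betw h (carrier M) (carrier N)"
    using assms(3) by (rule mod_isomorphicE)
  have "N.indec_sum (num_summands A M) (h ` carrier M)"
    using M.indec_sum_image[OF N.lmod_axioms M.indec_sum_num_summands[OF fdD(2)[OF assms(1)]], of h] h
    by (simp add: bij_betw_def)
  then show ?thesis using N.num_summands_eq[OF _ fdD(2)[OF assms(2)]] h(2) by (simp add: bij_betw_def)
qed

lemma num_summands_class_rep:
  "fd_module K A M \<Longrightarrow> num_summands A (class_rep (iso_class K A M)) = num_summands A M"
  using num_summands_iso[OF _ class_rep(1)[OF iso_class_in] class_rep_iso] by simp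

text \<open>Isomorphic modules have the same number of summands, so membership can be read off from
  the support.\<close>

lemma hall_D_iff:
  "f \<in> hall_D r K A \<longleftrightarrow> f \<in> carrier H \<and> (\<forall>X. f X \<noteq> 0 \<longrightarrow> r + 1 \<le> num_summands A (class_rep X))"
proof
  assume "f \<in> hall_D r K A"
  then obtain c S where S: "finite S" "\<forall>M\<in>S. fd_module K A M \<and> r + 1 \<le> num_summands A M \<and> c M \<in> Z_v K"
    and f: "f = (\<lambda>X. \<Sum>M\<in>S. c M * hall_basis K A M X)"
    unfolding hall_D_def by (elim CollectE exE conjE)
  have s: "\<exists>M\<in>S. X = iso_class K A M" if "f X \<noteq> 0" for X
  proof (rule ccontr)
    assume n: "\<not> ?thesis"
    have "f X = 0" unfolding f by (rule sum.neutral) (use n in \<open>auto simp: hall_basis_simp\<close>)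
    then show False using that by simp
  qed
  have sub: "supp f \<subseteq> iso_class K A ` S" using s by blast
  have "f X \<in> Z_v K" for X
    unfolding f using S(2) by (intro Z_v_sum Z_v_mult) (simp_all add: hall_basis_simp Z_v_0 Z_v_1)
  moreover have "finite (supp f)" using finite_subset[OF sub finite_imageI[OF S(1)]] .
  moreover have "supp f \<subseteq> iso_classes K A"
    by (rule subset_trans[OF sub image_subsetI]) (use S(2) in \<open>simp add: iso_class_in\<close>)
  moreover have "r + 1 \<le> num_summands A (class_rep X)" if nz: "f X \<noteq> 0" for X
  proof -
    obtain M where M: "M \<in> S" "X = iso_class K A M" using s[OF nz] by (rule bexE)
    have fM: "fd_module K A M" "r + 1 \<le> num_summands A M" using S(2) M(1) by simp_all
    show ?thesis unfolding M(2) num_summands_class_rep[OF fM(1)] by (rule fM(2))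
  qed
  ultimately show "f \<in> carrier H \<and> (\<forall>X. f X \<noteq> 0 \<longrightarrow> r + 1 \<le> num_summands A (class_rep X))"
    unfolding hall_carrier_iff by simp
next
  assume R: "f \<in> carrier H \<and> (\<forall>X. f X \<noteq> 0 \<longrightarrow> r + 1 \<le> num_summands A (class_rep X))"
  then have f: "finite (supp f)" "supp f \<subseteq> iso_classes K A" "\<And>X. f X \<in> Z_v K"
    unfolding hall_carrier_iff by simp_all
  let ?S = "class_rep ` supp f" and ?c = "\<lambda>M. f (iso_class K A M)"
  have rep: "class_rep X \<in> ?S \<and> fd_module K A (class_rep X) \<and> iso_class K A (class_rep X) = X" if "X \<in> supp f" for X
    using class_rep[OF subsetD[OF f(2) that]] that by simp
  have inj: "inj_on class_rep (supp f)"
  proof (rule inj_onI)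
    fix X Y assume XY: "X \<in> supp f" "Y \<in> supp f" "class_rep X = class_rep Y"
    have "X = iso_class K A (class_rep X)" using rep[OF XY(1)] by simp
    also have "\<dots> = Y" unfolding XY(3) using rep[OF XY(2)] by simp
    finally show "X = Y" .
  qed
  have "f X = (\<Sum>M\<in>?S. ?c M * hall_basis K A M X)" for X
  proof -
    have "(\<Sum>M\<in>?S. ?c M * hall_basis K A M X) = (\<Sum>Y\<in>supp f. ?c (class_rep Y) * hall_basis K A (class_rep Y) X)"
      by (rule sum.reindex_cong[OF inj refl refl])
    also have "\<dots> = (\<Sum>Y\<in>supp f. if X = Y then f Y else 0)"
    proof (rule sum.cong[OF refl])
      fix Y assume "Y \<in> supp f"
      then show "?c (class_rep Y) * hall_basis K A (class_rep Y) X = (if X = Y then f Y else 0)"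
        using rep[of Y] by (simp add: hall_basis_simp)
    qed
    also have "\<dots> = f X" using f(1) by (simp only: sum.delta') simp
    finally show ?thesis by simp
  qed
  moreover have "\<forall>M\<in>?S. fd_module K A M \<and> r + 1 \<le> num_summands A M \<and> ?c M \<in> Z_v K"
  proof
    fix M assume "M \<in> ?S"
    then obtain X where X: "X \<in> supp f" "M = class_rep X" by (rule imageE) simp
    then show "fd_module K A M \<and> r + 1 \<le> num_summands A M \<and> ?c M \<in> Z_v K"
      using rep[OF X(1)] R f(3) by simp
  qed
  ultimately show "f \<in> hall_D r K A"
    unfolding hall_D_def using finite_imageI[OF f(1), of class_rep]
    by (intro CollectI exI[of _ ?c] exI[of _ ?S] conjI ext)
qed

lemma hall_D_ideal_iff:
  assumes "finitary K A"
  shows "ideal (hall_D r K A) H \<longleftrightarrow>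
    (\<forall>f\<in>hall_D r K A. \<forall>g\<in>carrier H. g \<otimes>\<^bsub>H\<^esub> f \<in> hall_D r K A \<and> f \<otimes>\<^bsub>H\<^esub> g \<in> hall_D r K A)"
proof
  assume "ideal (hall_D r K A) H"
  then interpret ideal "hall_D r K A" H .
  show "\<forall>f\<in>hall_D r K A. \<forall>g\<in>carrier H. g \<otimes>\<^bsub>H\<^esub> f \<in> hall_D r K A \<and> f \<otimes>\<^bsub>H\<^esub> g \<in> hall_D r K A"
    using I_l_closed I_r_closed by simp
next
  assume R: "\<forall>f\<in>hall_D r K A. \<forall>g\<in>carrier H. g \<otimes>\<^bsub>H\<^esub> f \<in> hall_D r K A \<and> f \<otimes>\<^bsub>H\<^esub> g \<in> hall_D r K A"
  interpret H: ring H by (rule hall_algebra_ring[OF assms])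
  show "ideal (hall_D r K A) H"
  proof (rule idealI[OF H.ring_axioms])
    show "subgroup (hall_D r K A) (add_monoid H)"
    proof (rule subgroup.intro)
      show "hall_D r K A \<subseteq> carrier (add_monoid H)" using hall_D_iff by auto
      show "\<one>\<^bsub>add_monoid H\<^esub> \<in> hall_D r K A" using H.zero_closed by (simp add: hall_D_iff)
      fix f assume f: "f \<in> hall_D r K A"
      then have fc: "f \<in> carrier H" by (simp add: hall_D_iff)
      have "\<ominus>\<^bsub>H\<^esub> f = (\<lambda>X. - f X)"
        by (rule H.minus_equality[OF _ fc hall_neg_closed[OF fc]]) (simp add: fun_eq_iff)
      moreover have "(\<lambda>X. - f X) \<in> hall_D r K A" using f hall_neg_closed[OF fc] by (simp add: hall_D_iff)
      ultimately show "inv\<^bsub>add_monoid H\<^esub> f \<in> hall_D r K A" by (simp add: a_inv_def)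
      fix g assume g: "g \<in> hall_D r K A"
      have "r + 1 \<le> num_summands A (class_rep X)" if "(f \<oplus>\<^bsub>H\<^esub> g) X \<noteq> 0" for X
      proof -
        have "f X \<noteq> 0 \<or> g X \<noteq> 0" using that by auto
        then show ?thesis using f g unfolding hall_D_iff by auto
      qed
      then show "f \<otimes>\<^bsub>add_monoid H\<^esub> g \<in> hall_D r K A"
        using f g hall_add_closed[of f g] by (simp add: hall_D_iff del: hall_simps)
    qed
  qed (use R in auto)
qed

text \<open>The summands of \<open>X\<close> are uniserial; \<open>N\<close> is a submodule and \<open>M\<close> a quotient of \<open>X\<close>.\<close>

lemma serial_hall_count_summands:
  assumes "serial_algebra K A" "X \<in> iso_classes K A" "M \<in> iso_classes K A" "N \<in> iso_classes K A"
    "hall_count X M N \<noteq> 0"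
  shows "num_summands A (class_rep M) \<le> num_summands A (class_rep X)"
    "num_summands A (class_rep N) \<le> num_summands A (class_rep X)"
proof -
  let ?X = "class_rep X" and ?M = "class_rep M" and ?N = "class_rep N"
  note rep = class_rep(1)[OF assms(2)] class_rep(1)[OF assms(3)] class_rep(1)[OF assms(4)]
  interpret X: lmod A ?X using fdD(1)[OF rep(1)] .
  interpret M: lmod A ?M using fdD(1)[OF rep(2)] .
  interpret N: lmod A ?N using fdD(1)[OF rep(3)] .
  have chain: "X.chain_sub U" if U: "X.indec U" for U
  proof -
    have s: "submodule U A ?X" using U by (simp add: X.indec_def)
    have "indecomposable_mod A (sub_mod ?X U)" using X.indecomposable_sub_mod_iff[OF s] U by simp
    then have "uniserial_mod A (sub_mod ?X U)"
      using assms(1) fd_sub_mod[OF rep(1) s] unfolding serial_algebra_def by simp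
    then show ?thesis using X.uniserial_sub_mod_iff[OF s] by simp
  qed
  note decX = X.indec_sum_num_summands[OF fdD(2)[OF rep(1)]]
  obtain U where "U \<in> hall_submodules A ?X ?M ?N" using assms(5) by (rule hall_submodules_nonempty)
  then have U: "submodule U A ?X" "mod_isomorphic A (sub_mod ?X U) ?N" "\<exists>g. quotient_map A ?X ?M U g"
    by (simp_all add: hall_submodules_def)
  obtain g where g: "quotient_map A ?X ?M U g" using U(3) by (rule exE)
  note g' = quotient_mapD[OF g]
  show "num_summands A ?M \<le> num_summands A ?X"
    by (rule X.serial_quotient_summands[OF M.lmod_axioms chain decX, of g])
      (simp_all add: g' M.indec_sum_num_summands[OF fdD(2)[OF rep(2)]])
  obtain h where h: "h \<in> mod_hom A ?N (sub_mod ?X U)" "bij_betw h (carrier ?N) (carrier (sub_mod ?X U))"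
    using mod_isomorphic_sym[OF X.lmod_sub_mod[OF U(1)] N.lmod_axioms U(2)] by (rule mod_isomorphicE)
  have "h \<in> mod_hom A ?N ?X" by (rule mod_hom_from_into_sub[OF h(1) X.submoduleD(1)[OF U(1)]])
  then have "X.indec_sum (num_summands A ?N) (h ` carrier ?N)"
    using N.indec_sum_image[OF X.lmod_axioms N.indec_sum_num_summands[OF fdD(2)[OF rep(3)]], of h] h(2)
    by (simp add: bij_betw_def)
  then have "X.indec_sum (num_summands A ?N) U" using h(2) by (simp add: bij_betw_def)
  then show "num_summands A ?N \<le> num_summands A ?X"
    by (rule X.serial_submodule_summands[OF chain decX _ X.submoduleD(1)[OF U(1)], rotated])
qed

lemma serial_imp_ideal:
  assumes "finitary K A" "serial_algebra K A"
  shows "ideal (hall_D r K A) H"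
  unfolding hall_D_ideal_iff[OF assms(1)]
proof (intro ballI conjI)
  fix f g assume fD: "f \<in> hall_D r K A" and g: "g \<in> carrier H"
  then have f: "f \<in> carrier H" "\<And>X. f X \<noteq> 0 \<Longrightarrow> r + 1 \<le> num_summands A (class_rep X)"
    by (simp_all add: hall_D_iff)
  note fs = f(1)[unfolded hall_carrier_iff] and gs = g[unfolded hall_carrier_iff]
  show "g \<otimes>\<^bsub>H\<^esub> f \<in> hall_D r K A" unfolding hall_D_iff
  proof (intro conjI allI impI hall_mult_closed[OF assms(1) g f(1)])
    fix X assume nz: "(g \<otimes>\<^bsub>H\<^esub> f) X \<noteq> 0"
    obtain M N where *: "X \<in> iso_classes K A" "M \<in> supp g" "N \<in> supp f" "hall_count X M N \<noteq> 0"
      using hall_mult_support[OF g f(1) nz] by (elim conjE bexE)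
    have "M \<in> iso_classes K A" "N \<in> iso_classes K A" using * fs gs by auto
    from serial_hall_count_summands(2)[OF assms(2) *(1) this *(4)]
    show "r + 1 \<le> num_summands A (class_rep X)" using f(2)[of N] *(3) by simp
  qed
  show "f \<otimes>\<^bsub>H\<^esub> g \<in> hall_D r K A" unfolding hall_D_iff
  proof (intro conjI allI impI hall_mult_closed[OF assms(1) f(1) g])
    fix X assume nz: "(f \<otimes>\<^bsub>H\<^esub> g) X \<noteq> 0"
    obtain M N where *: "X \<in> iso_classes K A" "M \<in> supp f" "N \<in> supp g" "hall_count X M N \<noteq> 0"
      using hall_mult_support[OF f(1) g nz] by (elim conjE bexE)
    have "M \<in> iso_classes K A" "N \<in> iso_classes K A" using * fs gs by auto
    from serial_hall_count_summands(1)[OF assms(2) *(1) this *(4)]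
    show "r + 1 \<le> num_summands A (class_rep X)" using f(2)[of M] *(2) by simp
  qed
qed

lemma hall_basis_mult_nonzero:
  assumes "fd_module K A X" "fd_module K A M" "submodule U A X" "quotient_map A X M U g"
  shows "(hall_basis K A M \<otimes>\<^bsub>H\<^esub> hall_basis K A (sub_mod X U)) (iso_class K A X) \<noteq> 0"
proof -
  let ?N = "sub_mod X U"
  have N: "fd_module K A ?N" by (rule fd_sub_mod[OF assms(1,3)])
  let ?X' = "iso_class K A X" and ?M' = "iso_class K A M" and ?N' = "iso_class K A ?N"
  note I = iso_class_in[OF assms(1)] iso_class_in[OF assms(2)] iso_class_in[OF N]
  have s: "supp (hall_basis K A L) = {iso_class K A L}" for L by (auto simp: hall_basis_simp)
  have "(hall_basis K A M \<otimes>\<^bsub>H\<^esub> hall_basis K A ?N) ?X' = real (hall_count ?X' ?M' ?N')"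
    using hall_mult_eq[OF hall_basis_closed[OF assms(2)] hall_basis_closed[OF N] I(1), of "{?M'}" "{?N'}"] I s
    by (simp add: hall_basis_simp)
  moreover have "U \<in> hall_submodules A X (class_rep ?M') (class_rep ?N')"
  proof -
    obtain k where k: "k \<in> mod_hom A M (class_rep ?M')" "bij_betw k (carrier M) (carrier (class_rep ?M'))"
      using class_rep_iso[OF assms(2)] by (rule mod_isomorphicE)
    have "quotient_map A X (class_rep ?M') U (\<lambda>x. k (g x))"
      by (rule quotient_map_comp_iso[OF fdD(1)[OF assms(2)] fdD(1)[OF class_rep(1)[OF I(2)]] assms(4) k])
    then show ?thesis unfolding hall_submodules_def
      using assms(3) class_rep_iso[OF N] by (intro CollectI conjI exI[of _ "\<lambda>x. k (g x)"])
  qed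
  moreover have "finite (hall_submodules A X (class_rep ?M') (class_rep ?N'))"
    unfolding hall_submodules_def by (rule finite_submodules[OF assms(1)])
  ultimately show ?thesis
    using hall_submodules_class[OF assms(1) I(2,3)] by (metis card_eq_0_iff empty_iff of_nat_eq_0_iff)
qed

text \<open>A middle term \<open>X\<close> with \<open>r\<close> summands, one end of which has more. It is the obstruction to \<open>D\<^sub>r\<close>
  being an ideal.\<close>

definition summand_gap :: "nat \<Rightarrow> 'a nmod \<Rightarrow> nat set \<Rightarrow> bool" where
  "summand_gap r X U \<longleftrightarrow> fd_module K A X \<and> submodule U A X \<and> num_summands A X = r \<and>
     (r < num_summands A (sub_mod X U) \<or>
      (\<exists>(Q :: 'a nmod) g. fd_module K A Q \<and> quotient_map A X Q U g \<and> r < num_summands A Q))"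

text \<open>The class of the end with more than \<open>r\<close> summands belongs to \<open>D\<^sub>r\<close>, but its product with the class of
  the other end involves \<open>[X]\<close>.\<close>

lemma summand_gap_not_ideal:
  assumes "finitary K A" "summand_gap r X U"
  shows "\<not> ideal (hall_D r K A) H"
proof
  assume "ideal (hall_D r K A) H"
  note I = this[unfolded hall_D_ideal_iff[OF assms(1)]]
  note gap = assms(2)[unfolded summand_gap_def]
  have X: "fd_module K A X" "submodule U A X" "num_summands A X = r" using gap by auto
  note N = fd_sub_mod[OF X(1,2)]
  have D: "hall_basis K A L \<in> hall_D r K A" if "fd_module K A L" "r < num_summands A L" for L
    unfolding hall_D_iff using hall_basis_closed[OF that(1)] num_summands_class_rep[OF that(1)] that(2)
    by (simp add: hall_basis_simp)
  have out: "f (iso_class K A X) = 0" if "f \<in> hall_D r K A" for f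
    using that num_summands_class_rep[OF X(1)] X(3) unfolding hall_D_iff by force
  from gap consider "r < num_summands A (sub_mod X U)"
    | "\<exists>(Q :: 'a nmod) g. fd_module K A Q \<and> quotient_map A X Q U g \<and> r < num_summands A Q" by auto
  then show False
  proof cases
    case 1
    obtain Q :: "'a nmod" and g where Q: "fd_module K A Q" "quotient_map A X Q U g"
      by (rule fd_quotient_exists[OF X(1,2)])
    have "hall_basis K A Q \<otimes>\<^bsub>H\<^esub> hall_basis K A (sub_mod X U) \<in> hall_D r K A"
      using I D[OF N 1] hall_basis_closed[OF Q(1)] by simp
    then show False using out hall_basis_mult_nonzero[OF X(1) Q(1) X(2) Q(2)] by simp
  next
    case 2
    then obtain Q :: "'a nmod" and g where Q: "fd_module K A Q" "quotient_map A X Q U g" "r < num_summands A Q"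
      by (elim exE conjE)
    have "hall_basis K A Q \<otimes>\<^bsub>H\<^esub> hall_basis K A (sub_mod X U) \<in> hall_D r K A"
      using I D[OF Q(1,3)] hall_basis_closed[OF N] by simp
    then show False using out hall_basis_mult_nonzero[OF X(1) Q(1) X(2) Q(2)] by simp
  qed
qed

lemma num_summands_sub_mod:
  assumes "fd_module K A X" "submodule U A X" "lmod.indec_sum A X n U"
  shows "num_summands A (sub_mod X U) = n"
proof -
  interpret X: lmod A X using fdD(1)[OF assms(1)] .
  interpret U: lmod A "sub_mod X U" by (rule X.lmod_sub_mod[OF assms(2)])
  show ?thesis
    by (rule U.num_summands_eq)
      (use X.indec_sum_sub_mod_iff[OF assms(2) order_refl] assms(3) fdD(2)[OF fd_sub_mod[OF assms(1,2)]] in simp_all)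
qed

lemma indecomposable_num_summands:
  assumes "fd_module K A X" "indecomposable_mod A X" shows "num_summands A X = 1"
proof -
  interpret X: lmod A X using fdD(1)[OF assms(1)] .
  show ?thesis
    using X.num_summands_eq[OF X.indec_sum_1 fdD(2)[OF assms(1)]] X.indecomposable_mod_iff assms(2) by simp
qed

text \<open>Passing to \<open>Q = M / (V \<inter> V')\<close> for incomparable submodules \<open>V\<close>, \<open>V'\<close> makes them independent and
  leaves them nonzero. If \<open>Q\<close> is decomposable, then \<open>M \<rightarrow> Q\<close> is the gap, and otherwise the
  inclusion of the sum of the two images in \<open>Q\<close>.\<close>

lemma summand_gap_of_not_uniserial:
  fixes M :: "'a nmod"
  assumes "fd_module K A M" "indecomposable_mod A M" "\<not> uniserial_mod A M"
  shows "\<exists>X U. summand_gap 1 X U"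
proof -
  interpret M: lmod A M using fdD(1)[OF assms(1)] .
  obtain V V' where V: "submodule V A M" "submodule V' A M" "\<not> V \<subseteq> V'" "\<not> V' \<subseteq> V"
    using assms(3) unfolding uniserial_mod_def by auto
  note W = M.submodule_Int[OF V(1,2)]
  obtain Q :: "'a nmod" and q where Q: "fd_module K A Q" "quotient_map A M Q (V \<inter> V') q"
    by (rule fd_quotient_exists[OF assms(1) W])
  interpret Q: lmod A Q using fdD(1)[OF Q(1)] .
  note q = quotient_mapD[OF Q(2)]
  note s1 = indecomposable_num_summands[OF assms(1,2)]
  show ?thesis
  proof (cases "1 < num_summands A Q")
    case True
    have "summand_gap 1 M (V \<inter> V')" unfolding summand_gap_def
      using assms(1) W s1 True Q by auto
    then show ?thesis by (intro exI)
  next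
    case False
    note im = M.submodule_image[OF Q.lmod_axioms q(1) V(1)] M.submodule_image[OF Q.lmod_axioms q(1) V(2)]
    have nz: "q ` P \<noteq> {\<zero>\<^bsub>Q\<^esub>}" if P: "submodule P A M" "\<not> P \<subseteq> V \<inter> V'" for P
    proof
      assume z: "q ` P = {\<zero>\<^bsub>Q\<^esub>}"
      obtain x where x: "x \<in> P" "x \<notin> V \<inter> V'" using P(2) by auto
      have "q x = \<zero>\<^bsub>Q\<^esub>" using imageI[OF x(1), of q] unfolding z by simp
      then show False using q(3)[OF M.submoduleD(3)[OF P(1) x(1)]] x(2) by simp
    qed
    have nzV: "q ` V \<noteq> {\<zero>\<^bsub>Q\<^esub>}" "q ` V' \<noteq> {\<zero>\<^bsub>Q\<^esub>}" using nz[OF V(1)] nz[OF V(2)] V(3,4) by auto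
    have d: "Q.direct_sum (q ` V <+>\<^bsub>Q\<^esub> q ` V') (q ` V) (q ` V')"
    proof (rule Q.direct_sumI[OF im Q.submodule_sum[OF im] Q.sum_upper1[OF im] Q.sum_upper2[OF im] _ order_refl])
      fix y assume y: "y \<in> q ` V" "y \<in> q ` V'"
      obtain x where x: "x \<in> V" "y = q x" using y(1) by (rule imageE) simp
      obtain x' where x': "x' \<in> V'" "y = q x'" using y(2) by (rule imageE) simp
      note c = M.submoduleD(3)[OF V(1) x(1)] M.submoduleD(3)[OF V(2) x'(1)]
      have "q (x \<ominus>\<^bsub>M\<^esub> x') = \<zero>\<^bsub>Q\<^esub>" using M.hom_eq_iff[OF Q.lmod_axioms q(1) c] x(2) x'(2) by simp
      then have "x \<ominus>\<^bsub>M\<^esub> x' \<in> V'" using q(3)[OF M.M.minus_closed[OF c]] by simp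
      then have "(x \<ominus>\<^bsub>M\<^esub> x') \<oplus>\<^bsub>M\<^esub> x' \<in> V'" using M.submoduleD(4)[OF V(2) _ x'(1)] by simp
      moreover have "(x \<ominus>\<^bsub>M\<^esub> x') \<oplus>\<^bsub>M\<^esub> x' = x" using c by (simp add: a_minus_def M.M.a_assoc M.M.l_neg)
      ultimately have "x \<in> V \<inter> V'" using x(1) by simp
      then show "y = \<zero>\<^bsub>Q\<^esub>" using q(3)[OF c(1)] x(2) by simp
    qed
    note e = Q.direct_sumD[OF d]
    have fin: "finite (q ` V)" "finite (q ` V')"
      using finite_subset[OF Q.submoduleD(1)[OF im(1)] fdD(2)[OF Q(1)]]
        finite_subset[OF Q.submoduleD(1)[OF im(2)] fdD(2)[OF Q(1)]] .
    obtain a b where ab: "Q.indec_sum a (q ` V)" "Q.indec_sum b (q ` V')"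
      using Q.indec_sum_exists[OF im(1) fin(1)] Q.indec_sum_exists[OF im(2) fin(2)] by (elim exE)
    have "a \<noteq> 0" "b \<noteq> 0" using ab nzV Q.indec_sum_0_iff by metis+
    then have "1 < a + b" by simp
    moreover have "num_summands A (sub_mod Q (q ` V <+>\<^bsub>Q\<^esub> q ` V')) = a + b"
      by (rule num_summands_sub_mod[OF Q(1) e(1) Q.indec_sum_sum[OF ab d]])
    moreover have "num_summands A Q \<noteq> 0"
    proof
      assume "num_summands A Q = 0"
      then have "carrier Q = {\<zero>\<^bsub>Q\<^esub>}" using Q.indec_sum_num_summands[OF fdD(2)[OF Q(1)]] Q.indec_sum_0_iff by simp
      then show False using nzV(1) Q.submoduleD(1,2)[OF im(1)] by blast
    qed
    ultimately have "summand_gap 1 Q (q ` V <+>\<^bsub>Q\<^esub> q ` V')"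
      unfolding summand_gap_def using Q(1) e(1) False by auto
    then show ?thesis by (intro exI)
  qed
qed

definition dsum :: "'a nmod \<Rightarrow> 'a nmod \<Rightarrow> 'a nmod" where
  "dsum X S = ext_mod X S (\<lambda>p \<in> carrier A \<times> carrier S. \<zero>\<^bsub>X\<^esub>)"

lemma dsum_simps:
  "carrier (dsum X S) = prod_encode ` (carrier X \<times> carrier S)"
  "\<zero>\<^bsub>dsum X S\<^esub> = prod_encode (\<zero>\<^bsub>X\<^esub>, \<zero>\<^bsub>S\<^esub>)"
  "prod_encode (n, m) \<oplus>\<^bsub>dsum X S\<^esub> prod_encode (n', m') = prod_encode (n \<oplus>\<^bsub>X\<^esub> n', m \<oplus>\<^bsub>S\<^esub> m')"
  "lmod A X \<Longrightarrow> a \<in> carrier A \<Longrightarrow> n \<in> carrier X \<Longrightarrow> m \<in> carrier S \<Longrightarrow>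
    a \<odot>\<^bsub>dsum X S\<^esub> prod_encode (n, m) = prod_encode (a \<odot>\<^bsub>X\<^esub> n, a \<odot>\<^bsub>S\<^esub> m)"
proof -
  show "a \<odot>\<^bsub>dsum X S\<^esub> prod_encode (n, m) = prod_encode (a \<odot>\<^bsub>X\<^esub> n, a \<odot>\<^bsub>S\<^esub> m)"
    if "lmod A X" "a \<in> carrier A" "n \<in> carrier X" "m \<in> carrier S"
  proof -
    interpret X: lmod A X by fact
    show ?thesis using that(2-4) by (simp add: dsum_def ext_mod_simps X.smult_closed)
  qed
qed (simp_all add: dsum_def ext_mod_simps)

lemma dsum_fd:
  assumes "fd_module K A X" "fd_module K A S"
  shows "fd_module K A (dsum X S)"
proof -
  interpret X: lmod A X using fdD(1)[OF assms(1)] .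
  interpret S: lmod A S using fdD(1)[OF assms(2)] .
  have "(\<lambda>p \<in> carrier A \<times> carrier S. \<zero>\<^bsub>X\<^esub>) \<in> derivations A S X"
    by (rule derivationsI) (simp_all add: S.smult_closed)
  then show ?thesis unfolding fd_iff dsum_simps(1)
    using lmod_ext_mod[OF S.lmod_axioms X.lmod_axioms] fdD(2)[OF assms(1)] fdD(2)[OF assms(2)]
    by (simp add: dsum_def)
qed

lemma dsum_dec:
  assumes "fd_module K A X" "fd_module K A S" "submodule U A X" "lmod.indec_sum A X m U" "lmod.indec_sum A S n (carrier S)"
  shows "lmod.indec_sum A (dsum X S) (m + n) (prod_encode ` (U \<times> carrier S))"
proof -
  interpret X: lmod A X using fdD(1)[OF assms(1)] .
  interpret S: lmod A S using fdD(1)[OF assms(2)] .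
  interpret Z: lmod A "dsum X S" using fdD(1)[OF dsum_fd[OF assms(1,2)]] .
  note U = X.submoduleD[OF assms(3)]
  let ?i = "\<lambda>x. prod_encode (x, \<zero>\<^bsub>S\<^esub>)" and ?j = "\<lambda>s. prod_encode (\<zero>\<^bsub>X\<^esub>, s)"
  have i: "?i \<in> mod_hom A X (dsum X S)" and j: "?j \<in> mod_hom A S (dsum X S)"
    by (auto intro!: mod_homI simp: dsum_simps(1-3) dsum_simps(4)[OF X.lmod_axioms])
  note im = X.submodule_image[OF Z.lmod_axioms i assms(3)] S.submodule_image[OF Z.lmod_axioms j S.submodule_carrier]
  have sum: "prod_encode ` (U \<times> carrier S) = ?i ` U <+>\<^bsub>dsum X S\<^esub> ?j ` carrier S"
  proof (intro equalityI subsetI)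
    fix z assume "z \<in> prod_encode ` (U \<times> carrier S)"
    then obtain x s where z: "x \<in> U" "s \<in> carrier S" "z = prod_encode (x, s)" by auto
    then have "z = ?i x \<oplus>\<^bsub>dsum X S\<^esub> ?j s" using U(3) by (simp add: dsum_simps)
    then show "z \<in> ?i ` U <+>\<^bsub>dsum X S\<^esub> ?j ` carrier S"
      using Z.set_addI[OF imageI[OF z(1), of ?i] imageI[OF z(2), of ?j]] by simp
  next
    fix z assume "z \<in> ?i ` U <+>\<^bsub>dsum X S\<^esub> ?j ` carrier S"
    then obtain x s where z: "x \<in> U" "s \<in> carrier S" "z = ?i x \<oplus>\<^bsub>dsum X S\<^esub> ?j s" by (auto elim!: Z.set_addE)
    then show "z \<in> prod_encode ` (U \<times> carrier S)" using U(3) by (simp add: dsum_simps)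
  qed
  have d: "Z.direct_sum (prod_encode ` (U \<times> carrier S)) (?i ` U) (?j ` carrier S)"
    unfolding sum
  proof (rule Z.direct_sumI[OF im Z.submodule_sum[OF im] Z.sum_upper1[OF im] Z.sum_upper2[OF im] _ order_refl])
    fix z assume "z \<in> ?i ` U" "z \<in> ?j ` carrier S"
    then show "z = \<zero>\<^bsub>dsum X S\<^esub>" by (auto simp: dsum_simps)
  qed
  have "Z.indec_sum m (?i ` U)"
    by (rule X.indec_sum_image[OF Z.lmod_axioms assms(4) mod_hom_restrict[OF i U(1)]]) (simp add: inj_on_def)
  moreover have "Z.indec_sum n (?j ` carrier S)"
    by (rule S.indec_sum_image[OF Z.lmod_axioms assms(5) mod_hom_restrict[OF j order_refl]]) (simp add: inj_on_def)
  ultimately show ?thesis by (rule Z.indec_sum_sum[OF _ _ d])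
qed

lemma num_summands_dsum:
  assumes "fd_module K A X" "fd_module K A S"
  shows "num_summands A (dsum X S) = num_summands A X + num_summands A S"
proof -
  interpret X: lmod A X using fdD(1)[OF assms(1)] .
  interpret S: lmod A S using fdD(1)[OF assms(2)] .
  note Zf = dsum_fd[OF assms]
  interpret Z: lmod A "dsum X S" using fdD(1)[OF Zf] .
  show ?thesis
    using Z.num_summands_eq[OF _ fdD(2)[OF Zf]] dsum_dec[OF assms X.submodule_carrier
      X.indec_sum_num_summands[OF fdD(2)[OF assms(1)]] S.indec_sum_num_summands[OF fdD(2)[OF assms(2)]]]
    by (simp add: dsum_simps(1))
qed

text \<open>The summand \<open>S\<close> is added to the middle term and to the end with more summands: in the first case
  below the submodule \<open>U \<oplus> S\<close> of \<open>X \<oplus> S\<close> is used, in the second the quotient \<open>Q \<oplus> S\<close>.\<close>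

lemma summand_gap_add:
  fixes S :: "'a nmod"
  assumes "summand_gap r X U" "fd_module K A S"
  shows "\<exists>Y V. summand_gap (r + num_summands A S) Y V"
proof -
  note gap = assms(1)[unfolded summand_gap_def]
  have X: "fd_module K A X" "submodule U A X" "num_summands A X = r" using gap by auto
  interpret X: lmod A X using fdD(1)[OF X(1)] .
  interpret S: lmod A S using fdD(1)[OF assms(2)] .
  note Zf = dsum_fd[OF X(1) assms(2)]
  interpret Z: lmod A "dsum X S" using fdD(1)[OF Zf] .
  note s = num_summands_dsum[OF X(1) assms(2)]
  from gap consider "r < num_summands A (sub_mod X U)"
    | "\<exists>(Q :: 'a nmod) g. fd_module K A Q \<and> quotient_map A X Q U g \<and> r < num_summands A Q" by auto
  then show ?thesis
  proof cases
    case 1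
    interpret U: lmod A "sub_mod X U" by (rule X.lmod_sub_mod[OF X(2)])
    let ?V = "prod_encode ` (U \<times> carrier S)"
    have "X.indec_sum (num_summands A (sub_mod X U)) U"
      using U.indec_sum_num_summands[OF fdD(2)[OF fd_sub_mod[OF X(1,2)]]] X.indec_sum_sub_mod_iff[OF X(2) order_refl] by simp
    from dsum_dec[OF X(1) assms(2) X(2) this S.indec_sum_num_summands[OF fdD(2)[OF assms(2)]]]
    have d: "Z.indec_sum (num_summands A (sub_mod X U) + num_summands A S) ?V" .
    have "num_summands A (sub_mod (dsum X S) ?V) = num_summands A (sub_mod X U) + num_summands A S"
      by (rule num_summands_sub_mod[OF Zf Z.indec_sum_submodule[OF d] d])
    then have "summand_gap (r + num_summands A S) (dsum X S) ?V"
      unfolding summand_gap_def using Zf Z.indec_sum_submodule[OF d] s X(3) 1 by simp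
    then show ?thesis by (intro exI)
  next
    case 2
    then obtain Q :: "'a nmod" and g where Q: "fd_module K A Q" "quotient_map A X Q U g" "r < num_summands A Q"
      by (elim exE conjE)
    note g = quotient_mapD[OF Q(2)] and gh = mod_homD[OF quotient_mapD(1)[OF Q(2)]]
    interpret Q: lmod A Q using fdD(1)[OF Q(1)] .
    note Yf = dsum_fd[OF Q(1) assms(2)]
    interpret Y: lmod A "dsum Q S" using fdD(1)[OF Yf] .
    let ?G = "\<lambda>z. prod_encode (g (fst (prod_decode z)), snd (prod_decode z))"
    let ?V = "{z \<in> carrier (dsum X S). ?G z = \<zero>\<^bsub>dsum Q S\<^esub>}"
    have G: "?G \<in> mod_hom A (dsum X S) (dsum Q S)"
      by (rule mod_homI)
        (auto simp: dsum_simps(1-3) dsum_simps(4)[OF X.lmod_axioms] dsum_simps(4)[OF Q.lmod_axioms] gh)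
    have "?G ` carrier (dsum X S) = carrier (dsum Q S)"
    proof (intro equalityI subsetI)
      fix y assume "y \<in> carrier (dsum Q S)"
      then obtain x s where "x \<in> carrier X" "s \<in> carrier S" "y = prod_encode (g x, s)"
        unfolding dsum_simps(1) g(2)[symmetric] by auto
      then show "y \<in> ?G ` carrier (dsum X S)"
        by (intro image_eqI[of _ _ "prod_encode (x, s)"]) (simp_all add: dsum_simps(1))
    qed (auto simp: dsum_simps(1) gh)
    then have "quotient_map A (dsum X S) (dsum Q S) ?V ?G" by (rule Z.quotient_map_kernel[OF Y.lmod_axioms G])
    moreover have "r + num_summands A S < num_summands A (dsum Q S)"
      using num_summands_dsum[OF Q(1) assms(2)] Q(3) by simp
    ultimately have "\<exists>(Q' :: 'a nmod) g. fd_module K A Q' \<and> quotient_map A (dsum X S) Q' ?V g \<and>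
        r + num_summands A S < num_summands A Q'" using Yf by (intro exI conjI)
    moreover have "submodule ?V A (dsum X S)" by (rule Z.submodule_kernel[OF Y.lmod_axioms G])
    ultimately have "summand_gap (r + num_summands A S) (dsum X S) ?V"
      unfolding summand_gap_def using Zf s X(3) by simp
    then show ?thesis by (intro exI)
  qed
qed

text \<open>A module violating seriality gives a gap for \<open>r = 1\<close>, and adding copies of it gives gaps for
  all larger \<open>r\<close>.\<close>

lemma ideal_imp_serial:
  assumes "finitary K A" "r \<ge> 1" "ideal (hall_D r K A) H"
  shows "serial_algebra K A"
proof (rule ccontr)
  assume "\<not> serial_algebra K A"
  then obtain M :: "'a nmod" where M: "fd_module K A M" "indecomposable_mod A M" "\<not> uniserial_mod A M"
    unfolding serial_algebra_def by auto
  have "\<exists>X U. summand_gap r X U" using assms(2)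
  proof (induction r rule: dec_induct)
    case base
    show ?case by (rule summand_gap_of_not_uniserial[OF M])
  next
    case (step n)
    then obtain X U where "summand_gap n X U" by (elim exE)
    from summand_gap_add[OF this M(1)] show ?case
      using indecomposable_num_summands[OF M(1,2)] by simp
  qed
  then show False using summand_gap_not_ideal[OF assms(1)] assms(3) by auto
qed

end

theorem theorem1p1:
  fixes K :: "('k, 'm) ring_scheme" and A :: "('k, 'a) module"
  assumes "field K" and "finite (carrier K)"
    and "assoc_algebra K A"
    and "finitary K A"
  shows "(ideal (hall_D 1 K A) (hall_algebra K A) \<longleftrightarrow> serial_algebra K A) \<and>
    (serial_algebra K A \<longleftrightarrow> (\<forall>r\<ge>1. ideal (hall_D r K A) (hall_algebra K A))) \<and>
    ((\<forall>r\<ge>1. ideal (hall_D r K A) (hall_algebra K A)) \<longleftrightarrow>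
      (\<exists>r\<ge>2. ideal (hall_D r K A) (hall_algebra K A)))"
proof -
  interpret finite_field_algebra K A using assms(1-3) by (rule finite_field_algebra.intro)
  have fwd: "ideal (hall_D r K A) (hall_algebra K A)" if "serial_algebra K A" for r
    by (rule serial_imp_ideal[OF assms(4) that])
  have bwd: "serial_algebra K A" if "ideal (hall_D r K A) (hall_algebra K A)" "1 \<le> r" for r
    by (rule ideal_imp_serial[OF assms(4) that(2,1)])
  have 1: "ideal (hall_D 1 K A) (hall_algebra K A) \<longleftrightarrow> serial_algebra K A"
    using fwd bwd[of 1] by auto
  have 2: "serial_algebra K A \<longleftrightarrow> (\<forall>r\<ge>1. ideal (hall_D r K A) (hall_algebra K A))"
    using fwd bwd[of 1] by auto
  have 3: "serial_algebra K A \<longleftrightarrow> (\<exists>r\<ge>2. ideal (hall_D r K A) (hall_algebra K A))"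
  proof
    assume "serial_algebra K A"
    then show "\<exists>r\<ge>2. ideal (hall_D r K A) (hall_algebra K A)" using fwd[of 2] by auto
  next
    assume "\<exists>r\<ge>2. ideal (hall_D r K A) (hall_algebra K A)"
    then obtain r where "2 \<le> r" "ideal (hall_D r K A) (hall_algebra K A)" by auto
    then show "serial_algebra K A" using bwd[of r] by simp
  qed
  show ?thesis using 1 2 3 by simp
qed

end
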